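(* Let $(\mathsf{Gen},\mathsf{Eval},\mathsf{Puncture},\mathsf{Verify})$ be a puncturable cryptographic scheme with input length $n(\lambda)$, and let $\mathsf{UPO}=(\mathsf{UPO.Obf},\mathsf{UPO.Eval})$ be a secure unclonable puncturable obfuscation scheme, with respect to the uniform distribution on $\{0,1\}^{n(\lambda)}\times\{0,1\}^{n(\lambda)}$, for the puncturable keyed circuit class $\{\mathsf{Eval}(sk,\cdot)\}_{sk\in\{0,1\}^\lambda}$, $\lambda\in\mathbb{N}$, equipped with $\mathsf{Puncture}$ as puncturing algorithm. Then copy-protecting $\mathsf{Eval}(sk,\cdot)$ by $\mathsf{UPO.Obf}$ is secure: for every QPT adversary $(\mathcal{A},\mathcal{B},\mathcal{C})$ there is a negligible function $\mathsf{negl}$ such that $$\Pr\left[1\leftarrow \mathsf{PCS.Expt}^{(\mathcal{A},\mathcal{B},\mathcal{C})}(1^\lambda)\right]\le \mathsf{negl}(\lambda).$$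
   Context: QPT means quantum polynomial time. **Puncturable cryptographic scheme.** A tuple of probabilistic polynomial-time algorithms: $\mathsf{Gen}(1^\lambda)$ outputs a secret key $sk\in\{0,1\}^\lambda$ and public auxiliary information $aux$; $\mathsf{Eval}(sk,x)$ is deterministic and outputs a string $y$; $\mathsf{Puncture}(sk,x_1,x_2)$ is deterministic and outputs a circuit $G_{sk,x_1,x_2}$; $\mathsf{Verify}(sk,aux,x,y)$ accepts (outputs 1) or rejects. Inputs $x$ are in $\{0,1\}^{n(\lambda)}$. It must satisfy: (i) correctness: for $(sk,aux)\leftarrow\mathsf{Gen}(1^\lambda)$ and every $x$, $\mathsf{Verify}(sk,aux,x,\mathsf{Eval}(sk,x))$ accepts; (ii) correctness of the punctured circuit: $G_{sk,x_1,x_2}(x)=\mathsf{Eval}(sk,x)$ for $x\notin\{x_1,x_2\}$ and $G_{sk,x_1,x_2}(x)=\bot$ for $x\in\{x_1,x_2\}$; (iii) security: for every QPT $\mathcal{D}$, sampling $(sk,aux)\leftarrow\mathsf{Gen}(1^\lambda)$, $x_1,x_2$ uniform in $\{0,1\}^n$, $G\leftarrow\mathsf{Puncture}(sk,x_1,x_2)$, $y\leftarrow\mathcal{D}(x_1,aux,G)$, the probability that $\mathsf{Verify}(sk,aux,x_1,y)=1$ is negligible. **Puncturable keyed circuit class.** $\mathfrak{C}=\{\mathfrak{C}_\lambda\}$ with $\mathfrak{C}_\lambda=\{C_k:k\in\mathcal{K}_\lambda\}$, polynomial-size circuits of the same size with input length $n(\lambda)$, together with a deterministic polynomial-time $\mathsf{Puncture}$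 which on $(k,x^{\mathcal B},x^{\mathcal C})$ outputs a circuit $G_{k^*}$ (of the same size as $C_k$) with $G_{k^*}(x)=C_k(x)$ for $x\notin\{x^{\mathcal B},x^{\mathcal C}\}$ and $G_{k^*}(x)=\bot$ otherwise. **UPO scheme.** QPT algorithms $\mathsf{Obf}(1^\lambda,C)$, producing a quantum state $\rho_C$ from a circuit $C$ (in $\mathfrak{C}_\lambda$, or punctured), and $\mathsf{Eval}(\rho_C,x)$, producing $(\rho_C',y)$. Correctness: for every $C\in\mathfrak{C}_\lambda$ and $x$, $y=C(x)$ with probability negligibly close to 1. Security with respect to a distribution $\mathcal{D}_{\mathcal X}$ on $\{0,1\}^n\times\{0,1\}^n$: for every QPT $(\mathcal{A},\mathcal{B},\mathcal{C})$, the following experiment with uniformly random $b\in\{0,1\}$ outputs 1 with probability at most $\frac12+\mathsf{negl}(\lambda)$. $\mathcal{A}$ sends $k\in\mathcal{K}_\lambda$; the challenger samples $(x^{\mathcal B},x^{\mathcal C})\leftarrow\mathcal{D}_{\mathcal X}$, computes $G_{k^*}\leftarrow\mathsf{Puncture}(k,x^{\mathcal B},x^{\mathcal C})$ and sends to $\mathcal{A}$ the state $\mathsf{Obf}(1^\lambda,C_k)$ if $b=0$, $\mathsf{Obf}(1^\lambda,G_{k^*})$ if $b=1$; $\mathcal{A}$ outputs a bipartite state $\sigma_{\mathcal{B},\mathcal{C}}$; $(\mathcal{B}(x^{\mathcal B},\cdot)\otimes\mathcal{C}(x^{\mathcal C},\cdot))(\sigma_{\mathcal{B},\mathcal{C}})$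 gives bits $(b_{\mathcal B},b_{\mathcal C})$; output 1 iff $b_{\mathcal B}=b_{\mathcal C}=b$. **$\mathsf{PCS.Expt}^{(\mathcal{A},\mathcal{B},\mathcal{C})}(1^\lambda)$.** The challenger samples $(sk,aux)\leftarrow\mathsf{Gen}(1^\lambda)$, generates $\rho_{sk}\leftarrow\mathsf{UPO.Obf}(1^\lambda,\mathsf{Eval}(sk,\cdot))$ and sends $(\rho_{sk},aux)$ to $\mathcal{A}$; $\mathcal{A}$ produces a bipartite state $\sigma_{\mathcal{B},\mathcal{C}}$; the challenger samples independent uniform $x^{\mathcal B},x^{\mathcal C}\in\{0,1\}^n$; $(\mathcal{B}(x^{\mathcal B},\cdot)\otimes\mathcal{C}(x^{\mathcal C},\cdot))(\sigma_{\mathcal{B},\mathcal{C}})$ gives $(y^{\mathcal B},y^{\mathcal C})$; output 1 iff $\mathsf{Verify}(sk,aux,x^{\mathcal B},y^{\mathcal B})=\mathsf{Verify}(sk,aux,x^{\mathcal C},y^{\mathcal C})=1$.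
   Formalization: Security (iii) of the puncturable scheme is assumed also with the challenge at x_2 (D receives x_2), not only at x_1; with x_1 alone and a Puncture that is not symmetric in its two points, the claim fails (assuming post-quantum indistinguishability obfuscation and one-way functions). *)

theory Defs
  imports
    "HOL-Probability.Probability"
    "HOL-Computational_Algebra.Polynomial"
    "HOL-Library.Monad_Syntax"
begin

section \<open>Quantum programs\<close>

text \<open>
  The machine model is a multi-stack machine with classical control.  Every register \<open>v\<close> carries a
  stack of classical bits and a stack of qubits; the qubit at height \<open>i\<close> of register \<open>v\<close> is named
  \<open>(v, i)\<close>.  A program mentions finitely many registers and does not depend on the security
  parameter, so this is a uniform model.  The gate set (Hadamard, T, CNOT) is universal, and each
  step costs one unit of time.

  All qubits of a memory live in one joint pure state.  Mixed states are probability distributions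
  over memories (measurements and coin tosses branch).  A part of a system that is handed to
  somebody else is a set of registers of this joint memory; the registers that are not handed over
  are never touched again, which has the effect of a partial trace.
\<close>

type_synonym bits = "bool list"

datatype 'v instr =
    Push bool 'v
  | Pop 'v
  | Toss 'v
  | QNew 'v
  | QMove 'v 'v
  | QMeasure 'v
  | Hadamard 'v
  | TGate 'v
  | CNot 'v 'v

datatype 'v test = TopIsOne 'v | NonEmpty 'v | QNonEmpty 'v

datatype 'v prog =
    Skip
  | Do "'v instr"
  | Seq "'v prog" "'v prog"
  | Cond "'v test" "'v prog" "'v prog"
  | While "'v test" "'v prog"

type_synonym 'v config = "'v \<times> nat \<Rightarrow> bool"
type_synonym 'v ket = "'v config \<Rightarrow> complex"

text \<open>
  Kets are amplitude functions on the computational basis.  They are not normalised: a measurement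
  projects without rescaling, and the Born rule divides by the squared norm.
\<close>

record 'v mem =
  cl :: "'v \<Rightarrow> bits"
  ql :: "'v \<Rightarrow> nat"
  amp :: "'v ket"

definition wf_mem :: "'v mem \<Rightarrow> bool" where
  "wf_mem m \<longleftrightarrow> finite {c. amp m c \<noteq> 0} \<and> (\<exists>c. amp m c \<noteq> 0) \<and>
     (\<forall>c v i. amp m c \<noteq> 0 \<longrightarrow> ql m v \<le> i \<longrightarrow> \<not> c (v, i))"

definition empty_mem :: "'v mem" where
  "empty_mem = \<lparr>cl = (\<lambda>_. []), ql = (\<lambda>_. 0), amp = (\<lambda>c. if c = (\<lambda>_. False) then 1 else 0)\<rparr>"

definition norm_sq :: "'v ket \<Rightarrow> real" where
  "norm_sq \<psi> = (\<Sum>c | \<psi> c \<noteq> 0. (cmod (\<psi> c))\<^sup>2)"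

definition prob_one :: "'v \<times> nat \<Rightarrow> 'v ket \<Rightarrow> real" where
  "prob_one q \<psi> = norm_sq (\<lambda>c. if c q then \<psi> c else 0) / norm_sq \<psi>"

definition apply_gate :: "(bool \<Rightarrow> bool \<Rightarrow> complex) \<Rightarrow> 'v \<times> nat \<Rightarrow> 'v ket \<Rightarrow> 'v ket" where
  "apply_gate U q \<psi> = (\<lambda>c. \<Sum>b\<in>UNIV. U (c q) b * \<psi> (c(q := b)))"

definition hadamard_matrix :: "bool \<Rightarrow> bool \<Rightarrow> complex" where
  "hadamard_matrix a b = (if a \<and> b then - 1 else 1) / complex_of_real (sqrt 2)"

definition t_matrix :: "bool \<Rightarrow> bool \<Rightarrow> complex" where
  "t_matrix a b = (if a \<noteq> b then 0 else if a then cis (pi / 4) else 1)"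

definition cnot_ket :: "'v \<times> nat \<Rightarrow> 'v \<times> nat \<Rightarrow> 'v ket \<Rightarrow> 'v ket" where
  "cnot_ket a b \<psi> = (\<lambda>c. \<psi> (c(b := (c b \<noteq> c a))))"

definition swap_ket :: "'v \<times> nat \<Rightarrow> 'v \<times> nat \<Rightarrow> 'v ket \<Rightarrow> 'v ket" where
  "swap_ket a b \<psi> = (\<lambda>c. \<psi> (c(a := c b, b := c a)))"

text \<open>
  Projection onto outcome \<open>b\<close> for qubit \<open>q\<close>, followed by a reset of \<open>q\<close> to zero: measured qubits are
  removed from their stack, and the positions above the top of a stack are always in state zero.
\<close>

definition collapse :: "'v \<times> nat \<Rightarrow> bool \<Rightarrow> 'v ket \<Rightarrow> 'v ket" where
  "collapse q b \<psi> = (\<lambda>c. if c q then 0 else \<psi> (c(q := b)))"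

abbreviation top_qubit :: "'v mem \<Rightarrow> 'v \<Rightarrow> 'v \<times> nat" where
  "top_qubit m v \<equiv> (v, ql m v - 1)"

definition push :: "bool \<Rightarrow> 'v \<Rightarrow> 'v mem \<Rightarrow> 'v mem" where
  "push b v m = m\<lparr>cl := (cl m)(v := b # cl m v)\<rparr>"

fun exec :: "'v instr \<Rightarrow> 'v mem \<Rightarrow> 'v mem pmf" where
  "exec (Push b v) m = return_pmf (push b v m)"
| "exec (Pop v) m = return_pmf (m\<lparr>cl := (cl m)(v := tl (cl m v))\<rparr>)"
| "exec (Toss v) m = map_pmf (\<lambda>b. push b v m) (pmf_of_set UNIV)"
| "exec (QNew v) m = return_pmf (m\<lparr>ql := (ql m)(v := Suc (ql m v))\<rparr>)"
| "exec (QMove v w) m = return_pmf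
     (if ql m v = 0 then m
      else let l = (ql m)(v := ql m v - 1)
           in m\<lparr>ql := l(w := Suc (l w)), amp := swap_ket (top_qubit m v) (w, l w) (amp m)\<rparr>)"
| "exec (QMeasure v) m =
     (if ql m v = 0 then return_pmf m
      else map_pmf
        (\<lambda>b. push b v (m\<lparr>ql := (ql m)(v := ql m v - 1), amp := collapse (top_qubit m v) b (amp m)\<rparr>))
        (bernoulli_pmf (prob_one (top_qubit m v) (amp m))))"
| "exec (Hadamard v) m = return_pmf
     (if ql m v = 0 then m else m\<lparr>amp := apply_gate hadamard_matrix (top_qubit m v) (amp m)\<rparr>)"
| "exec (TGate v) m = return_pmf
     (if ql m v = 0 then m else m\<lparr>amp := apply_gate t_matrix (top_qubit m v) (amp m)\<rparr>)"
| "exec (CNot v w) m = return_pmf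
     (if v = w \<or> ql m v = 0 \<or> ql m w = 0 then m
      else m\<lparr>amp := cnot_ket (top_qubit m v) (top_qubit m w) (amp m)\<rparr>)"

fun holds :: "'v test \<Rightarrow> 'v mem \<Rightarrow> bool" where
  "holds (TopIsOne v) m \<longleftrightarrow> cl m v \<noteq> [] \<and> hd (cl m v)"
| "holds (NonEmpty v) m \<longleftrightarrow> cl m v \<noteq> []"
| "holds (QNonEmpty v) m \<longleftrightarrow> ql m v \<noteq> 0"

primrec step :: "'v prog \<Rightarrow> 'v mem \<Rightarrow> ('v prog \<times> 'v mem) pmf" where
  "step Skip m = return_pmf (Skip, m)"
| "step (Do i) m = map_pmf (Pair Skip) (exec i m)"
| "step (Seq P Q) m =
     (if P = Skip then return_pmf (Q, m) else map_pmf (\<lambda>(P', m'). (Seq P' Q, m')) (step P m))"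
| "step (Cond t P Q) m = return_pmf (if holds t m then P else Q, m)"
| "step (While t P) m = return_pmf (if holds t m then Seq P (While t P) else Skip, m)"

primrec steps :: "nat \<Rightarrow> 'v prog \<Rightarrow> 'v mem \<Rightarrow> ('v prog \<times> 'v mem) pmf" where
  "steps 0 P m = return_pmf (P, m)"
| "steps (Suc n) P m = do { (P', m') \<leftarrow> step P m; steps n P' m' }"

definition halts_within :: "nat \<Rightarrow> 'v prog \<Rightarrow> 'v mem \<Rightarrow> bool" where
  "halts_within n P m \<longleftrightarrow> (\<forall>(Q, m') \<in> set_pmf (steps n P m). Q = Skip)"

text \<open>Meaningful only for programs that halt, within some fixed time, on all branches.\<close>

definition run :: "'v prog \<Rightarrow> 'v mem \<Rightarrow> 'v mem pmf" where
  "run P m = map_pmf snd (steps (LEAST n. halts_within n P m) P m)"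

section \<open>Polynomial-time algorithms\<close>

text \<open>
  The registers of an algorithm are \<open>(p, i)\<close>: register \<open>i\<close> of port \<open>p\<close>.  Ports are the units of
  communication.  A classical string at a port is the bit stack of its register 0; a quantum state
  may occupy all registers of the port.  Port 0 always receives the security parameter in unary, and
  the other arguments follow at ports 1, 2, and so on.
\<close>

type_synonym alg = "(nat \<times> nat) prog"

definition mem_size :: "'v set \<Rightarrow> 'v mem \<Rightarrow> nat" where
  "mem_size R m = (\<Sum>v\<in>R. length (cl m v) + ql m v)"

text \<open>
  The input size counts the registers of the program only.  The qubits of the other registers may
  be entangled with them.
\<close>

definition poly_time :: "alg \<Rightarrow> bool" where
  "poly_time P \<longleftrightarrow> (\<exists>p :: nat poly. \<forall>m. wf_mem m \<longrightarrow>
     halts_within (poly p (mem_size (set_prog P) m)) P m)"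

fun classical_instr :: "'v instr \<Rightarrow> bool" where
  "classical_instr (Push b v) \<longleftrightarrow> True"
| "classical_instr (Pop v) \<longleftrightarrow> True"
| "classical_instr (Toss v) \<longleftrightarrow> True"
| "classical_instr _ \<longleftrightarrow> False"

fun deterministic_instr :: "'v instr \<Rightarrow> bool" where
  "deterministic_instr (Push b v) \<longleftrightarrow> True"
| "deterministic_instr (Pop v) \<longleftrightarrow> True"
| "deterministic_instr _ \<longleftrightarrow> False"

fun classical_test :: "'v test \<Rightarrow> bool" where
  "classical_test (QNonEmpty v) \<longleftrightarrow> False"
| "classical_test _ \<longleftrightarrow> True"

primrec uses_only :: "('v instr \<Rightarrow> bool) \<Rightarrow> ('v test \<Rightarrow> bool) \<Rightarrow> 'v prog \<Rightarrow> bool" where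
  "uses_only I T Skip \<longleftrightarrow> True"
| "uses_only I T (Do i) \<longleftrightarrow> I i"
| "uses_only I T (Seq P Q) \<longleftrightarrow> uses_only I T P \<and> uses_only I T Q"
| "uses_only I T (Cond t P Q) \<longleftrightarrow> T t \<and> uses_only I T P \<and> uses_only I T Q"
| "uses_only I T (While t P) \<longleftrightarrow> T t \<and> uses_only I T P"

definition QPT :: "alg \<Rightarrow> bool" where
  "QPT P \<longleftrightarrow> poly_time P"

definition PPT :: "alg \<Rightarrow> bool" where
  "PPT P \<longleftrightarrow> poly_time P \<and> uses_only classical_instr classical_test P"

definition DPT :: "alg \<Rightarrow> bool" where
  "DPT P \<longleftrightarrow> poly_time P \<and> uses_only deterministic_instr classical_test P"

definition load :: "bits list \<Rightarrow> (nat \<times> nat) mem" where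
  "load ins = empty_mem\<lparr>cl := (\<lambda>(p, i). if i = 0 \<and> p < length ins then ins ! p else [])\<rparr>"

definition out :: "nat \<Rightarrow> alg \<Rightarrow> bits list \<Rightarrow> bits pmf" where
  "out p P ins = map_pmf (\<lambda>m. cl m (p, 0)) (run P (load ins))"

definition unary :: "nat \<Rightarrow> bits" where
  "unary \<eta> = replicate \<eta> True"

definition negl :: "(nat \<Rightarrow> real) \<Rightarrow> bool" where
  "negl \<nu> \<longleftrightarrow> (\<forall>d :: nat. eventually (\<lambda>\<eta>. \<bar>\<nu> \<eta>\<bar> < 1 / real \<eta> ^ d) sequentially)"

definition strings :: "nat \<Rightarrow> bits set" where
  "strings n = {x. length x = n}"

section \<open>Circuits\<close>

text \<open>
  Wires \<open>0, ..., inputs c - 1\<close> of a circuit carry the input and wire \<open>inputs c + j\<close> the value of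
  gate \<open>j\<close>.  The output is bottom (\<open>None\<close>) if the wire \<open>valid c\<close> carries false.
\<close>

datatype gate = Const bool | Nand nat nat

datatype circuit = Circuit (inputs: nat) (gates: "gate list") (valid: nat) (outputs: "nat list")

fun gate_val :: "gate \<Rightarrow> bits \<Rightarrow> bool" where
  "gate_val (Const b) ws = b"
| "gate_val (Nand i j) ws = (\<not> (ws ! i \<and> ws ! j))"

definition wire_vals :: "circuit \<Rightarrow> bits \<Rightarrow> bits" where
  "wire_vals c x = foldl (\<lambda>ws g. ws @ [gate_val g ws]) x (gates c)"

definition ceval :: "circuit \<Rightarrow> bits \<Rightarrow> bits option" where
  "ceval c x = (let ws = wire_vals c x
     in if ws ! valid c then Some (map ((!) ws) (outputs c)) else None)"

fun wf_gate :: "nat \<Rightarrow> gate \<Rightarrow> bool" where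
  "wf_gate w (Const b) \<longleftrightarrow> True"
| "wf_gate w (Nand i j) \<longleftrightarrow> i < w \<and> j < w"

definition wires :: "circuit \<Rightarrow> nat" where
  "wires c = inputs c + length (gates c)"

definition wf_circuit :: "circuit \<Rightarrow> bool" where
  "wf_circuit c \<longleftrightarrow> (\<forall>j < length (gates c). wf_gate (inputs c + j) (gates c ! j)) \<and>
     valid c < wires c \<and> (\<forall>i \<in> set (outputs c). i < wires c)"

definition csize :: "circuit \<Rightarrow> nat" where
  "csize c = wires c + length (outputs c)"

text \<open>
  Description of circuits by bit strings, of length polynomial in the size.  Wire numbers are written
  in a field whose width is the number of wires, so that the length of the description depends only
  on the numbers of inputs, gates and outputs.
\<close>

definition encode_wire :: "nat \<Rightarrow> nat \<Rightarrow> bits" where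
  "encode_wire w i = replicate i True @ replicate (w - i) False"

fun encode_gate :: "nat \<Rightarrow> gate \<Rightarrow> bits" where
  "encode_gate w (Const b) = False # b # replicate (2 * w) False"
| "encode_gate w (Nand i j) = True # False # encode_wire w i @ encode_wire w j"

definition encode :: "circuit \<Rightarrow> bits" where
  "encode c =
     unary (inputs c) @ [False] @ unary (length (gates c)) @ [False] @
     unary (length (outputs c)) @ [False] @
     encode_wire (wires c) (valid c) @
     concat (map (encode_gate (wires c)) (gates c)) @
     concat (map (encode_wire (wires c)) (outputs c))"

lemma unary_append_eq:
  "unary a @ False # xs = unary b @ False # ys \<longleftrightarrow> a = b \<and> xs = ys"
proof (induction a arbitrary: b)
  case 0 then show ?case by (cases b) (auto simp: unary_def)
next
  case (Suc a) then show ?case by (cases b) (auto simp: unary_def)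
qed

lemma length_encode_wire: "i \<le> w \<Longrightarrow> length (encode_wire w i) = w"
  by (simp add: encode_wire_def)
lemma encode_wire_inj: assumes "encode_wire w i = encode_wire w j" shows "i = j"
  using arg_cong[OF assms, of "filter id"] by (simp add: encode_wire_def filter_replicate)
lemma concat_map_inj:
  assumes "length xs = length ys" "concat (map f xs) @ us = concat (map f ys) @ vs"
    and "\<forall>x \<in> set xs. \<forall>y \<in> set ys. length (f x) = length (f y) \<and> (f x = f y \<longrightarrow> x = y)"
  shows "xs = ys \<and> us = vs"
  using assms
proof (induction xs ys rule: list_induct2)
  case Nil
  show ?case using Nil(1) by simp
next
  case (Cons x xs y ys)
  have "x \<in> set (x # xs)" "y \<in> set (y # ys)" by simp_all
  note xy = bspec[OF bspec[OF Cons.prems(2) this(1)] this(2)]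
  have "f x @ (concat (map f xs) @ us) = f y @ (concat (map f ys) @ vs)"
    using Cons.prems(1) by (simp only: list.map concat.simps append_assoc)
  then have *: "f x = f y \<and> concat (map f xs) @ us = concat (map f ys) @ vs"
    by (rule iffD1[OF append_eq_append_conv[OF disjI1[OF conjunct1[OF xy]]]])
  have "\<forall>x \<in> set xs. \<forall>y \<in> set ys. length (f x) = length (f y) \<and> (f x = f y \<longrightarrow> x = y)"
    using Cons.prems(2) unfolding list.set by blast
  then have "xs = ys \<and> us = vs" by (rule Cons.IH[OF conjunct2[OF *]])
  then show ?case using mp[OF conjunct2[OF xy] conjunct1[OF *]] by blast
qed

lemma encode_inj:
  assumes "wf_circuit c" "wf_circuit d" "encode c = encode d"
  shows "c = d"
proof -
  let ?w = "wires c"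
  have hd: "inputs c = inputs d" "length (gates c) = length (gates d)"
      "length (outputs c) = length (outputs d)"
    and tl: "encode_wire (wires c) (valid c) @ concat (map (encode_gate (wires c)) (gates c)) @
       concat (map (encode_wire (wires c)) (outputs c)) =
     encode_wire (wires d) (valid d) @ concat (map (encode_gate (wires d)) (gates d)) @
       concat (map (encode_wire (wires d)) (outputs d))"
    using assms(3) by (simp_all add: encode_def unary_append_eq)
  have w: "wires d = ?w" using hd by (simp add: wires_def)
  have wf: "wf_gate ?w g" if "g \<in> set (gates c) \<union> set (gates d)" for g
  proof -
    have "wf_gate (wires e) g" if e: "wf_circuit e" "g \<in> set (gates e)" for e
    proof -
      obtain j where j: "j < length (gates e)" "g = gates e ! j"
        using e(2) by (auto simp: in_set_conv_nth)
      then have "wf_gate (inputs e + j) g" using e(1) by (auto simp: wf_circuit_def)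
      then show ?thesis using j(1) by (cases g) (auto simp: wires_def)
    qed
    note * = this
    from that show ?thesis
      using *[OF assms(1)] *[OF assms(2)] unfolding w by blast
  qed
  have lg: "length (encode_gate ?w g) = 2 + 2 * ?w" if "wf_gate ?w g" for g
    using that by (cases g) (auto simp: length_encode_wire)
  have wi: "i = j \<and> xs = ys"
    if "encode_wire ?w i @ xs = encode_wire ?w j @ ys" "i \<le> ?w" "j \<le> ?w" for i j xs ys
  proof -
    have "encode_wire ?w i = encode_wire ?w j" "xs = ys"
      using that(1) length_encode_wire[OF that(2)] length_encode_wire[OF that(3)]
      by simp_all
    then show ?thesis using encode_wire_inj by blast
  qed
  have gi: "g = h" if g: "wf_gate ?w g" "wf_gate ?w h" "encode_gate ?w g = encode_gate ?w h" for g h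
  proof (cases g)
    case (Const b)
    then show ?thesis using g by (cases h) simp_all
  next
    case (Nand i j)
    then obtain k l where h: "h = Nand k l" using g(3) by (cases h) simp_all
    have le: "i \<le> ?w" "j \<le> ?w" "k \<le> ?w" "l \<le> ?w" using g(1,2) Nand h by simp_all
    have "encode_wire ?w i @ encode_wire ?w j = encode_wire ?w k @ encode_wire ?w l"
      using g(3) Nand h by simp
    then have "i = k" "encode_wire ?w j = encode_wire ?w l" using wi[OF _ le(1,3)] by auto
    then show ?thesis using encode_wire_inj Nand h by blast
  qed
  have v: "valid c \<le> ?w" "valid d \<le> ?w"
    using assms(1,2) w by (simp_all add: wf_circuit_def)
  have o: "i \<le> ?w" if "i \<in> set (outputs c) \<union> set (outputs d)" for i
    using assms(1,2) w that by (fastforce simp: wf_circuit_def)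
  have 1: "valid c = valid d"
    and 2: "concat (map (encode_gate ?w) (gates c)) @ concat (map (encode_wire ?w) (outputs c)) =
      concat (map (encode_gate ?w) (gates d)) @ concat (map (encode_wire ?w) (outputs d))"
    using wi[OF tl[unfolded w] v] by blast+
  have 3: "gates c = gates d \<and> concat (map (encode_wire ?w) (outputs c)) =
      concat (map (encode_wire ?w) (outputs d))"
  proof (rule concat_map_inj[OF hd(2) 2])
    show "\<forall>g \<in> set (gates c). \<forall>h \<in> set (gates d).
        length (encode_gate ?w g) = length (encode_gate ?w h) \<and>
        (encode_gate ?w g = encode_gate ?w h \<longrightarrow> g = h)"
      using lg[OF wf] gi[OF wf wf] by (metis UnI1 UnI2)
  qed
  then have 4: "concat (map (encode_wire ?w) (outputs c)) @ [] =
      concat (map (encode_wire ?w) (outputs d)) @ []" by simp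
  have "outputs c = outputs d \<and> ([] :: bits) = []"
  proof (rule concat_map_inj[OF hd(3) 4])
    show "\<forall>i \<in> set (outputs c). \<forall>j \<in> set (outputs d).
        length (encode_wire ?w i) = length (encode_wire ?w j) \<and>
        (encode_wire ?w i = encode_wire ?w j \<longrightarrow> i = j)"
      using length_encode_wire[OF o] encode_wire_inj by (metis UnI1 UnI2)
  qed
  with 1 3 hd show ?thesis by (intro circuit.expand) simp
qed

section \<open>Puncturable cryptographic schemes\<close>

text \<open>
  Arguments start at port 1: \<open>gen\<close> outputs the secret key at port 1 and the auxiliary information
  at port 2; \<open>eval sk x\<close> outputs at port 3; \<open>punct sk x1 x2\<close> outputs at port 4;
  \<open>verify sk aux x y\<close> outputs at port 5.
\<close>

record scheme =
  inlen :: "nat \<Rightarrow> nat"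
  gen :: alg
  eval :: alg
  punct :: alg
  verify :: alg

definition gen_out :: "scheme \<Rightarrow> nat \<Rightarrow> (bits \<times> bits) pmf" where
  "gen_out S \<eta> = map_pmf (\<lambda>m. (cl m (1, 0), cl m (2, 0))) (run (gen S) (load [unary \<eta>]))"

definition eval_out :: "scheme \<Rightarrow> nat \<Rightarrow> bits \<Rightarrow> bits \<Rightarrow> bits pmf" where
  "eval_out S \<eta> sk x = out 3 (eval S) [unary \<eta>, sk, x]"

definition punct_out :: "alg \<Rightarrow> nat \<Rightarrow> bits \<Rightarrow> bits \<Rightarrow> bits \<Rightarrow> bits pmf" where
  "punct_out P \<eta> sk x1 x2 = out 4 P [unary \<eta>, sk, x1, x2]"

definition accepts :: "scheme \<Rightarrow> nat \<Rightarrow> bits \<Rightarrow> bits \<Rightarrow> bits \<Rightarrow> bits \<Rightarrow> bool pmf" where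
  "accepts S \<eta> sk aux x y = map_pmf (\<lambda>v. v = [True]) (out 5 (verify S) [unary \<eta>, sk, aux, x, y])"

definition correct_scheme :: "scheme \<Rightarrow> bool" where
  "correct_scheme S \<longleftrightarrow> (\<forall>\<eta>. \<forall>(sk, aux) \<in> set_pmf (gen_out S \<eta>). \<forall>x \<in> strings (inlen S \<eta>).
     do { y \<leftarrow> eval_out S \<eta> sk x; accepts S \<eta> sk aux x y } = return_pmf True)"

definition correct_puncturing :: "scheme \<Rightarrow> bool" where
  "correct_puncturing S \<longleftrightarrow> (\<forall>\<eta>. \<forall>sk \<in> strings \<eta>.
     \<forall>x1 \<in> strings (inlen S \<eta>). \<forall>x2 \<in> strings (inlen S \<eta>).
       \<exists>G. wf_circuit G \<and> inputs G = inlen S \<eta> \<and>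
         punct_out (punct S) \<eta> sk x1 x2 = return_pmf (encode G) \<and>
         (\<forall>x \<in> strings (inlen S \<eta>).
            if x \<in> {x1, x2} then ceval G x = None
            else map_pmf Some (eval_out S \<eta> sk x) = return_pmf (ceval G x)))"

text \<open>
  The punctured circuit depends on the set of punctured points as far as its functionality is
  concerned, but its description may depend on their order.  Security therefore concerns a challenge
  at either one of the two punctured points: the first one if \<open>first\<close> holds, else the second one.
  If \<open>punct\<close> is symmetric, then both cases coincide.  If it is not, then the first case alone would
  allow the description of the punctured circuit to reveal the value at the second point.
\<close>

definition punct_expt :: "scheme \<Rightarrow> bool \<Rightarrow> alg \<Rightarrow> nat \<Rightarrow> bool pmf" where
  "punct_expt S first D \<eta> = do {
     (sk, aux) \<leftarrow> gen_out S \<eta>;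
     x1 \<leftarrow> pmf_of_set (strings (inlen S \<eta>));
     x2 \<leftarrow> pmf_of_set (strings (inlen S \<eta>));
     G \<leftarrow> punct_out (punct S) \<eta> sk x1 x2;
     let x = (if first then x1 else x2);
     y \<leftarrow> out 4 D [unary \<eta>, x, aux, G];
     accepts S \<eta> sk aux x y
   }"

definition secure_scheme :: "scheme \<Rightarrow> bool" where
  "secure_scheme S \<longleftrightarrow>
     (\<forall>D. QPT D \<longrightarrow> (\<forall>first. negl (\<lambda>\<eta>. pmf (punct_expt S first D \<eta>) True)))"

definition puncturable_scheme :: "scheme \<Rightarrow> bool" where
  "puncturable_scheme S \<longleftrightarrow>
     PPT (gen S) \<and> DPT (eval S) \<and> DPT (punct S) \<and> PPT (verify S) \<and>
     (\<forall>\<eta>. \<forall>(sk, aux) \<in> set_pmf (gen_out S \<eta>). length sk = \<eta>) \<and>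
     correct_scheme S \<and> correct_puncturing S \<and> secure_scheme S"

section \<open>Puncturable keyed circuit classes\<close>

record circuit_class =
  keys :: "nat \<Rightarrow> bits set"
  class_inlen :: "nat \<Rightarrow> nat"
  circ :: "nat \<Rightarrow> bits \<Rightarrow> circuit"
  class_punct :: alg

definition puncturable_class :: "circuit_class \<Rightarrow> bool" where
  "puncturable_class K \<longleftrightarrow>
     (\<forall>\<eta>. \<forall>k \<in> keys K \<eta>. wf_circuit (circ K \<eta> k) \<and> inputs (circ K \<eta> k) = class_inlen K \<eta>) \<and>
     (\<forall>\<eta>. \<forall>k \<in> keys K \<eta>. \<forall>k' \<in> keys K \<eta>. csize (circ K \<eta> k) = csize (circ K \<eta> k')) \<and>
     (\<exists>p :: nat poly. \<forall>\<eta>. \<forall>k \<in> keys K \<eta>. csize (circ K \<eta> k) \<le> poly p \<eta>) \<and>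
     DPT (class_punct K) \<and>
     (\<forall>\<eta>. \<forall>k \<in> keys K \<eta>.
        \<forall>xB \<in> strings (class_inlen K \<eta>). \<forall>xC \<in> strings (class_inlen K \<eta>).
          \<exists>G. wf_circuit G \<and> inputs G = class_inlen K \<eta> \<and> csize G = csize (circ K \<eta> k) \<and>
            punct_out (class_punct K) \<eta> k xB xC = return_pmf (encode G) \<and>
            (\<forall>x \<in> strings (class_inlen K \<eta>).
               ceval G x = (if x \<in> {xB, xC} then None else ceval (circ K \<eta> k) x)))"

text \<open>
  A family \<open>F\<close> of circuits for the functions \<open>Eval(sk, \<cdot>)\<close>, and the keyed circuit class it forms
  together with the puncturing algorithm of the scheme.
\<close>

definition computes_eval :: "scheme \<Rightarrow> (nat \<Rightarrow> bits \<Rightarrow> circuit) \<Rightarrow> bool" where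
  "computes_eval S F \<longleftrightarrow> (\<forall>\<eta>. \<forall>sk \<in> strings \<eta>. \<forall>x \<in> strings (inlen S \<eta>).
     map_pmf Some (eval_out S \<eta> sk x) = return_pmf (ceval (F \<eta> sk) x))"

definition eval_class :: "scheme \<Rightarrow> (nat \<Rightarrow> bits \<Rightarrow> circuit) \<Rightarrow> circuit_class" where
  "eval_class S F = \<lparr>keys = strings, class_inlen = inlen S, circ = F, class_punct = punct S\<rparr>"

section \<open>Interaction of several parties\<close>

text \<open>
  In an experiment, all parties work on a joint memory, and port \<open>p\<close> of party \<open>a\<close> consists of the
  registers \<open>(a, p, i)\<close>.  A wiring maps the ports of an algorithm to ports of the joint memory.
  By default, an algorithm run by \<open>a\<close> is connected to the ports of \<open>a\<close>, which no other party can
  access.  A (quantum) message is sent by connecting an input port of the receiver to the output port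
  of the sender.  Programs with disjoint registers act on different tensor factors, and the order in
  which they are run is irrelevant.
\<close>

datatype party = Obfuscator | Evaluator | Alice | Bob | Charlie

type_synonym port = "party \<times> nat"
type_synonym joint_mem = "(party \<times> nat \<times> nat) mem"

definition run_wired :: "(nat \<Rightarrow> port) \<Rightarrow> alg \<Rightarrow> joint_mem \<Rightarrow> joint_mem pmf" where
  "run_wired w P m = run (map_prog (\<lambda>(p, i). (fst (w p), snd (w p), i)) P) m"

definition deliver :: "port \<Rightarrow> bits \<Rightarrow> joint_mem \<Rightarrow> joint_mem" where
  "deliver r s m = m\<lparr>cl := (cl m)((fst r, snd r, 0) := s)\<rparr>"

definition received :: "port \<Rightarrow> joint_mem \<Rightarrow> bits" where
  "received r m = cl m (fst r, snd r, 0)"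

section \<open>Unclonable puncturable obfuscation\<close>

text \<open>
  \<open>obf\<close> takes the description of a circuit at port 1 and outputs a state at port 2.  \<open>upo_eval\<close> takes
  a state at port 1 and a string at port 2; it leaves the new state at port 1 and outputs a string
  at port 3.
\<close>

record upo =
  obf :: alg
  upo_eval :: alg

definition obfuscate :: "upo \<Rightarrow> nat \<Rightarrow> bits \<Rightarrow> joint_mem \<Rightarrow> joint_mem pmf" where
  "obfuscate U \<eta> c m = run_wired (Pair Obfuscator) (obf U)
     (deliver (Obfuscator, 0) (unary \<eta>) (deliver (Obfuscator, 1) c m))"

definition correct_upo :: "upo \<Rightarrow> circuit_class \<Rightarrow> bool" where
  "correct_upo U K \<longleftrightarrow> (\<exists>\<nu>. negl \<nu> \<and>
     (\<forall>\<eta>. \<forall>k \<in> keys K \<eta>. \<forall>x \<in> strings (class_inlen K \<eta>).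
        pmf (do {
          m \<leftarrow> obfuscate U \<eta> (encode (circ K \<eta> k)) empty_mem;
          m \<leftarrow> run_wired ((Pair Evaluator)(1 := (Obfuscator, 2))) (upo_eval U)
            (deliver (Evaluator, 0) (unary \<eta>) (deliver (Evaluator, 2) x m));
          return_pmf (ceval (circ K \<eta> k) x = Some (received (Evaluator, 3) m))
        }) True \<ge> 1 - \<nu> \<eta>))"

text \<open>
  The adversary Alice receives the obfuscated program at port 1 and outputs a bipartite state at
  ports 3 and 4.  Bob and Charlie receive their input at port 1 and their half of the
  state at port 2, and they output at port 3.
\<close>

abbreviation wire_Alice :: "nat \<Rightarrow> port" where
  "wire_Alice \<equiv> (Pair Alice)(1 := (Obfuscator, 2))"

definition run_Bob_Charlie ::
  "alg \<Rightarrow> alg \<Rightarrow> nat \<Rightarrow> bits \<Rightarrow> bits \<Rightarrow> joint_mem \<Rightarrow> (bits \<times> bits) pmf" where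
  "run_Bob_Charlie B C \<eta> xB xC m = do {
     m \<leftarrow> run_wired ((Pair Bob)(2 := (Alice, 3))) B
       (deliver (Bob, 0) (unary \<eta>) (deliver (Bob, 1) xB m));
     m \<leftarrow> run_wired ((Pair Charlie)(2 := (Alice, 4))) C
       (deliver (Charlie, 0) (unary \<eta>) (deliver (Charlie, 1) xC m));
     return_pmf (received (Bob, 3) m, received (Charlie, 3) m)
   }"

text \<open>
  Alice has two stages, \<open>A1\<close> (which outputs the key at port 2) and \<open>A2\<close>, which share her memory.
  An adversary that sends something else than a key loses.
\<close>

definition upo_expt ::
  "upo \<Rightarrow> circuit_class \<Rightarrow> (nat \<Rightarrow> (bits \<times> bits) pmf) \<Rightarrow> alg \<Rightarrow> alg \<Rightarrow> alg \<Rightarrow> alg \<Rightarrow> nat \<Rightarrow> bool pmf"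
where
  "upo_expt U K DX A1 A2 B C \<eta> = do {
     b \<leftarrow> pmf_of_set UNIV;
     m \<leftarrow> run_wired (Pair Alice) A1 (deliver (Alice, 0) (unary \<eta>) empty_mem);
     let k = received (Alice, 2) m;
     if k \<notin> keys K \<eta> then return_pmf False
     else do {
       (xB, xC) \<leftarrow> DX \<eta>;
       G \<leftarrow> punct_out (class_punct K) \<eta> k xB xC;
       m \<leftarrow> obfuscate U \<eta> (if b then G else encode (circ K \<eta> k)) m;
       m \<leftarrow> run_wired wire_Alice A2 m;
       (bB, bC) \<leftarrow> run_Bob_Charlie B C \<eta> xB xC m;
       return_pmf (bB = [b] \<and> bC = [b])
     }
   }"

definition secure_upo :: "upo \<Rightarrow> circuit_class \<Rightarrow> (nat \<Rightarrow> (bits \<times> bits) pmf) \<Rightarrow> bool" where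
  "secure_upo U K DX \<longleftrightarrow> (\<forall>A1 A2 B C. QPT A1 \<and> QPT A2 \<and> QPT B \<and> QPT C \<longrightarrow>
     (\<exists>\<nu>. negl \<nu> \<and> (\<forall>\<eta>. pmf (upo_expt U K DX A1 A2 B C \<eta>) True \<le> 1 / 2 + \<nu> \<eta>)))"

definition secure_upo_scheme ::
  "upo \<Rightarrow> circuit_class \<Rightarrow> (nat \<Rightarrow> (bits \<times> bits) pmf) \<Rightarrow> bool" where
  "secure_upo_scheme U K DX \<longleftrightarrow>
     QPT (obf U) \<and> QPT (upo_eval U) \<and> correct_upo U K \<and> secure_upo U K DX"

definition uniform_pairs :: "(nat \<Rightarrow> nat) \<Rightarrow> nat \<Rightarrow> (bits \<times> bits) pmf" where
  "uniform_pairs n \<eta> = pmf_of_set (strings (n \<eta>) \<times> strings (n \<eta>))"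

section \<open>Copy-protection experiment\<close>

text \<open>Here Alice additionally receives the auxiliary information at port 2.\<close>

definition pcs_expt ::
  "scheme \<Rightarrow> (nat \<Rightarrow> bits \<Rightarrow> circuit) \<Rightarrow> upo \<Rightarrow> alg \<Rightarrow> alg \<Rightarrow> alg \<Rightarrow> nat \<Rightarrow> bool pmf" where
  "pcs_expt S F U A B C \<eta> = do {
     (sk, aux) \<leftarrow> gen_out S \<eta>;
     m \<leftarrow> obfuscate U \<eta> (encode (F \<eta> sk)) empty_mem;
     m \<leftarrow> run_wired wire_Alice A (deliver (Alice, 0) (unary \<eta>) (deliver (Alice, 2) aux m));
     xB \<leftarrow> pmf_of_set (strings (inlen S \<eta>));
     xC \<leftarrow> pmf_of_set (strings (inlen S \<eta>));
     (yB, yC) \<leftarrow> run_Bob_Charlie B C \<eta> xB xC m;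
     vB \<leftarrow> accepts S \<eta> sk aux xB yB;
     vC \<leftarrow> accepts S \<eta> sk aux xC yC;
     return_pmf (vB \<and> vC)
   }"

end

theory Submission
  imports Defs
begin

text \<open>
  A pirate \<open>(A, B, C)\<close> is turned into an attack on the obfuscation.  The first stage of Alice samples
  \<open>(sk, aux)\<close> and submits \<open>sk\<close>; the second stage runs \<open>A\<close> and attaches \<open>(sk, aux)\<close> to both halves of
  the state, so that Bob and Charlie can verify their own answers and guess \<open>b = 0\<close> iff they are
  accepted.  If \<open>b = 0\<close>, both are right with the probability \<open>p\<close> that the pirate wins.  If \<open>b = 1\<close>,
  each of them is accepted with negligible probability, by the security of the punctured scheme:
  the puncturing adversary obfuscates the punctured circuit on its own and runs \<open>A\<close> together with
  only one of \<open>B\<close> and \<open>C\<close>, which is sound because programs on disjoint registers commute.  Hence the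
  attack wins with probability at least \<open>p / 2 + (1 - negl) / 2\<close>, and \<open>p\<close> is negligible.
\<close>

section \<open>Semantics of programs\<close>


text \<open>The comparison with the pirate's experiment is an equality of distributions, but the
  attack leaves the garbage of \<open>gen\<close> and \<open>verify\<close> in the joint memory.
  Equations are therefore stated after erasing the ports from \<open>N\<close> on, which the
  remaining programs never access. Classical algorithms run embedded in a memory whose qubits stay
  entangled; quantum ones are moved past classical writes by a frame rule. Commutation is delicate
  for measurements, because the distribution of the second outcome depends on the first. Kets are
  not normalised, so the joint probability of two outcomes is the squared norm of a doubly projected
  ket divided by that of the original, which is symmetric in the two. Since Bob runs before Charlie,
  only Charlie's marginal needs this. Polynomial time refers to registers numbered by pairs, whereas
  a puncturing adversary simulates several parties. A bijection of all registers, chosen freely away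
  from the interface, turns the joint program into one algorithm.\<close>

lemma finite_set_prog [simp]: "finite (set_prog P)"
proof (induction P)
  case (Do i)
  show ?case by (cases i) auto
next
  case (Cond t P Q)
  then show ?case by (cases t) auto
next
  case (While t P)
  then show ?case by (cases t) auto
qed auto

lemma uses_only_True [simp]: "uses_only (\<lambda>_. True) (\<lambda>_. True) P"
  by (induction P) auto

lemma map_prog_eq_Skip [simp]: "map_prog h P = Skip \<longleftrightarrow> P = Skip"
  by (cases P) auto

text \<open>Inductions over \<open>steps\<close> pass to the residual program, so what is assumed
  about the registers and instructions of a program has to survive one step.\<close>

lemma step_preserves:
  assumes "(P', m') \<in> set_pmf (step P m)"
  shows "set_prog P' \<subseteq> set_prog P" and "uses_only I T P \<Longrightarrow> uses_only I T P'"
proof -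
  have "set_prog P' \<subseteq> set_prog P \<and> (uses_only I T P \<longrightarrow> uses_only I T P')"
    using assms
  proof (induction P arbitrary: P' m')
    case (Seq P Q)
    show ?case
    proof (cases "P = Skip")
      case True
      then show ?thesis using Seq.prems by auto
    next
      case False
      then obtain P1 where "(P1, m') \<in> set_pmf (step P m)" "P' = Seq P1 Q"
        using Seq.prems by auto
      with Seq.IH(1) show ?thesis by fastforce
    qed
  qed auto
  then show "set_prog P' \<subseteq> set_prog P" and "uses_only I T P \<Longrightarrow> uses_only I T P'" by auto
qed

text \<open>Every step executes one instruction or none, and which one it is depends only on the stack
  heights and classical data of the registers of the program.\<close>

definition agree :: "'v set \<Rightarrow> 'v mem \<Rightarrow> 'v mem \<Rightarrow> bool" where
  "agree R m m' \<longleftrightarrow> (\<forall>v\<in>R. cl m v = cl m' v \<and> ql m v = ql m' v)"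

lemma agree_mono: "agree R m m' \<Longrightarrow> R' \<subseteq> R \<Longrightarrow> agree R' m m'"
  by (auto simp: agree_def)

lemma holds_agree: "agree (set_test t) m m' \<Longrightarrow> holds t m = holds t m'"
  by (cases t) (auto simp: agree_def)

text \<open>In both cases the residual program \<open>P'\<close> is chosen before \<open>m'\<close>:
  it depends neither on the outcome of the instruction nor on amplitudes. This makes the next steps
  of two programs exchangeable.\<close>

lemma step_cases:
  obtains (silent) P' where "\<And>m'. agree (set_prog P) m m' \<Longrightarrow> step P m' = return_pmf (P', m')"
  | (exec) i P' where "set_instr i \<subseteq> set_prog P"
      "\<And>m'. agree (set_prog P) m m' \<Longrightarrow> step P m' = map_pmf (Pair P') (exec i m')"
proof -
  have "(\<exists>P'. \<forall>m'. agree (set_prog P) m m' \<longrightarrow> step P m' = return_pmf (P', m')) \<or>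
    (\<exists>i P'. set_instr i \<subseteq> set_prog P \<and>
      (\<forall>m'. agree (set_prog P) m m' \<longrightarrow> step P m' = map_pmf (Pair P') (exec i m')))"
  proof (induction P)
    case Skip
    then show ?case by auto
  next
    case (Do i)
    show ?case by (rule disjI2, rule exI[of _ i], rule exI[of _ Skip]) auto
  next
    case (Seq P Q)
    show ?case
    proof (cases "P = Skip")
      case True
      then show ?thesis by auto
    next
      case False
      from Seq.IH(1) show ?thesis
      proof
        assume "\<exists>P'. \<forall>m'. agree (set_prog P) m m' \<longrightarrow> step P m' = return_pmf (P', m')"
        then obtain P' where "\<forall>m'. agree (set_prog P) m m' \<longrightarrow> step P m' = return_pmf (P', m')" ..
        with False show ?thesis
          by (intro disjI1 exI[of _ "Seq P' Q"]) (auto dest: agree_mono)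
      next
        assume "\<exists>i P'. set_instr i \<subseteq> set_prog P \<and>
          (\<forall>m'. agree (set_prog P) m m' \<longrightarrow> step P m' = map_pmf (Pair P') (exec i m'))"
        then obtain i P' where "set_instr i \<subseteq> set_prog P"
          "\<forall>m'. agree (set_prog P) m m' \<longrightarrow> step P m' = map_pmf (Pair P') (exec i m')" by blast
        with False show ?thesis
          by (intro disjI2 exI[of _ i] exI[of _ "Seq P' Q"])
            (auto dest: agree_mono simp: pmf.map_comp o_def)
      qed
    qed
  next
    case (Cond t P Q)
    have "holds t m' = holds t m" if "agree (set_prog (Cond t P Q)) m m'" for m'
      using that by (intro holds_agree[symmetric]) (auto dest: agree_mono)
    then show ?case by (intro disjI1 exI[of _ "if holds t m then P else Q"]) simp
  next
    case (While t P)
    have "holds t m' = holds t m" if "agree (set_prog (While t P)) m m'" for m'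
      using that by (intro holds_agree[symmetric]) (auto dest: agree_mono)
    then show ?case by (intro disjI1 exI[of _ "if holds t m then Seq P (While t P) else Skip"]) simp
  qed
  then show ?thesis using that by blast
qed

lemma finite_set_exec [simp]: "finite (set_pmf (exec i m))"
  by (cases i) (auto intro: finite_subset[OF subset_UNIV])

lemma finite_set_step [simp]: "finite (set_pmf (step P m))"
proof (cases rule: step_cases[of P m])
  case (silent P')
  then show ?thesis by (auto simp: agree_def)
next
  case (exec i P')
  then show ?thesis by (auto simp: agree_def)
qed

lemma finite_set_steps [simp]: "finite (set_pmf (steps n P m))"
  by (induction n arbitrary: P m) (auto split: prod.splits)

lemma set_step_cases:
  assumes "(P', m') \<in> set_pmf (step P m)"
  obtains "m' = m" | i where "set_instr i \<subseteq> set_prog P" "m' \<in> set_pmf (exec i m)"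
proof (cases rule: step_cases[of P m])
  case (silent P'')
  then show ?thesis using assms that by (auto simp: agree_def)
next
  case (exec i P'')
  then show ?thesis using assms that by (auto simp: agree_def)
qed

lemma steps_invariant:
  assumes "(P', m') \<in> set_pmf (steps n P m)"
    and "\<And>i m m'. set_instr i \<subseteq> set_prog P \<Longrightarrow> J m \<Longrightarrow> m' \<in> set_pmf (exec i m) \<Longrightarrow> J m'"
    and "J m"
  shows "J m'"
  using assms
proof (induction n arbitrary: P m)
  case 0
  then show ?case by simp
next
  case (Suc n)
  from Suc.prems(1) obtain P1 m1 where 1: "(P1, m1) \<in> set_pmf (step P m)"
    and 2: "(P', m') \<in> set_pmf (steps n P1 m1)" by auto
  have "J m1" using 1 Suc.prems(2,3) by (metis set_step_cases)
  with 2 show ?case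
    using Suc.IH Suc.prems(2) step_preserves(1)[OF 1] by (meson subset_trans)
qed

subsection \<open>Halting\<close>

lemma steps_Skip [simp]: "steps n Skip m = return_pmf (Skip, m)"
  by (induction n) (auto simp: bind_return_pmf)

lemma steps_add: "steps (a + b) P m = steps a P m \<bind> (\<lambda>(P', m'). steps b P' m')"
  by (induction a arbitrary: P m)
    (auto simp: bind_return_pmf bind_assoc_pmf split_def)

text \<open>A halted program idles at \<open>Skip\<close>, so surplus steps change nothing. Hence
  any sufficient bound may replace the least one in \<open>run\<close>.\<close>

lemma halts_within_steps_add:
  assumes "halts_within n P m" shows "steps (n + k) P m = steps n P m"
proof -
  have "steps (n + k) P m = steps n P m \<bind> return_pmf"
    unfolding steps_add using assms
    by (intro bind_pmf_cong) (auto simp: halts_within_def split_def)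
  then show ?thesis by (simp add: bind_return_pmf')
qed

lemma halts_within_mono: "halts_within n P m \<Longrightarrow> n \<le> k \<Longrightarrow> halts_within k P m"
  using halts_within_steps_add[of n P m "k - n"] by (simp add: halts_within_def)

lemma run_eq:
  assumes "halts_within n P m" shows "run P m = map_pmf snd (steps n P m)"
proof -
  let ?k = "LEAST n. halts_within n P m"
  have "halts_within ?k P m" by (rule LeastI) fact
  moreover have "?k \<le> n" by (rule Least_le) fact
  ultimately show ?thesis unfolding run_def
    using halts_within_steps_add[of ?k P m "n - ?k"] by simp
qed

definition halts :: "'v prog \<Rightarrow> 'v mem \<Rightarrow> bool" where
  "halts P m \<longleftrightarrow> (\<exists>n. halts_within n P m)"

lemma halts_withinI:
  assumes "steps n P m = map_pmf (Pair Skip) D"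
  shows "halts_within n P m" and "run P m = D"
proof -
  show "halts_within n P m" using assms by (auto simp: halts_within_def)
  from run_eq[OF this] show "run P m = D" by (simp add: assms pmf.map_comp o_def)
qed

lemma halts_within_0: "halts_within 0 P m \<longleftrightarrow> P = Skip"
  by (auto simp: halts_within_def)

lemma halts_within_Suc:
  "halts_within (Suc n) P m \<longleftrightarrow> (\<forall>(P', m') \<in> set_pmf (step P m). halts_within n P' m')"
  by (auto simp: halts_within_def)

text \<open>The additional step discards the finished \<open>Skip\<close> in front of
  \<open>Q\<close>. On branches where \<open>P\<close> ends early, \<open>Q\<close> starts early and
  idles for the remaining time.\<close>

lemma steps_Seq:
  assumes "halts_within a P m" "\<And>P' m'. (P', m') \<in> set_pmf (steps a P m) \<Longrightarrow> halts_within b Q m'"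
  shows "steps (Suc (a + b)) (Seq P Q) m = steps a P m \<bind> (\<lambda>(_, m'). steps b Q m')"
  using assms
proof (induction a arbitrary: P m)
  case 0
  then show ?case by (simp add: halts_within_0 bind_return_pmf)
next
  case (Suc a)
  show ?case
  proof (cases "P = Skip")
    case True
    have "halts_within b Q m" using Suc.prems(2) True by simp
    then have "steps (Suc b) Q m = steps b Q m" using halts_within_steps_add[of b Q m 1] by simp
    with True show ?thesis
      using halts_within_steps_add[OF \<open>halts_within b Q m\<close>, of "Suc a"]
      by (simp add: bind_return_pmf add.commute)
  next
    case False
    have "steps (Suc (Suc a + b)) (Seq P Q) m =
        step P m \<bind> (\<lambda>(P', m'). steps (Suc (a + b)) (Seq P' Q) m')"
      using False by (simp add: bind_map_pmf split_def)
    also have "\<dots> = step P m \<bind> (\<lambda>(P', m'). steps a P' m' \<bind> (\<lambda>(_, m'). steps b Q m'))"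
    proof (intro bind_pmf_cong refl)
      fix x assume "x \<in> set_pmf (step P m)"
      moreover obtain P' m' where x: "x = (P', m')" by (cases x)
      ultimately have 1: "(P', m') \<in> set_pmf (step P m)" by simp
      have "halts_within b Q m''" if "(P'', m'') \<in> set_pmf (steps a P' m')" for P'' m''
        using 1 that Suc.prems(2)[of P'' m''] by force
      with 1 show "(case x of (P', m') \<Rightarrow> steps (Suc (a + b)) (Seq P' Q) m') =
          (case x of (P', m') \<Rightarrow> steps a P' m' \<bind> (\<lambda>(_, m'). steps b Q m'))"
        unfolding x prod.case using Suc.prems(1)
        by (intro Suc.IH) (auto simp: halts_within_Suc)
    qed
    finally show ?thesis by (simp add: bind_assoc_pmf split_def)
  qed
qed

lemma set_run:
  assumes "halts_within n P m" shows "set_pmf (run P m) = snd ` set_pmf (steps n P m)"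
  by (simp add: run_eq[OF assms])

lemma halts_within_Seq:
  assumes "halts_within a P m" "\<And>m'. m' \<in> set_pmf (run P m) \<Longrightarrow> halts_within b Q m'"
  shows "halts_within (Suc (a + b)) (Seq P Q) m"
    and "run (Seq P Q) m = run P m \<bind> run Q"
proof -
  have b: "halts_within b Q m'" if "(P', m') \<in> set_pmf (steps a P m)" for P' m'
    using assms that by (force simp: set_run)
  note eq = steps_Seq[OF assms(1) b, simplified]
  show 1: "halts_within (Suc (a + b)) (Seq P Q) m"
    unfolding halts_within_def using b eq by (fastforce simp: halts_within_def)
  have "run (Seq P Q) m = steps a P m \<bind> (\<lambda>(_, m'). map_pmf snd (steps b Q m'))"
    by (subst run_eq[OF 1], subst steps_Seq[OF assms(1) b])
      (auto simp: map_bind_pmf split_def)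
  also have "\<dots> = steps a P m \<bind> (\<lambda>(_, m'). run Q m')"
    using b by (intro bind_pmf_cong) (auto dest!: b simp: run_eq)
  also have "\<dots> = run P m \<bind> run Q"
    by (simp add: run_eq[OF assms(1)] bind_map_pmf split_def)
  finally show "run (Seq P Q) m = run P m \<bind> run Q" .
qed

lemma finite_set_run:
  assumes "halts P m" shows "finite (set_pmf (run P m))"
  using assms by (auto simp: halts_def set_run)

text \<open>\<open>halts\<close> allows a different bound for every memory, whereas
  \<open>steps\<close> takes one number for all branches. Runs have finitely many outcomes, so the
  maximum of their bounds serves all of them.\<close>

lemma halts_uniform:
  assumes "finite M" "\<And>m. m \<in> M \<Longrightarrow> halts P m"
  obtains n where "\<And>m. m \<in> M \<Longrightarrow> halts_within n P m"
proof -
  have "\<exists>n. \<forall>m\<in>M. halts_within n P m" using assms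
  proof (induction M)
    case (insert m M)
    then obtain n where "\<forall>m\<in>M. halts_within n P m" by auto
    moreover obtain k where "halts_within k P m"
      using insert.prems by (auto simp: halts_def)
    ultimately show ?case
      by (intro exI[of _ "max n k"]) (auto intro: halts_within_mono)
  qed simp
  with that show ?thesis by blast
qed

lemma run_Seq:
  assumes "halts P m" "\<And>m'. m' \<in> set_pmf (run P m) \<Longrightarrow> halts Q m'"
  shows "halts (Seq P Q) m" and "run (Seq P Q) m = run P m \<bind> run Q"
proof -
  obtain b where b: "\<And>m'. m' \<in> set_pmf (run P m) \<Longrightarrow> halts_within b Q m'"
    using halts_uniform[of "set_pmf (run P m)" Q] finite_set_run assms by metis
  obtain a where a: "halts_within a P m" using assms(1) by (auto simp: halts_def)
  from halts_within_Seq[OF a b] show "halts (Seq P Q) m" "run (Seq P Q) m = run P m \<bind> run Q"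
    by (auto simp: halts_def)
qed

lemma run_Skip: "halts_within 0 Skip m" "run Skip m = return_pmf m"
  using halts_withinI[of 0 Skip m "return_pmf m"] by simp_all

lemma run_Do: "halts_within 1 (Do i) m" "run (Do i) m = exec i m"
  using halts_withinI[of 1 "Do i" m "exec i m"]
  by (simp_all add: bind_return_pmf' split_def)

lemma run_silent:
  assumes "step P m = return_pmf (Q, m)" "halts_within n Q m"
  shows "halts_within (Suc n) P m" and "run P m = run Q m"
proof -
  have *: "steps (Suc n) P m = steps n Q m" by (simp add: assms(1) bind_return_pmf)
  show "halts_within (Suc n) P m" using assms(2) unfolding halts_within_def * .
  from run_eq[OF this] show "run P m = run Q m" unfolding * using run_eq[OF assms(2)] by simp
qed

lemma run_Cond:
  assumes "halts_within n (if holds t m then P else Q) m"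
  shows "halts_within (Suc n) (Cond t P Q) m"
    and "run (Cond t P Q) m = (if holds t m then run P m else run Q m)"
  using run_silent[of "Cond t P Q" m "if holds t m then P else Q" n] assms by (auto split: if_splits)

lemma run_While_False:
  assumes "\<not> holds t m"
  shows "halts_within 1 (While t P) m" "run (While t P) m = return_pmf m"
  using run_silent[of "While t P" m Skip 0] assms run_Skip[of m] by auto

lemma run_While_True:
  assumes "holds t m" "halts_within n (Seq P (While t P)) m"
  shows "halts_within (Suc n) (While t P) m" "run (While t P) m = run (Seq P (While t P)) m"
  using run_silent[of "While t P" m "Seq P (While t P)" n] assms by auto

subsection \<open>Simulation\<close>

text \<open>One induction serves three maps \<open>\<phi>\<close> between memories: renaming
  registers, overwriting untouched ones (\<open>h\<close> is the identity), and planting classical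
  data in a quantum memory. The last one respects only classical instructions and tests, hence the
  predicates \<open>I\<close> and \<open>T\<close>.\<close>

lemma step_simulation:
  assumes "\<And>i m. I i \<Longrightarrow> set_instr i \<subseteq> R \<Longrightarrow> exec (map_instr h i) (\<phi> m) = map_pmf \<phi> (exec i m)"
    and "\<And>t m. T t \<Longrightarrow> set_test t \<subseteq> R \<Longrightarrow> holds (map_test h t) (\<phi> m) = holds t m"
    and "uses_only I T P" "set_prog P \<subseteq> R"
  shows "step (map_prog h P) (\<phi> m) = map_pmf (map_prod (map_prog h) \<phi>) (step P m)"
  using assms(3,4)
proof (induction P)
  case (Do i)
  then show ?case using assms(1)[of i m] by (simp add: pmf.map_comp o_def)
next
  case (Seq P Q)
  then show ?case by (simp add: pmf.map_comp o_def split_def map_prod_def)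
qed (auto simp: assms(2))

lemma steps_simulation:
  assumes "\<And>i m. I i \<Longrightarrow> set_instr i \<subseteq> R \<Longrightarrow> exec (map_instr h i) (\<phi> m) = map_pmf \<phi> (exec i m)"
    and "\<And>t m. T t \<Longrightarrow> set_test t \<subseteq> R \<Longrightarrow> holds (map_test h t) (\<phi> m) = holds t m"
    and "uses_only I T P" "set_prog P \<subseteq> R"
  shows "steps n (map_prog h P) (\<phi> m) = map_pmf (map_prod (map_prog h) \<phi>) (steps n P m)"
  using assms(3,4)
proof (induction n arbitrary: P m)
  case (Suc n)
  have "steps (Suc n) (map_prog h P) (\<phi> m) =
      step P m \<bind> (\<lambda>(P', m'). steps n (map_prog h P') (\<phi> m'))"
    by (simp add: step_simulation[OF assms(1,2) Suc.prems] bind_map_pmf split_def)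
  also have "\<dots> = step P m \<bind> (\<lambda>(P', m'). map_pmf (map_prod (map_prog h) \<phi>) (steps n P' m'))"
  proof (intro bind_pmf_cong refl)
    fix x assume "x \<in> set_pmf (step P m)"
    moreover obtain P' m' where x: "x = (P', m')" by (cases x)
    ultimately have "(P', m') \<in> set_pmf (step P m)" by simp
    from step_preserves[OF this] show "(case x of (P', m') \<Rightarrow> steps n (map_prog h P') (\<phi> m')) =
        (case x of (P', m') \<Rightarrow> map_pmf (map_prod (map_prog h) \<phi>) (steps n P' m'))"
      unfolding x prod.case using Suc.prems by (intro Suc.IH) auto
  qed
  finally show ?case by (simp add: map_bind_pmf split_def)
qed simp

lemma run_simulation:
  assumes "\<And>i m. I i \<Longrightarrow> set_instr i \<subseteq> R \<Longrightarrow> exec (map_instr h i) (\<phi> m) = map_pmf \<phi> (exec i m)"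
    and "\<And>t m. T t \<Longrightarrow> set_test t \<subseteq> R \<Longrightarrow> holds (map_test h t) (\<phi> m) = holds t m"
    and "uses_only I T P" "set_prog P \<subseteq> R"
  shows "halts_within n (map_prog h P) (\<phi> m) \<longleftrightarrow> halts_within n P m"
    and "run (map_prog h P) (\<phi> m) = map_pmf \<phi> (run P m)"
proof -
  note steps = steps_simulation[OF assms, simplified]
  show *: "halts_within n (map_prog h P) (\<phi> m) \<longleftrightarrow> halts_within n P m" for n
    by (auto simp: halts_within_def steps)
  \<comment> \<open>The sufficient bounds coincide, so both sides of \<open>run\<close> use the same
    least one.\<close>
  show "run (map_prog h P) (\<phi> m) = map_pmf \<phi> (run P m)"
    unfolding run_def * by (simp add: steps pmf.map_comp o_def)
qed

section \<open>Kets\<close>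

abbreviation support :: "'v ket \<Rightarrow> 'v config set" where
  "support \<psi> \<equiv> {c. \<psi> c \<noteq> 0}"

definition proj :: "'v \<times> nat \<Rightarrow> bool \<Rightarrow> 'v ket \<Rightarrow> 'v ket" where
  "proj q b \<psi> = (\<lambda>c. if c q = b then \<psi> c else 0)"

lemma prob_one_proj: "prob_one q \<psi> = norm_sq (proj q True \<psi>) / norm_sq \<psi>"
  by (simp add: prob_one_def proj_def)

lemma norm_sq_superset:
  "finite M \<Longrightarrow> support \<psi> \<subseteq> M \<Longrightarrow> norm_sq \<psi> = (\<Sum>c\<in>M. (cmod (\<psi> c))\<^sup>2)"
  unfolding norm_sq_def by (rule sum.mono_neutral_left) auto

lemma norm_sq_nonneg [simp]: "norm_sq \<psi> \<ge> 0"
  by (simp add: norm_sq_def sum_nonneg)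

lemma norm_sq_eq_0:
  assumes "finite (support \<psi>)" shows "norm_sq \<psi> = 0 \<longleftrightarrow> (\<forall>c. \<psi> c = 0)"
  using assms by (auto simp: norm_sq_def sum_nonneg_eq_0_iff)

lemma norm_sq_reindex:
  assumes "bij T" shows "norm_sq (\<lambda>c. \<psi> (T c)) = norm_sq \<psi>"
  unfolding norm_sq_def
proof (rule sum.reindex_bij_betw)
  show "bij_betw T {c. \<psi> (T c) \<noteq> 0} (support \<psi>)"
    using assms by (intro bij_betwI[where g = "inv T"])
      (auto simp: bij_is_surj bij_is_inj surj_f_inv_f)
qed

lemma finite_support_reindex:
  assumes "bij T" "finite (support \<psi>)" shows "finite {c. \<psi> (T c) \<noteq> 0}"
  using finite_vimageI[OF assms(2) bij_is_inj[OF assms(1)]] by (simp add: vimage_def)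

lemma finite_support_proj: "finite (support \<psi>) \<Longrightarrow> finite (support (proj q b \<psi>))"
  by (rule finite_subset[of _ "support \<psi>"]) (auto simp: proj_def)

text \<open>A configuration is recovered from \<open>c(q := b)\<close> by restoring its old value at
  \<open>q\<close>, so this update is at most two to one.\<close>

lemma finite_support_update:
  assumes "finite (support \<psi>)" shows "finite {c. \<psi> (c(q := b)) \<noteq> 0}"
proof (rule finite_subset)
  show "{c. \<psi> (c(q := b)) \<noteq> 0} \<subseteq> (\<Union>a\<in>UNIV. (\<lambda>d. d(q := a)) ` support \<psi>)"
  proof clarify
    fix c assume "\<psi> (c(q := b)) \<noteq> 0"
    then have "c(q := b) \<in> support \<psi>" by simp
    moreover have "c = (c(q := b))(q := c q)" by simp
    ultimately show "c \<in> (\<Union>a\<in>UNIV. (\<lambda>d. d(q := a)) ` support \<psi>)"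
      by blast
  qed
qed (use assms in simp)

lemma finite_support_collapse:
  assumes "finite (support \<psi>)" shows "finite (support (collapse q b \<psi>))"
  by (rule finite_subset[OF _ finite_support_update[OF assms, of q b]]) (auto simp: collapse_def)

lemma apply_gate_nonzero:
  assumes "apply_gate U q \<psi> c \<noteq> 0" obtains b where "\<psi> (c(q := b)) \<noteq> 0"
proof -
  have "\<exists>b. \<psi> (c(q := b)) \<noteq> 0" by (rule ccontr) (use assms in \<open>simp add: apply_gate_def\<close>)
  with that show ?thesis by blast
qed

lemma finite_support_apply_gate:
  assumes "finite (support \<psi>)" shows "finite (support (apply_gate U q \<psi>))"
proof (rule finite_subset)
  show "support (apply_gate U q \<psi>) \<subseteq> (\<Union>b\<in>UNIV. {c. \<psi> (c(q := b)) \<noteq> 0})"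
    by (auto elim: apply_gate_nonzero)
qed (simp add: finite_support_update[OF assms])

text \<open>The reset to zero moves amplitudes without changing their moduli: setting
  \<open>q\<close> to \<open>b\<close> matches the support of the collapsed ket with that of the
  projection.\<close>

lemma norm_sq_collapse: "norm_sq (collapse q b \<psi>) = norm_sq (proj q b \<psi>)"
  unfolding norm_sq_def
  by (rule sum.reindex_bij_witness[of _ "\<lambda>c. c(q := False)" "\<lambda>c. c(q := b)"])
    (auto simp: collapse_def proj_def fun_upd_idem split: if_splits)

lemma norm_sq_proj_add:
  assumes "finite (support \<psi>)"
  shows "norm_sq (proj q True \<psi>) + norm_sq (proj q False \<psi>) = norm_sq \<psi>"
proof -
  have "norm_sq (proj q b \<psi>) = (\<Sum>c\<in>support \<psi>. (cmod (proj q b \<psi> c))\<^sup>2)" for b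
    by (rule norm_sq_superset[OF assms]) (auto simp: proj_def)
  then have "norm_sq (proj q True \<psi>) + norm_sq (proj q False \<psi>) =
      (\<Sum>c\<in>support \<psi>. (cmod (proj q True \<psi> c))\<^sup>2 + (cmod (proj q False \<psi> c))\<^sup>2)"
    by (simp add: sum.distrib)
  also have "\<dots> = norm_sq \<psi>"
    unfolding norm_sq_def by (intro sum.cong) (auto simp: proj_def)
  finally show ?thesis .
qed

text \<open>A one-qubit gate mixes the amplitudes of \<open>c\<close> and of \<open>c\<close> with
  \<open>q\<close> flipped, and preserves the squared norm on each such pair. A sum of pairs over a
  set closed under flipping meets every configuration twice, hence the factor 2 below.\<close>

lemma norm_sq_apply_gate:
  assumes fin: "finite (support \<psi>)"
    and unitary: "\<And>x y. (cmod (U False False * x + U False True * y))\<^sup>2 +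
      (cmod (U True False * x + U True True * y))\<^sup>2 = (cmod x)\<^sup>2 + (cmod y)\<^sup>2"
  shows "norm_sq (apply_gate U q \<psi>) = norm_sq \<psi>"
proof -
  let ?f = "\<lambda>c. c(q := \<not> c q)"
  define M where "M = support \<psi> \<union> ?f ` support \<psi>"
  have fM: "?f c \<in> M" if "c \<in> M" for c
    using that by (auto simp: M_def image_iff)
  have M: "finite M" using fin by (simp add: M_def)
  let ?\<phi> = "apply_gate U q \<psi>"
  have pair: "(cmod (?\<phi> c))\<^sup>2 + (cmod (?\<phi> (?f c)))\<^sup>2 = (cmod (\<psi> c))\<^sup>2 + (cmod (\<psi> (?f c)))\<^sup>2" for c
  proof (cases "c q")
    case True
    then have "c(q := True) = c" by (simp add: fun_upd_idem)
    then show ?thesis using unitary[of "\<psi> (?f c)" "\<psi> c"] True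
      by (simp add: apply_gate_def UNIV_bool add.commute)
  next
    case False
    then have "c(q := False) = c" by (simp add: fun_upd_idem)
    then show ?thesis using unitary[of "\<psi> c" "\<psi> (?f c)"] False
      by (simp add: apply_gate_def UNIV_bool add.commute)
  qed
  have double: "2 * (\<Sum>c\<in>M. g c) = (\<Sum>c\<in>M. g c + g (?f c))" for g :: "_ \<Rightarrow> real"
  proof -
    have "(\<Sum>c\<in>M. g (?f c)) = (\<Sum>c\<in>M. g c)"
      by (rule sum.reindex_bij_witness[of _ ?f ?f]) (auto simp: fM)
    then show ?thesis by (simp add: sum.distrib)
  qed
  have "support ?\<phi> \<subseteq> M"
  proof
    fix c assume "c \<in> support ?\<phi>"
    then obtain b where "\<psi> (c(q := b)) \<noteq> 0" by (auto elim: apply_gate_nonzero)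
    moreover have "c(q := b) = c \<or> c(q := b) = ?f c"
      by (cases "b = c q") (simp_all add: fun_upd_idem)
    ultimately have "\<psi> c \<noteq> 0 \<or> \<psi> (?f c) \<noteq> 0" by metis
    moreover have "c = ?f (?f c)" by auto
    ultimately show "c \<in> M" unfolding M_def by blast
  qed
  then have "2 * norm_sq ?\<phi> = (\<Sum>c\<in>M. (cmod (?\<phi> c))\<^sup>2 + (cmod (?\<phi> (?f c)))\<^sup>2)"
    by (subst norm_sq_superset[OF M]) (simp_all add: double)
  also have "\<dots> = 2 * norm_sq \<psi>"
    unfolding pair by (subst norm_sq_superset[OF M, of \<psi>]) (simp_all add: double, simp add: M_def)
  finally show ?thesis by simp
qed

lemma hadamard_unitary:
  "(cmod (hadamard_matrix False False * x + hadamard_matrix False True * y))\<^sup>2 +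
   (cmod (hadamard_matrix True False * x + hadamard_matrix True True * y))\<^sup>2 =
   (cmod x)\<^sup>2 + (cmod y)\<^sup>2"
proof -
  let ?r = "complex_of_real (sqrt 2)"
  have "hadamard_matrix False False * x + hadamard_matrix False True * y = (x + y) / ?r"
    "hadamard_matrix True False * x + hadamard_matrix True True * y = (x - y) / ?r"
    by (simp_all add: hadamard_matrix_def add_divide_distrib diff_divide_distrib)
  \<comment> \<open>The parallelogram law.\<close>
  moreover have "(cmod (x + y))\<^sup>2 + (cmod (x - y))\<^sup>2 = 2 * ((cmod x)\<^sup>2 + (cmod y)\<^sup>2)"
    unfolding cmod_power2 by (simp add: power2_eq_square algebra_simps)
  ultimately show ?thesis
    by (simp add: norm_divide power_divide add_divide_distrib[symmetric])
qed

lemma t_unitary: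
  "(cmod (t_matrix False False * x + t_matrix False True * y))\<^sup>2 +
   (cmod (t_matrix True False * x + t_matrix True True * y))\<^sup>2 = (cmod x)\<^sup>2 + (cmod y)\<^sup>2"
  by (simp add: t_matrix_def norm_mult)

lemma bij_cnot:
  assumes "a \<noteq> b" shows "bij (\<lambda>c :: 'v config. c(b := (c b \<noteq> c a)))"
  using assms by (intro o_bij[of "\<lambda>c. c(b := (c b \<noteq> c a))"]) (auto simp: fun_eq_iff)

lemma bij_swap: "bij (\<lambda>c :: 'v config. c(a := c b, b := c a))"
  by (intro o_bij[of "\<lambda>c. c(a := c b, b := c a)"]) (auto simp: fun_eq_iff)

lemma support_cnot_ket:
  assumes "p \<noteq> q"
  shows "finite (support \<psi>) \<Longrightarrow> finite (support (cnot_ket p q \<psi>))"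
    and "norm_sq (cnot_ket p q \<psi>) = norm_sq \<psi>"
  unfolding cnot_ket_def
  by (rule finite_support_reindex[OF bij_cnot[OF assms]] norm_sq_reindex[OF bij_cnot[OF assms]]; assumption?)+

lemma support_swap_ket:
  shows "finite (support \<psi>) \<Longrightarrow> finite (support (swap_ket p q \<psi>))"
    and "norm_sq (swap_ket p q \<psi>) = norm_sq \<psi>"
  unfolding swap_ket_def
  by (rule finite_support_reindex[OF bij_swap] norm_sq_reindex[OF bij_swap]; assumption?)+

subsection \<open>Local operators\<close>

text \<open>Two terms suffice: a one-qubit gate sums over the value of one qubit, and the other operations
  have a single term.\<close>

definition local_form ::
  "'v set \<Rightarrow> ('v ket \<Rightarrow> 'v ket) \<Rightarrow> (bool \<Rightarrow> 'v config \<Rightarrow> complex) \<Rightarrow> (bool \<Rightarrow> 'v config \<Rightarrow> 'v config) \<Rightarrow> bool"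
where
  "local_form R K a \<tau> \<longleftrightarrow> (\<forall>\<psi> c. K \<psi> c = (\<Sum>b\<in>UNIV. a b c * \<psi> (\<tau> b c))) \<and>
     (\<forall>b c c'. (\<forall>q. fst q \<in> R \<longrightarrow> c q = c' q) \<longrightarrow>
        a b c = a b c' \<and> (\<forall>q. fst q \<in> R \<longrightarrow> \<tau> b c q = \<tau> b c' q)) \<and>
     (\<forall>b c q. fst q \<notin> R \<longrightarrow> \<tau> b c q = c q)"

definition local_op :: "'v set \<Rightarrow> ('v ket \<Rightarrow> 'v ket) \<Rightarrow> bool" where
  "local_op R K \<longleftrightarrow> (\<exists>a \<tau>. local_form R K a \<tau>)"

lemma local_formD:
  assumes "local_form R K a \<tau>"
  shows "K \<psi> c = (\<Sum>b\<in>UNIV. a b c * \<psi> (\<tau> b c))"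
    and "(\<And>q. fst q \<in> R \<Longrightarrow> c q = c' q) \<Longrightarrow> a b c = a b c'"
    and "(\<And>q. fst q \<in> R \<Longrightarrow> c q = c' q) \<Longrightarrow> fst q' \<in> R \<Longrightarrow> \<tau> b c q' = \<tau> b c' q'"
    and "fst q \<notin> R \<Longrightarrow> \<tau> b c q = c q"
  using assms by (simp_all add: local_form_def del: split_paired_All)

lemma local_opI:
  assumes "\<And>\<psi> c. K \<psi> c = (\<Sum>b\<in>(UNIV :: bool set). a b c * \<psi> (\<tau> b c))"
    and "\<And>b c c'. (\<And>q. fst q \<in> R \<Longrightarrow> c q = c' q) \<Longrightarrow> a b c = a b c'"
    and "\<And>b c c' q'. (\<And>q. fst q \<in> R \<Longrightarrow> c q = c' q) \<Longrightarrow> fst q' \<in> R \<Longrightarrow> \<tau> b c q' = \<tau> b c' q'"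
    and "\<And>b c q. fst q \<notin> R \<Longrightarrow> \<tau> b c q = c q"
  shows "local_op R K"
  unfolding local_op_def local_form_def
  by (intro exI[of _ a] exI[of _ \<tau>] conjI allI impI; (rule assms)?) (auto simp del: split_paired_All)

text \<open>Neither operator changes the qubits that determine the coefficients and the substitution
  of the other. So the substitutions commute, and both compositions are the same sum over pairs of
  bits.\<close>

lemma local_op_commute:
  assumes "local_op R K" "local_op R' K'" "R \<inter> R' = {}"
  shows "K (K' \<psi>) = K' (K \<psi>)"
proof
  fix c
  obtain a \<tau> where K: "local_form R K a \<tau>" using assms(1) by (auto simp: local_op_def)
  obtain a' \<tau>' where K': "local_form R' K' a' \<tau>'" using assms(2) by (auto simp: local_op_def)
  note a = local_formD(2)[OF K] and a' = local_formD(2)[OF K']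
  note \<tau> = local_formD(3)[OF K] and \<tau>' = local_formD(3)[OF K']
  note \<tau>_out = local_formD(4)[OF K] and \<tau>'_out = local_formD(4)[OF K']
  have disj: "v \<in> R \<Longrightarrow> v \<notin> R'" "v \<in> R' \<Longrightarrow> v \<notin> R" for v using assms(3) by auto
  have "a' b' (\<tau> b c) = a' b' c" for b b' by (rule a') (simp add: \<tau>_out disj)
  moreover have "a b (\<tau>' b' c) = a b c" for b b' by (rule a) (simp add: \<tau>'_out disj)
  moreover have "\<tau> b (\<tau>' b' c) = \<tau>' b' (\<tau> b c)" for b b'
  proof
    fix q :: "_ \<times> nat"
    consider "fst q \<in> R" "fst q \<notin> R'" | "fst q \<in> R'" "fst q \<notin> R" | "fst q \<notin> R" "fst q \<notin> R'"
      using assms(3) by blast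
    then show "\<tau> b (\<tau>' b' c) q = \<tau>' b' (\<tau> b c) q"
    proof cases
      case 1
      have "\<tau> b (\<tau>' b' c) q = \<tau> b c q" by (rule \<tau>[OF _ 1(1)]) (simp add: \<tau>'_out disj)
      with 1 show ?thesis by (simp add: \<tau>'_out)
    next
      case 2
      have "\<tau>' b' (\<tau> b c) q = \<tau>' b' c q" by (rule \<tau>'[OF _ 2(1)]) (simp add: \<tau>_out disj)
      with 2 show ?thesis by (simp add: \<tau>_out)
    next
      case 3
      then show ?thesis by (simp add: \<tau>_out \<tau>'_out)
    qed
  qed
  ultimately show "K (K' \<psi>) c = K' (K \<psi>) c"
    unfolding local_formD(1)[OF K] local_formD(1)[OF K'] UNIV_bool by (simp add: algebra_simps)
qed

lemma local_op_id: "local_op R (\<lambda>\<psi>. \<psi>)"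
  by (rule local_opI[where a = "\<lambda>b _. if b then 1 else 0" and \<tau> = "\<lambda>_ c. c"]) (auto simp: UNIV_bool)

lemma local_op_gate: "fst q \<in> R \<Longrightarrow> local_op R (apply_gate U q)"
  by (rule local_opI[where a = "\<lambda>b c. U (c q) b" and \<tau> = "\<lambda>b c. c(q := b)"])
    (auto simp: apply_gate_def simp del: split_paired_All)

lemma local_op_reindex:
  assumes "\<And>c c' q'. (\<And>q. fst q \<in> R \<Longrightarrow> c q = c' q) \<Longrightarrow> fst q' \<in> R \<Longrightarrow> T c q' = T c' q'"
    and "\<And>c q. fst q \<notin> R \<Longrightarrow> T c q = c q"
  shows "local_op R (\<lambda>\<psi> c. \<psi> (T c))"
  by (rule local_opI[where a = "\<lambda>b _. if b then 1 else 0" and \<tau> = "\<lambda>_. T", OF _ _ assms])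
    (auto simp: UNIV_bool)

lemma local_op_cnot: "fst p \<in> R \<Longrightarrow> fst q \<in> R \<Longrightarrow> local_op R (cnot_ket p q)"
  unfolding cnot_ket_def[abs_def] by (rule local_op_reindex) (auto simp del: split_paired_All)

lemma local_op_swap: "fst p \<in> R \<Longrightarrow> fst q \<in> R \<Longrightarrow> local_op R (swap_ket p q)"
  unfolding swap_ket_def[abs_def] by (rule local_op_reindex) (auto simp del: split_paired_All)

lemma local_op_collapse: "fst q \<in> R \<Longrightarrow> local_op R (collapse q b)"
  by (rule local_opI[where a = "\<lambda>b' c. if b' \<and> \<not> c q then 1 else 0" and \<tau> = "\<lambda>_ c. c(q := b)"])
    (auto simp: collapse_def UNIV_bool simp del: split_paired_All)

lemma local_op_proj: "fst q \<in> R \<Longrightarrow> local_op R (proj q b)"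
  by (rule local_opI[where a = "\<lambda>b' c. if b' \<and> c q = b then 1 else 0" and \<tau> = "\<lambda>_ c. c"])
    (auto simp: proj_def UNIV_bool simp del: split_paired_All)

section \<open>Instructions as random choices of local actions\<close>

text \<open>All randomness of an instruction fits into one bit, which leaves a deterministic action
  \<open>act\<close>. Where nothing is random the bit is a dummy with value
  \<open>False\<close>.\<close>

fun coin :: "'v instr \<Rightarrow> 'v mem \<Rightarrow> bool pmf" where
  "coin (Toss v) m = pmf_of_set UNIV"
| "coin (QMeasure v) m =
     (if ql m v = 0 then return_pmf False else bernoulli_pmf (prob_one (top_qubit m v) (amp m)))"
| "coin _ m = return_pmf False"

fun act_cl :: "'v instr \<Rightarrow> bool \<Rightarrow> ('v \<Rightarrow> bits) \<Rightarrow> ('v \<Rightarrow> nat) \<Rightarrow> 'v \<Rightarrow> bits" where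
  "act_cl (Push a v) b s l = s(v := a # s v)"
| "act_cl (Pop v) b s l = s(v := tl (s v))"
| "act_cl (Toss v) b s l = s(v := b # s v)"
| "act_cl (QMeasure v) b s l = (if l v = 0 then s else s(v := b # s v))"
| "act_cl _ b s l = s"

fun act_ql :: "'v instr \<Rightarrow> ('v \<Rightarrow> nat) \<Rightarrow> 'v \<Rightarrow> nat" where
  "act_ql (QNew v) l = l(v := Suc (l v))"
| "act_ql (QMove v w) l =
     (if l v = 0 then l else let l' = l(v := l v - 1) in l'(w := Suc (l' w)))"
| "act_ql (QMeasure v) l = (if l v = 0 then l else l(v := l v - 1))"
| "act_ql _ l = l"

text \<open>The operator depends on the memory only through the stack heights. An instruction on
  other registers leaves the relevant heights alone, so the same operator is applied in either
  order.\<close>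

fun act_amp :: "'v instr \<Rightarrow> bool \<Rightarrow> ('v \<Rightarrow> nat) \<Rightarrow> 'v ket \<Rightarrow> 'v ket" where
  "act_amp (QMove v w) b l =
     (if l v = 0 then (\<lambda>\<psi>. \<psi>) else swap_ket (v, l v - 1) (w, (l(v := l v - 1)) w))"
| "act_amp (QMeasure v) b l = (if l v = 0 then (\<lambda>\<psi>. \<psi>) else collapse (v, l v - 1) b)"
| "act_amp (Hadamard v) b l =
     (if l v = 0 then (\<lambda>\<psi>. \<psi>) else apply_gate hadamard_matrix (v, l v - 1))"
| "act_amp (TGate v) b l = (if l v = 0 then (\<lambda>\<psi>. \<psi>) else apply_gate t_matrix (v, l v - 1))"
| "act_amp (CNot v w) b l =
     (if v = w \<or> l v = 0 \<or> l w = 0 then (\<lambda>\<psi>. \<psi>) else cnot_ket (v, l v - 1) (w, l w - 1))"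
| "act_amp _ b l = (\<lambda>\<psi>. \<psi>)"

definition act :: "'v instr \<Rightarrow> bool \<Rightarrow> 'v mem \<Rightarrow> 'v mem" where
  "act i b m = \<lparr>cl = act_cl i b (cl m) (ql m), ql = act_ql i (ql m), amp = act_amp i b (ql m) (amp m)\<rparr>"

lemma mem_eqI: "cl m = cl m' \<Longrightarrow> ql m = ql m' \<Longrightarrow> amp m = amp m' \<Longrightarrow> m = (m' :: 'v mem)"
  by (rule mem.equality) auto

lemma act_sel [simp]:
  "cl (act i b m) = act_cl i b (cl m) (ql m)"
  "ql (act i b m) = act_ql i (ql m)"
  "amp (act i b m) = act_amp i b (ql m) (amp m)"
  by (simp_all add: act_def)

lemma exec_act: "exec i m = map_pmf (\<lambda>b. act i b m) (coin i m)"
  by (cases i) (auto simp: push_def Let_def intro!: mem_eqI pmf.map_cong)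

lemma act_outside:
  assumes "v \<notin> set_instr i"
  shows "act_cl i b s l v = s v" "act_ql i l v = l v"
  using assms by (cases i; auto simp: Let_def)+

lemma act_cong:
  assumes "\<And>v. v \<in> set_instr i \<Longrightarrow> s v = s' v" "\<And>v. v \<in> set_instr i \<Longrightarrow> l v = l' v"
  shows "v \<in> set_instr i \<Longrightarrow> act_cl i b s l v = act_cl i b s' l' v"
    and "v \<in> set_instr i \<Longrightarrow> act_ql i l v = act_ql i l' v"
    and "act_amp i b l = act_amp i b l'"
  using assms by (cases i; auto simp: Let_def)+

lemma local_op_act_amp: "local_op (set_instr i) (act_amp i b l)"
  by (cases i) (auto intro: local_op_id local_op_gate local_op_swap local_op_cnot local_op_collapse)

lemma finite_support_act_amp:
  assumes "finite (support \<psi>)" shows "finite (support (act_amp i b l \<psi>))"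
  using assms
  by (cases i) (auto simp: support_cnot_ket support_swap_ket
      intro: finite_support_apply_gate finite_support_collapse)

lemma norm_sq_act_amp:
  assumes "finite (support \<psi>)" "\<And>v. i \<noteq> QMeasure v"
  shows "norm_sq (act_amp i b l \<psi>) = norm_sq \<psi>"
  using assms
  by (cases i) (auto simp: support_cnot_ket support_swap_ket norm_sq_apply_gate
      hadamard_unitary t_unitary)

section \<open>The Born rule and preservation of well-formed memories\<close>

lemma wf_memD:
  assumes "wf_mem m"
  shows "finite (support (amp m))" "norm_sq (amp m) \<noteq> 0"
    "amp m c \<noteq> 0 \<Longrightarrow> ql m v \<le> i \<Longrightarrow> \<not> c (v, i)"
  using assms by (auto simp: wf_mem_def norm_sq_eq_0)

text \<open>Finite support and nonzero norm place \<open>prob_one\<close> in the unit interval,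
  where the parameter of \<open>bernoulli_pmf\<close> is its actual mass. The mass of
  \<open>False\<close> follows because the two projections split the squared norm.\<close>

lemma pmf_measurement:
  assumes "finite (support \<psi>)" "norm_sq \<psi> \<noteq> 0"
  shows "pmf (bernoulli_pmf (prob_one q \<psi>)) b = norm_sq (proj q b \<psi>) / norm_sq \<psi>"
proof -
  note add = norm_sq_proj_add[OF assms(1), of q]
  have pos: "norm_sq \<psi> > 0" using assms(2) norm_sq_nonneg[of \<psi>] by linarith
  have "norm_sq (proj q True \<psi>) \<le> norm_sq \<psi>"
    using add norm_sq_nonneg[of "proj q False \<psi>"] by linarith
  then have "0 \<le> prob_one q \<psi>" "prob_one q \<psi> \<le> 1"
    using pos by (simp_all add: prob_one_proj)
  then show ?thesis
    using add pos by (cases b) (auto simp: prob_one_proj field_simps)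
qed

text \<open>A slot that leaves a stack must end up in state zero: a measurement resets it, and a
  move exchanges it with the free slot above the destination stack. Gates act below the top.\<close>

lemma support_act_amp_above:
  assumes "\<And>c v i. \<psi> c \<noteq> 0 \<Longrightarrow> l v \<le> i \<Longrightarrow> \<not> c (v, i)"
    and "act_amp i b l \<psi> c \<noteq> 0" "act_ql i l v \<le> n"
  shows "\<not> c (v, n)"
proof -
  have base: "\<not> c (v, n)" if "\<psi> c \<noteq> 0" "l v \<le> n" using assms(1) that .
  have gate: "\<not> c (v, n)" if nz: "apply_gate U (w, l w - 1) \<psi> c \<noteq> 0" and "l w \<noteq> 0" "l v \<le> n" for U w
  proof -
    obtain b where "\<psi> (c((w, l w - 1) := b)) \<noteq> 0"
      using nz by (rule apply_gate_nonzero)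
    from assms(1)[OF this \<open>l v \<le> n\<close>] show ?thesis using that by (auto split: if_splits)
  qed
  show ?thesis
  proof (cases i)
    case (QMove x y)
    show ?thesis
    proof (cases "l x = 0")
      case False
      let ?a = "(x, l x - 1)" and ?b = "(y, (l(x := l x - 1)) y)"
      have nz: "\<psi> (c(?a := c ?b, ?b := c ?a)) \<noteq> 0"
        using assms(2) QMove False by (simp add: swap_ket_def)
      \<comment> \<open>The second instance says that the destination slot held zero, so the vacated
        slot holds zero after the swap.\<close>
      show ?thesis
        using assms(1)[OF nz, of v n] assms(1)[OF nz, of y "l y"] assms(3) QMove False
        by (cases "n = l x - 1") (auto simp: Let_def split: if_splits)
    qed (use assms QMove in auto)
  next
    case (QMeasure x)
    show ?thesis
    proof (cases "l x = 0")
      case False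
      then have "\<not> c (x, l x - 1)" "\<psi> (c((x, l x - 1) := b)) \<noteq> 0"
        using assms(2) QMeasure by (auto simp: collapse_def split: if_splits)
      then show ?thesis
        using assms(1)[of "c((x, l x - 1) := b)" v n] assms(3) QMeasure False
        by (cases "(v, n) = (x, l x - 1)") (auto split: if_splits)
    qed (use assms QMeasure in auto)
  next
    case (CNot x y)
    show ?thesis
    proof (cases "x = y \<or> l x = 0 \<or> l y = 0")
      case False
      then show ?thesis
        using assms(1)[of "c((y, l y - 1) := (c (y, l y - 1) \<noteq> c (x, l x - 1)))" v n]
          assms(2,3) CNot by (auto simp: cnot_ket_def split: if_splits)
    qed (use assms CNot in auto)
  qed (use base gate assms(2,3) in \<open>auto split: if_splits\<close>)
qed

text \<open>A measurement could only destroy the ket by projecting it to zero, but such an outcome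
  has probability zero and is never sampled. All other actions preserve the norm.\<close>

lemma wf_exec:
  assumes "wf_mem m" "m' \<in> set_pmf (exec i m)" shows "wf_mem m'"
proof -
  from assms(2) obtain b where b: "b \<in> set_pmf (coin i m)" and m': "m' = act i b m"
    by (auto simp: exec_act)
  note wf = wf_memD[OF assms(1)]
  have fin: "finite (support (amp m'))"
    unfolding m' act_sel using wf(1) by (rule finite_support_act_amp)
  have "norm_sq (amp m') \<noteq> 0"
  proof (cases "\<exists>v. i = QMeasure v \<and> ql m v \<noteq> 0")
    case True
    then obtain v where v: "i = QMeasure v" "ql m v \<noteq> 0" by blast
    then have "pmf (bernoulli_pmf (prob_one (top_qubit m v) (amp m))) b \<noteq> 0"
      using b by (simp add: set_pmf_iff)
    then show ?thesis using v by (simp add: m' pmf_measurement[OF wf(1,2)] norm_sq_collapse)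
  next
    case False
    then have "norm_sq (act_amp i b (ql m) (amp m)) = norm_sq (amp m)"
      using norm_sq_act_amp[OF wf(1), of i b "ql m"] by (cases "\<exists>v. i = QMeasure v") auto
    then show ?thesis using wf(2) by (simp add: m')
  qed
  with fin have "\<exists>c. amp m' c \<noteq> 0" by (auto simp: norm_sq_eq_0)
  moreover have "\<not> c (v, n)" if "amp m' c \<noteq> 0" "ql m' v \<le> n" for c v n
    using support_act_amp_above[of "amp m" "ql m" i b c v n] wf(3) that unfolding m' act_sel by blast
  ultimately show ?thesis using fin by (auto simp: wf_mem_def)
qed

section \<open>Commutation of instructions on disjoint registers\<close>

lemma act_commute:
  assumes "set_instr i \<inter> set_instr j = {}"
  shows "act j c (act i b m) = act i b (act j c m)"
proof (rule mem_eqI)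
  have out: "v \<in> set_instr i \<Longrightarrow> v \<notin> set_instr j" "v \<in> set_instr j \<Longrightarrow> v \<notin> set_instr i" for v
    using assms by auto
  show "cl (act j c (act i b m)) = cl (act i b (act j c m))"
  proof
    fix v
    consider "v \<in> set_instr i" | "v \<in> set_instr j" | "v \<notin> set_instr i" "v \<notin> set_instr j" by blast
    then show "cl (act j c (act i b m)) v = cl (act i b (act j c m)) v"
      by cases (auto simp: act_outside out intro!: act_cong(1) act_cong(1)[symmetric])
  qed
  show "ql (act j c (act i b m)) = ql (act i b (act j c m))"
  proof
    fix v
    consider "v \<in> set_instr i" | "v \<in> set_instr j" | "v \<notin> set_instr i" "v \<notin> set_instr j" by blast
    then show "ql (act j c (act i b m)) v = ql (act i b (act j c m)) v"
      by cases (auto simp: act_outside out intro!: act_cong(2) act_cong(2)[symmetric])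
  qed
  have "act_amp j c (act_ql i (ql m)) = act_amp j c (ql m)"
    by (rule act_cong(3)[where s = "cl m" and s' = "cl m"]) (simp_all add: act_outside out)
  moreover have "act_amp i b (act_ql j (ql m)) = act_amp i b (ql m)"
    by (rule act_cong(3)[where s = "cl m" and s' = "cl m"]) (simp_all add: act_outside out)
  ultimately show "amp (act j c (act i b m)) = amp (act i b (act j c m))"
    using assms by (simp add: local_op_commute[OF local_op_act_amp local_op_act_amp] Int_commute)
qed

text \<open>The projection for \<open>j\<close> commutes with the action of \<open>i\<close>, which
  preserves the norms of both the whole and the projected ket. If \<open>i\<close> measures, this
  fails for entangled qubits: its outcome influences the coin of \<open>j\<close>, and the joint
  distribution has to be compared instead.\<close>

lemma coin_act:
  assumes "wf_mem m" "set_instr i \<inter> set_instr j = {}" "\<And>v. i \<noteq> QMeasure v"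
  shows "coin j (act i b m) = coin j m"
proof (cases "\<exists>v. j = QMeasure v")
  case True
  then obtain v where v: "j = QMeasure v" by blast
  let ?q = "(v, ql m v - 1)" and ?K = "act_amp i b (ql m)"
  note wf = wf_memD[OF assms(1)]
  have "proj ?q True (?K (amp m)) = ?K (proj ?q True (amp m))"
    using assms(2) v by (intro local_op_commute[OF local_op_proj local_op_act_amp]) auto
  then have "prob_one ?q (?K (amp m)) = prob_one ?q (amp m)"
    unfolding prob_one_proj
    using assms(3) norm_sq_act_amp wf(1) finite_support_proj by metis
  then show ?thesis using assms(2) v by (simp add: act_outside)
next
  case False
  then show ?thesis by (cases j) auto
qed

text \<open>Both orders of sampling become products of a mass and a conditional mass, so that they
  can be compared although the second coin depends on the first.\<close>

lemma pmf_bind_pairs: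
  shows "pmf (p \<bind> (\<lambda>b. f b \<bind> (\<lambda>c. return_pmf (b, c)))) (x, y) = pmf p x * pmf (f x) y"
    and "pmf (q \<bind> (\<lambda>c. g c \<bind> (\<lambda>b. return_pmf (b, c)))) (x, y) = pmf q y * pmf (g y) x"
proof -
  have "pmf (map_pmf (Pair b) (f b)) (x, y) = indicator {x} b * pmf (f x) y" for b
    using pmf_map_inj'[of "Pair b" "f b" y]
    by (cases "b = x") (auto simp: inj_on_def pmf_eq_0_set_pmf)
  then show "pmf (p \<bind> (\<lambda>b. f b \<bind> (\<lambda>c. return_pmf (b, c)))) (x, y) = pmf p x * pmf (f x) y"
    by (simp add: map_pmf_def[symmetric] pmf_bind measure_pmf_single)
  have "pmf (map_pmf (\<lambda>b. (b, c)) (g c)) (x, y) = indicator {y} c * pmf (g y) x" for c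
    using pmf_map_inj'[of "\<lambda>b. (b, c)" "g c" x]
    by (cases "c = y") (auto simp: inj_on_def pmf_eq_0_set_pmf)
  then show "pmf (q \<bind> (\<lambda>c. g c \<bind> (\<lambda>b. return_pmf (b, c)))) (x, y) = pmf q y * pmf (g y) x"
    by (simp add: map_pmf_def[symmetric] pmf_bind measure_pmf_single)
qed

text \<open>Unless both instructions measure, neither coin depends on the action of the other. For
  two measurements, both orders give each pair of outcomes the squared norm of the doubly projected
  ket over that of the ket.\<close>

lemma coin_commute:
  assumes "wf_mem m" "set_instr i \<inter> set_instr j = {}"
  shows "do { b \<leftarrow> coin i m; c \<leftarrow> coin j (act i b m); return_pmf (b, c) } =
    do { c \<leftarrow> coin j m; b \<leftarrow> coin i (act j c m); return_pmf (b, c) }"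
proof -
  have disj': "set_instr j \<inter> set_instr i = {}" using assms(2) by auto
  have commute: ?thesis
    if "\<And>b. coin j (act i b m) = coin j m" "\<And>c. coin i (act j c m) = coin i m"
    unfolding that by (rule bind_commute_pmf)
  show ?thesis
  proof (cases "\<exists>v w. i = QMeasure v \<and> j = QMeasure w")
    case False
    show ?thesis
    proof (cases "\<exists>v. i = QMeasure v")
      case True
      then have j: "\<And>v. j \<noteq> QMeasure v" using False by auto
      from True have "coin j (act i b m) = coin j m" for b using j by (cases j) auto
      then show ?thesis using commute coin_act[OF assms(1) disj' j] by blast
    next
      case i: False
      then have "coin i (act j c m) = coin i m" for c by (cases i) auto
      then show ?thesis using commute coin_act[OF assms] i by blast
    qed
  next
    case True
    then obtain v w where vw: "i = QMeasure v" "j = QMeasure w" "v \<noteq> w" using assms(2) by auto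
    show ?thesis
    proof (cases "ql m v = 0 \<or> ql m w = 0")
      case True
      have id: "act (QMeasure x) b m = m" if "ql m x = 0" for x b
        using that by (intro mem_eqI) auto
      show ?thesis
        using True vw by (auto simp: id bind_return_pmf intro: bind_commute_pmf)
    next
      case False
      note wf = wf_memD[OF assms(1)]
      let ?\<psi> = "amp m" and ?q = "(v, ql m v - 1)" and ?r = "(w, ql m w - 1)"
      let ?N = "norm_sq ?\<psi>"
      let ?B = "\<lambda>q \<psi>. bernoulli_pmf (prob_one q \<psi>)"
      have qr: "{fst ?q} \<inter> {fst ?r} = {}" "{fst ?r} \<inter> {fst ?q} = {}" using vw by auto
      \<comment> \<open>Chain rule: the norm after the first collapse is the numerator of the first
        factor and the denominator of the second, and cancels.\<close>
      have two: "pmf (?B q ?\<psi>) b * pmf (?B r (collapse q b ?\<psi>)) c =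
          norm_sq (proj q b (proj r c ?\<psi>)) / ?N" if "{fst q} \<inter> {fst r} = {}" for q r b c
      proof (cases "norm_sq (proj q b ?\<psi>) = 0")
        \<comment> \<open>The second factor would be a quotient with denominator 0. The first
          outcome is impossible here, so both sides vanish.\<close>
        case True
        then have "proj q b ?\<psi> x = 0" for x
          using norm_sq_eq_0[OF finite_support_proj[OF wf(1)]] by blast
        moreover have "proj q b (proj r c ?\<psi>) x = (if x r = c then proj q b ?\<psi> x else 0)" for x
          by (simp add: proj_def)
        ultimately have "proj q b (proj r c ?\<psi>) = (\<lambda>_. 0)" by auto
        then show ?thesis using True by (simp add: pmf_measurement[OF wf(1,2)] norm_sq_def)
      next
        case False
        have fin: "finite (support (collapse q b ?\<psi>))" by (rule finite_support_collapse[OF wf(1)])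
        have "proj r c (collapse q b ?\<psi>) = collapse q b (proj r c ?\<psi>)"
          using that by (intro local_op_commute[OF local_op_proj local_op_collapse]) auto
        then show ?thesis
          using False pmf_measurement[OF wf(1,2), of q b] pmf_measurement[OF fin, of r c]
          by (simp add: norm_sq_collapse)
      qed
      have comm: "proj ?q b (proj ?r c ?\<psi>) = proj ?r c (proj ?q b ?\<psi>)" for b c
        by (auto simp: proj_def)
      have "pmf (do { b \<leftarrow> ?B ?q ?\<psi>; c \<leftarrow> ?B ?r (collapse ?q b ?\<psi>); return_pmf (b, c) }) x =
          pmf (do { c \<leftarrow> ?B ?r ?\<psi>; b \<leftarrow> ?B ?q (collapse ?r c ?\<psi>); return_pmf (b, c) }) x" for x
        
        by (cases x) (simp only: pmf_bind_pairs two[OF qr(1)] two[OF qr(2)] comm)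
      then show ?thesis using vw False by (intro pmf_eqI) simp
    qed
  qed
qed

lemma exec_commute:
  assumes "wf_mem m" "set_instr i \<inter> set_instr j = {}"
  shows "exec i m \<bind> exec j = exec j m \<bind> exec i"
proof -
  have "exec i m \<bind> exec j = do { b \<leftarrow> coin i m; c \<leftarrow> coin j (act i b m); return_pmf (b, c) } \<bind>
      (\<lambda>(b, c). return_pmf (act j c (act i b m)))"
    by (simp add: exec_act bind_map_pmf map_pmf_def bind_assoc_pmf bind_return_pmf)
  also have "\<dots> = exec j m \<bind> exec i"
    unfolding coin_commute[OF assms] act_commute[OF assms(2)]
    by (simp add: exec_act bind_map_pmf map_pmf_def bind_assoc_pmf bind_return_pmf)
  finally show ?thesis .
qed

section \<open>Commutation of programs on disjoint registers\<close>

lemma wf_step: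
  assumes "wf_mem m" "(P', m') \<in> set_pmf (step P m)" shows "wf_mem m'"
  using assms by (metis set_step_cases wf_exec)

lemma wf_steps:
  assumes "wf_mem m" "(P', m') \<in> set_pmf (steps n P m)" shows "wf_mem m'"
  using steps_invariant[OF assms(2), of wf_mem] assms(1) wf_exec by blast

lemma exec_agree:
  assumes "m' \<in> set_pmf (exec i m)" "set_instr i \<inter> R = {}" shows "agree R m m'"
  using assms by (auto simp: agree_def exec_act intro!: act_outside[symmetric])

text \<open>After one program has acted, the registers of the other still agree with
  \<open>m\<close>, so \<open>step_cases\<close> predicts the same instruction and residual program.
  Both residual programs are recorded so that the exchange can be iterated.\<close>

lemma step_commute:
  assumes "wf_mem m" "set_prog P \<inter> set_prog Q = {}"
  shows "do { (P', m') \<leftarrow> step P m; (Q', m'') \<leftarrow> step Q m'; return_pmf (P', Q', m'') } =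
    do { (Q', m') \<leftarrow> step Q m; (P', m'') \<leftarrow> step P m'; return_pmf (P', Q', m'') }"
proof -
  have ag: "agree R m m" for R by (simp add: agree_def)
  consider (PQ) P' Q' where "\<And>m'. agree (set_prog P) m m' \<Longrightarrow> step P m' = return_pmf (P', m')"
      "\<And>m'. agree (set_prog Q) m m' \<Longrightarrow> step Q m' = return_pmf (Q', m')"
    | (P) P' j Q' where "\<And>m'. agree (set_prog P) m m' \<Longrightarrow> step P m' = return_pmf (P', m')"
      "set_instr j \<subseteq> set_prog Q"
      "\<And>m'. agree (set_prog Q) m m' \<Longrightarrow> step Q m' = map_pmf (Pair Q') (exec j m')"
    | (Q) P' i Q' where "set_instr i \<subseteq> set_prog P"
      "\<And>m'. agree (set_prog P) m m' \<Longrightarrow> step P m' = map_pmf (Pair P') (exec i m')"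
      "\<And>m'. agree (set_prog Q) m m' \<Longrightarrow> step Q m' = return_pmf (Q', m')"
    | (none) P' i Q' j where "set_instr i \<subseteq> set_prog P"
      "\<And>m'. agree (set_prog P) m m' \<Longrightarrow> step P m' = map_pmf (Pair P') (exec i m')"
      "set_instr j \<subseteq> set_prog Q"
      "\<And>m'. agree (set_prog Q) m m' \<Longrightarrow> step Q m' = map_pmf (Pair Q') (exec j m')"
    by (cases rule: step_cases[of P m]; cases rule: step_cases[of Q m]) blast+
  then show ?thesis
  proof cases
    case PQ
    then show ?thesis by (simp add: ag bind_return_pmf)
  next
    case P
    have "agree (set_prog P) m m'" if "m' \<in> set_pmf (exec j m)" for m'
      using assms(2) P(2) by (intro exec_agree[OF that]) auto
    then have "step P m' = return_pmf (P', m')" if "m' \<in> set_pmf (exec j m)" for m'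
      using that P(1) by blast
    then show ?thesis using P
      by (auto simp: ag bind_return_pmf bind_map_pmf cong: bind_pmf_cong)
  next
    case Q
    have "agree (set_prog Q) m m'" if "m' \<in> set_pmf (exec i m)" for m'
      using assms(2) Q(1) by (intro exec_agree[OF that]) auto
    then have "step Q m' = return_pmf (Q', m')" if "m' \<in> set_pmf (exec i m)" for m'
      using that Q(3) by blast
    then show ?thesis using Q
      by (auto simp: ag bind_return_pmf bind_map_pmf cong: bind_pmf_cong)
  next
    case none
    have "agree (set_prog P) m m'" if "m' \<in> set_pmf (exec j m)" for m'
      using assms(2) none(3) by (intro exec_agree[OF that]) auto
    then have P: "step P m' = map_pmf (Pair P') (exec i m')" if "m' \<in> set_pmf (exec j m)" for m'
      using that none(2) by blast
    have "agree (set_prog Q) m m'" if "m' \<in> set_pmf (exec i m)" for m'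
      using assms(2) none(1) by (intro exec_agree[OF that]) auto
    then have Q: "step Q m' = map_pmf (Pair Q') (exec j m')" if "m' \<in> set_pmf (exec i m)" for m'
      using that none(4) by blast
    have "do { (P', m') \<leftarrow> step P m; (Q', m'') \<leftarrow> step Q m'; return_pmf (P', Q', m'') } =
        (exec i m \<bind> exec j) \<bind> (\<lambda>m''. return_pmf (P', Q', m''))"
      using none Q by (auto simp: ag bind_map_pmf bind_assoc_pmf cong: bind_pmf_cong)
    also have "\<dots> = (exec j m \<bind> exec i) \<bind> (\<lambda>m''. return_pmf (P', Q', m''))"
      using assms none(1,3) by (subst exec_commute) auto
    also have "\<dots> = do { (Q', m') \<leftarrow> step Q m; (P', m'') \<leftarrow> step P m'; return_pmf (P', Q', m'') }"
      using none P by (auto simp: ag bind_map_pmf bind_assoc_pmf cong: bind_pmf_cong)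
    finally show ?thesis .
  qed
qed

lemma step_steps_commute:
  assumes "wf_mem m" "set_prog P \<inter> set_prog Q = {}"
  shows "do { (P', m') \<leftarrow> step P m; (Q', m'') \<leftarrow> steps n Q m'; return_pmf (P', Q', m'') } =
    do { (Q', m') \<leftarrow> steps n Q m; (P', m'') \<leftarrow> step P m'; return_pmf (P', Q', m'') }"
  using assms
proof (induction n arbitrary: Q m)
  case 0
  then show ?case by (simp add: bind_return_pmf split_def)
next
  case (Suc n)
  let ?f = "\<lambda>(P', Q', m'). do { (Q'', m'') \<leftarrow> steps n Q' m'; return_pmf (P', Q'', m'') }"
  have "do { (P', m') \<leftarrow> step P m; (Q', m'') \<leftarrow> steps (Suc n) Q m'; return_pmf (P', Q', m'') } =
     do { (P', m') \<leftarrow> step P m; (Q', m'') \<leftarrow> step Q m'; return_pmf (P', Q', m'') } \<bind> ?f"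
    by (simp add: bind_assoc_pmf bind_return_pmf split_def)
  also have "\<dots> = do { (Q', m') \<leftarrow> step Q m; (P', m'') \<leftarrow> step P m'; return_pmf (P', Q', m'') } \<bind> ?f"
    by (simp only: step_commute[OF Suc.prems])
  also have "\<dots> = do { (Q', m') \<leftarrow> step Q m;
      do { (P', m'') \<leftarrow> step P m'; (Q'', m''') \<leftarrow> steps n Q' m''; return_pmf (P', Q'', m''') } }"
    by (simp add: bind_assoc_pmf bind_return_pmf split_def)
  also have "\<dots> = do { (Q', m') \<leftarrow> step Q m;
      do { (Q'', m'') \<leftarrow> steps n Q' m'; (P', m''') \<leftarrow> step P m''; return_pmf (P', Q'', m''') } }"
  proof (intro bind_pmf_cong refl, clarify)
    fix Q' m' assume "(Q', m') \<in> set_pmf (step Q m)"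
    moreover from step_preserves(1)[OF this] have "set_prog P \<inter> set_prog Q' = {}"
      using Suc.prems(2) by auto
    ultimately show "do { (P', m'') \<leftarrow> step P m'; (Q'', m''') \<leftarrow> steps n Q' m''; return_pmf (P', Q'', m''') } =
      do { (Q'', m'') \<leftarrow> steps n Q' m'; (P', m''') \<leftarrow> step P m''; return_pmf (P', Q'', m''') }"
      using Suc.IH Suc.prems(1) wf_step by blast
  qed
  finally show ?case by (simp add: bind_assoc_pmf split_def)
qed

lemma steps_commute:
  assumes "wf_mem m" "set_prog P \<inter> set_prog Q = {}"
  shows "do { (P', m') \<leftarrow> steps k P m; (Q', m'') \<leftarrow> steps n Q m'; return_pmf (P', Q', m'') } =
    do { (Q', m') \<leftarrow> steps n Q m; (P', m'') \<leftarrow> steps k P m'; return_pmf (P', Q', m'') }"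
  using assms
proof (induction k arbitrary: P m)
  case 0
  then show ?case by (simp add: bind_return_pmf split_def)
next
  case (Suc k)
  let ?f = "\<lambda>(P', Q', m'). do { (P'', m'') \<leftarrow> steps k P' m'; return_pmf (P'', Q', m'') }"
  have "do { (P', m') \<leftarrow> steps (Suc k) P m; (Q', m'') \<leftarrow> steps n Q m'; return_pmf (P', Q', m'') } =
     do { (P', m') \<leftarrow> step P m;
       do { (P'', m'') \<leftarrow> steps k P' m'; (Q', m''') \<leftarrow> steps n Q m''; return_pmf (P'', Q', m''') } }"
    by (simp add: bind_assoc_pmf split_def)
  also have "\<dots> = do { (P', m') \<leftarrow> step P m;
       do { (Q', m'') \<leftarrow> steps n Q m'; (P'', m''') \<leftarrow> steps k P' m''; return_pmf (P'', Q', m''') } }"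
  proof (intro bind_pmf_cong refl, clarify)
    fix P' m' assume "(P', m') \<in> set_pmf (step P m)"
    moreover from step_preserves(1)[OF this] have "set_prog P' \<inter> set_prog Q = {}"
      using Suc.prems(2) by auto
    ultimately show "do { (P'', m'') \<leftarrow> steps k P' m'; (Q', m''') \<leftarrow> steps n Q m''; return_pmf (P'', Q', m''') } =
       do { (Q', m'') \<leftarrow> steps n Q m'; (P'', m''') \<leftarrow> steps k P' m''; return_pmf (P'', Q', m''') }"
      using Suc.IH Suc.prems(1) wf_step by blast
  qed
  also have "\<dots> = do { (P', m') \<leftarrow> step P m; (Q', m'') \<leftarrow> steps n Q m'; return_pmf (P', Q', m'') } \<bind> ?f"
    by (simp add: bind_assoc_pmf bind_return_pmf split_def)
  also have "\<dots> = do { (Q', m') \<leftarrow> steps n Q m; (P', m'') \<leftarrow> step P m'; return_pmf (P', Q', m'') } \<bind> ?f"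
    by (simp only: step_steps_commute[OF Suc.prems])
  finally show ?case by (simp add: bind_assoc_pmf bind_return_pmf split_def)
qed

lemma wf_run:
  assumes "wf_mem m" "halts P m" "m' \<in> set_pmf (run P m)" shows "wf_mem m'"
  using assms wf_steps by (fastforce simp: halts_def set_run)

lemma agree_run:
  assumes "halts P m" "m' \<in> set_pmf (run P m)" "set_prog P \<inter> R = {}" shows "agree R m m'"
proof -
  from assms(1,2) obtain n P' where "(P', m') \<in> set_pmf (steps n P m)"
    by (auto simp: halts_def set_run)
  then show ?thesis
  proof (rule steps_invariant)
    fix i m1 m2
    assume "set_instr i \<subseteq> set_prog P" "agree R m m1" "m2 \<in> set_pmf (exec i m1)"
    moreover from this have "agree R m1 m2" using assms(3) by (intro exec_agree) auto
    ultimately show "agree R m m2" by (simp add: agree_def)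
  qed (simp add: agree_def)
qed

text \<open>This is no signalling: the qubits of the two programs may be entangled.\<close>

lemma run_commute:
  assumes "wf_mem m" "set_prog P \<inter> set_prog Q = {}"
    and P: "\<And>m. wf_mem m \<Longrightarrow> halts P m" and Q: "\<And>m. wf_mem m \<Longrightarrow> halts Q m"
  shows "run P m \<bind> run Q = run Q m \<bind> run P"
proof -
  \<comment> \<open>Only runs with fixed step counts are exchanged, so \<open>k\<close> and
    \<open>n\<close> must suffice on \<open>m\<close> and also on every outcome of either
    program.\<close>
  have fin: "finite (insert m (set_pmf (run P m) \<union> set_pmf (run Q m)))"
    using assms(1) P Q by (simp add: finite_set_run)
  have wf: "wf_mem m'" if "m' \<in> insert m (set_pmf (run P m) \<union> set_pmf (run Q m))" for m'
    using that assms(1) P Q wf_run by blast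
  obtain k where k: "\<And>m'. m' \<in> insert m (set_pmf (run P m) \<union> set_pmf (run Q m)) \<Longrightarrow> halts_within k P m'"
    using halts_uniform[OF fin] wf P by metis
  obtain n where n: "\<And>m'. m' \<in> insert m (set_pmf (run P m) \<union> set_pmf (run Q m)) \<Longrightarrow> halts_within n Q m'"
    using halts_uniform[OF fin] wf Q by metis
  have "run P m \<bind> run Q = run P m \<bind> (\<lambda>m'. map_pmf snd (steps n Q m'))"
    by (intro bind_pmf_cong) (simp_all add: run_eq[OF n])
  also have "\<dots> = map_pmf (snd \<circ> snd)
      (do { (P', m') \<leftarrow> steps k P m; (Q', m'') \<leftarrow> steps n Q m'; return_pmf (P', Q', m'') })"
    by (simp add: run_eq[OF k, of m] bind_map_pmf split_def map_pmf_def bind_assoc_pmf bind_return_pmf)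
  also have "\<dots> = run Q m \<bind> (\<lambda>m'. map_pmf snd (steps k P m'))"
    unfolding steps_commute[OF assms(1,2)]
    by (simp add: run_eq[OF n, of m] bind_map_pmf split_def map_pmf_def bind_assoc_pmf bind_return_pmf)
  also have "\<dots> = run Q m \<bind> run P"
    by (intro bind_pmf_cong) (simp_all add: run_eq[OF k])
  finally show ?thesis .
qed

section \<open>Renaming registers\<close>

definition rename :: "('v \<Rightarrow> 'w) \<Rightarrow> 'v mem \<Rightarrow> 'w mem" where
  "rename h m = \<lparr>cl = cl m \<circ> inv h, ql = ql m \<circ> inv h, amp = (\<lambda>c. amp m (c \<circ> map_prod h id))\<rparr>"

lemma rename_sel [simp]:
  "cl (rename h m) = cl m \<circ> inv h" "ql (rename h m) = ql m \<circ> inv h"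
  "amp (rename h m) = (\<lambda>c. amp m (c \<circ> map_prod h id))"
  by (simp_all add: rename_def)

lemma bij_reindex_config:
  assumes "bij h" shows "bij (\<lambda>c :: 'w config. c \<circ> map_prod h id)"
proof (rule o_bij)
  show "(\<lambda>c. c \<circ> map_prod (inv h) id) \<circ> (\<lambda>c. c \<circ> map_prod h id) = id"
    using assms by (auto simp: fun_eq_iff bij_is_surj surj_f_inv_f)
  show "(\<lambda>c. c \<circ> map_prod h id) \<circ> (\<lambda>c. c \<circ> map_prod (inv h) id) = id"
    using assms by (auto simp: fun_eq_iff bij_is_inj)
qed

lemma fun_upd_comp_inv:
  assumes "bij h" shows "(s \<circ> inv h)(h v := x) = s(v := x) \<circ> inv h"
  using assms by (auto simp: fun_eq_iff bij_is_inj bij_is_surj surj_f_inv_f)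

lemma fun_upd_comp_map_prod:
  assumes "inj h" shows "c((h v, n) := b) \<circ> map_prod h id = (c \<circ> map_prod h id)((v, n) := b)"
  using assms by (auto simp: fun_eq_iff dest: injD)

lemma rename_inverse:
  assumes "bij h" shows "rename h (rename (inv h) m) = m"
proof (rule mem_eqI)
  have "(c \<circ> map_prod h id) \<circ> map_prod (inv h) id = c" for c :: "_ \<times> nat \<Rightarrow> bool"
    using assms by (auto simp: fun_eq_iff bij_is_surj surj_f_inv_f)
  then show "amp (rename h (rename (inv h) m)) = amp m" by (simp add: o_def)
qed (use assms in \<open>auto simp: fun_eq_iff inv_inv_eq bij_is_surj surj_f_inv_f\<close>)

lemma coin_rename:
  assumes "bij h" shows "coin (map_instr h i) (rename h m) = coin i m"
proof (cases i)
  case (QMeasure v)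
  have "norm_sq (\<lambda>c. \<psi> (c \<circ> map_prod h id)) = norm_sq \<psi>" for \<psi>
    by (rule norm_sq_reindex[OF bij_reindex_config[OF assms]])
  from this[of "proj (v, n) True (amp m)" for n] this[of "amp m"]
  show ?thesis using QMeasure assms by (simp add: bij_is_inj prob_one_def proj_def)
qed auto

lemma act_rename:
  assumes "bij h" shows "act (map_instr h i) b (rename h m) = rename h (act i b m)"
proof (rule mem_eqI)
  note inj = bij_is_inj[OF assms]
  show "cl (act (map_instr h i) b (rename h m)) = cl (rename h (act i b m))"
    by (cases i) (use inj in \<open>simp_all add: fun_upd_comp_inv[OF assms]\<close>)
  show "ql (act (map_instr h i) b (rename h m)) = ql (rename h (act i b m))"
    by (cases i) (use inj in \<open>simp_all add: fun_upd_comp_inv[OF assms] Let_def\<close>)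
  show "amp (act (map_instr h i) b (rename h m)) = amp (rename h (act i b m))"
    by (cases i) (use inj in \<open>simp_all add: fun_upd_comp_map_prod fun_eq_iff apply_gate_def
        swap_ket_def cnot_ket_def collapse_def inj_eq\<close>)
qed

lemma exec_rename:
  assumes "bij h" shows "exec (map_instr h i) (rename h m) = map_pmf (rename h) (exec i m)"
  by (simp add: exec_act coin_rename[OF assms] act_rename[OF assms] pmf.map_comp o_def)

lemma run_rename:
  assumes "bij h"
  shows "halts_within n (map_prog h P) (rename h m) \<longleftrightarrow> halts_within n P m"
    and "run (map_prog h P) (rename h m) = map_pmf (rename h) (run P m)"
proof -
  have "Defs.holds (map_test h t) (rename h m) = Defs.holds t m" for t m
    using assms by (cases t) (auto simp: bij_is_inj)
  note sim = run_simulation[of "\<lambda>_. True" UNIV h "rename h" "\<lambda>_. True", OF exec_rename[OF assms] this]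
  show "halts_within n (map_prog h P) (rename h m) \<longleftrightarrow> halts_within n P m"
    and "run (map_prog h P) (rename h m) = map_pmf (rename h) (run P m)"
    by (rule sim; simp)+
qed

lemma wf_rename:
  assumes "bij h" "wf_mem m" shows "wf_mem (rename h m)"
proof -
  note bij = bij_reindex_config[OF assms(1)]
  note wf = assms(2)[unfolded wf_mem_def]
  have "finite (support (amp (rename h m)))"
    unfolding rename_sel using wf by (intro finite_support_reindex[OF bij]) simp
  moreover obtain c where "amp m c \<noteq> 0" using wf by blast
  then have "amp (rename h m) (inv (\<lambda>c. c \<circ> map_prod h id) c) \<noteq> 0"
    by (simp add: surj_f_inv_f[OF bij_is_surj[OF bij]])
  moreover have "\<not> c (v, i)" if "amp (rename h m) c \<noteq> 0" "ql (rename h m) v \<le> i" for c v i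
  proof -
    have "\<not> (c \<circ> map_prod h id) (inv h v, i)" using wf that by auto
    then show ?thesis by (simp add: surj_f_inv_f[OF bij_is_surj[OF assms(1)]])
  qed
  ultimately show ?thesis unfolding wf_mem_def by blast
qed

text \<open>Removing finitely many elements leaves countably infinite sets on both sides, and any
  bijection between them completes \<open>f\<close>.\<close>

lemma bij_extension:
  fixes f :: "'v \<Rightarrow> 'w"
  assumes "finite R" "inj_on f R"
    and "countable (UNIV :: 'v set)" "infinite (UNIV :: 'v set)"
    and "countable (UNIV :: 'w set)" "infinite (UNIV :: 'w set)"
  obtains h where "bij h" "\<And>r. r \<in> R \<Longrightarrow> h r = f r"
proof -
  have "countable (- R)" "countable (- f ` R)"
    using assms(3,5) countable_subset subset_UNIV by blast+
  moreover have "infinite (- R)" "infinite (- f ` R)"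
    using assms(1,4,6) by (simp_all add: Compl_eq_Diff_UNIV Diff_infinite_finite)
  ultimately obtain g where g: "bij_betw g (- R) (- f ` R)"
    using to_nat_on_infinite[of "- R"] bij_betw_from_nat_into[of "- f ` R"] bij_betw_trans by blast
  let ?h = "\<lambda>r. if r \<in> R then f r else g r"
  have "bij_betw ?h (R \<union> - R) (f ` R \<union> - f ` R)"
    using bij_betw_disjoint_Un[OF inj_on_imp_bij_betw[OF assms(2)] g] by simp
  then have "bij ?h" by simp
  then show ?thesis by (rule that) simp
qed

section \<open>Closure properties of polynomial time\<close>

text \<open>\<open>poly_time\<close> is tied to registers numbered by pairs. On the joint memory the
  equations between runs need only this weaker property.\<close>

definition terminating :: "'v prog \<Rightarrow> bool" where
  "terminating P \<longleftrightarrow> (\<forall>m. wf_mem m \<longrightarrow> halts P m)"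

lemma poly_mono_nat: "x \<le> y \<Longrightarrow> poly p x \<le> poly p (y :: nat)"
  by (induction p) (auto intro: add_mono mult_mono)

lemma set_prog_map [simp]: "set_prog (map_prog f P) = f ` set_prog P"
  by (rule prog.set_map)

text \<open>
  Polynomial time is a statement about memories with registers \<open>nat \<times> nat\<close>.  A memory with other
  registers, possibly entangled with those of the program, is covered by extending the renaming of
  the registers of the program to a bijection between all registers.
\<close>

lemma halts_within_map_prog:
  fixes f :: "'v \<Rightarrow> 'w"
  assumes "inj_on f (set_prog P)" "wf_mem m"
    and "countable (UNIV :: 'v set)" "infinite (UNIV :: 'v set)"
    and "countable (UNIV :: 'w set)" "infinite (UNIV :: 'w set)"
  obtains m0 where "wf_mem m0" "mem_size (set_prog P) m0 = mem_size (set_prog (map_prog f P)) m"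
    "\<And>n. halts_within n (map_prog f P) m \<longleftrightarrow> halts_within n P m0"
proof -
  obtain h where h: "bij h" "\<And>r. r \<in> set_prog P \<Longrightarrow> h r = f r"
    using bij_extension[OF finite_set_prog assms(1,3-6)] by blast
  let ?m0 = "rename (inv h) m"
  have eq: "map_prog f P = map_prog h P"
    using h(2) by (intro prog.map_cong) auto
  have "mem_size (set_prog P) ?m0 = mem_size (h ` set_prog P) m"
    unfolding mem_size_def using h(1)
    by (subst sum.reindex) (auto simp: inv_inv_eq bij_is_inj intro: inj_on_subset[OF bij_is_inj[OF h(1)]])
  moreover have "halts_within n (map_prog h P) m \<longleftrightarrow> halts_within n P ?m0" for n
    using run_rename(1)[OF h(1), of n P ?m0] by (simp add: rename_inverse[OF h(1)])
  moreover have "wf_mem ?m0" by (rule wf_rename[OF bij_imp_bij_inv[OF h(1)] assms(2)])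
  ultimately show ?thesis using that unfolding eq by simp
qed

lemma poly_timeI:
  assumes "\<And>m. wf_mem m \<Longrightarrow> halts_within (poly p (mem_size (set_prog P) m)) P m"
  shows "poly_time P"
  using assms by (auto simp: poly_time_def)

lemma infinite_nat_pairs: "infinite (UNIV :: (nat \<times> nat) set)"
  by (simp add: finite_prod)

lemma poly_time_map_prog:
  fixes f :: "nat \<times> nat \<Rightarrow> nat \<times> nat"
  assumes "poly_time P" "inj_on f (set_prog P)"
  shows "poly_time (map_prog f P)"
proof -
  from assms(1) obtain p where
    p: "\<And>m. wf_mem m \<Longrightarrow> halts_within (poly p (mem_size (set_prog P) m)) P m"
    by (auto simp: poly_time_def)
  show ?thesis
  proof (rule poly_timeI)
    fix m :: "(nat \<times> nat) mem" assume "wf_mem m"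
    from halts_within_map_prog[OF assms(2) this] obtain m0 where
      "wf_mem m0" "mem_size (set_prog P) m0 = mem_size (set_prog (map_prog f P)) m"
      "\<And>n. halts_within n (map_prog f P) m \<longleftrightarrow> halts_within n P m0"
      using infinite_nat_pairs by auto
    with p[of m0] show "halts_within (poly p (mem_size (set_prog (map_prog f P)) m)) (map_prog f P) m"
      by simp
  qed
qed

lemma terminating_map_prog:
  fixes f :: "nat \<times> nat \<Rightarrow> 'w"
  assumes "poly_time P" "inj_on f (set_prog P)"
    and "countable (UNIV :: 'w set)" "infinite (UNIV :: 'w set)"
  shows "terminating (map_prog f P)"
  unfolding terminating_def
proof (intro allI impI)
  fix m :: "'w mem" assume "wf_mem m"
  from halts_within_map_prog[OF assms(2) this _ _ assms(3,4)] obtain m0 where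
    "wf_mem m0" "\<And>n. halts_within n (map_prog f P) m \<longleftrightarrow> halts_within n P m0"
    using infinite_nat_pairs by auto
  with assms(1) show "halts (map_prog f P) m" by (auto simp: poly_time_def halts_def)
qed

lemma terminating_Seq:
  assumes "terminating P" "terminating Q" shows "terminating (Seq P Q)"
  using assms run_Seq(1) wf_run unfolding terminating_def by metis

lemma run_Seq_terminating:
  assumes "terminating P" "terminating Q" "wf_mem m"
  shows "run (Seq P Q) m = run P m \<bind> run Q"
  using assms run_Seq(2) wf_run unfolding terminating_def by metis

lemma mem_size_exec:
  assumes "finite R" "m' \<in> set_pmf (exec i m)"
  shows "mem_size R m' \<le> Suc (mem_size R m)"
proof -
  \<comment> \<open>\<open>r\<close> is the only register whose stacks can grow in total: the target
    of a push, of a new qubit or of a move. A measurement trades a qubit for a bit.\<close>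
  have "\<exists>r. \<forall>v. length (cl m' v) + ql m' v \<le> length (cl m v) + ql m v + (if v = r then 1 else 0)"
  proof (cases i)
    case (QMove v w)
    then show ?thesis using assms(2) by (intro exI[of _ w]) (auto simp: Let_def)
  next
    case (Push b v)
    then show ?thesis using assms(2) by (intro exI[of _ v]) (auto simp: push_def)
  next
    case (Toss v)
    then show ?thesis using assms(2) by (intro exI[of _ v]) (auto simp: push_def)
  next
    case (QMeasure v)
    then show ?thesis using assms(2) by (intro exI[of _ v]) (auto simp: push_def split: if_splits)
  next
    case (QNew v)
    then show ?thesis using assms(2) by (intro exI[of _ v]) auto
  qed (use assms(2) in auto)
  then obtain r where
    "\<And>v. length (cl m' v) + ql m' v \<le> length (cl m v) + ql m v + (if v = r then 1 else 0)"
    by blast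
  then have "mem_size R m' \<le> (\<Sum>v\<in>R. length (cl m v) + ql m v + (if v = r then 1 else 0))"
    unfolding mem_size_def by (rule sum_mono)
  also have "\<dots> \<le> Suc (mem_size R m)"
    using assms(1) by (simp only: sum.distrib mem_size_def) simp
  finally show ?thesis .
qed

text \<open>Time bounds the growth of the memory; this controls the input size of the second program
  in a sequence.\<close>

lemma mem_size_steps:
  assumes "finite R" "(P', m') \<in> set_pmf (steps n P m)"
  shows "mem_size R m' \<le> mem_size R m + n"
  using assms(2)
proof (induction n arbitrary: P m)
  case (Suc n)
  then obtain P1 m1 where 1: "(P1, m1) \<in> set_pmf (step P m)"
    and "(P', m') \<in> set_pmf (steps n P1 m1)" by auto
  with Suc.IH have "mem_size R m' \<le> mem_size R m1 + n" by blast
  moreover have "mem_size R m1 \<le> Suc (mem_size R m)"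
    using 1 by (rule set_step_cases) (auto dest: mem_size_exec[OF assms(1)])
  ultimately show ?case by simp
qed simp

lemma mem_size_mono: "finite R' \<Longrightarrow> R \<subseteq> R' \<Longrightarrow> mem_size R m \<le> mem_size R' m"
  unfolding mem_size_def by (rule sum_mono2) auto

lemma poly_time_Seq:
  assumes "poly_time P" "poly_time Q" shows "poly_time (Seq P Q)"
proof -
  from assms obtain p q where
    p: "\<And>m. wf_mem m \<Longrightarrow> halts_within (poly p (mem_size (set_prog P) m)) P m" and
    q: "\<And>m. wf_mem m \<Longrightarrow> halts_within (poly q (mem_size (set_prog Q) m)) Q m"
    unfolding poly_time_def by blast
  show ?thesis
  proof (rule poly_timeI)
    fix m :: "(nat \<times> nat) mem" assume wf: "wf_mem m"
    let ?s = "mem_size (set_prog (Seq P Q)) m"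
    have P: "halts_within (poly p ?s) P m"
      using p[OF wf] by (rule halts_within_mono) (intro poly_mono_nat mem_size_mono; auto)
    have "halts_within (poly q (?s + poly p ?s)) Q m'" if m': "m' \<in> set_pmf (run P m)" for m'
    proof -
      obtain P' where steps: "(P', m') \<in> set_pmf (steps (poly p ?s) P m)"
        using m' by (auto simp: set_run[OF P])
      have "mem_size (set_prog Q) m' \<le> mem_size (set_prog Q) m + poly p ?s"
        by (rule mem_size_steps[OF _ steps]) simp
      also have "\<dots> \<le> ?s + poly p ?s" by (simp add: mem_size_mono)
      finally have "mem_size (set_prog Q) m' \<le> ?s + poly p ?s" .
      with q[OF wf_steps[OF wf steps]] show ?thesis
        by (rule halts_within_mono[OF _ poly_mono_nat])
    qed
    from halts_within_Seq(1)[OF P this]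
    have "halts_within (Suc (poly p ?s + poly q (?s + poly p ?s))) (Seq P Q) m" .
    \<comment> \<open>\<open>[:0, 1:]\<close> is the identity polynomial, so \<open>q\<close> is
      composed with a bound on the memory that \<open>Q\<close> may find. The 1 pays for passing
      from \<open>P\<close> to \<open>Q\<close>.\<close>
    then show "halts_within (poly (1 + p + pcompose q ([:0, 1:] + p)) ?s) (Seq P Q) m"
      by (simp add: poly_pcompose)
  qed
qed

lemma poly_time_Do: "poly_time (Do i)"
  by (rule poly_timeI[of 1]) (simp add: run_Do(1)[simplified])

lemma poly_time_Cond:
  assumes "poly_time P" "poly_time Q" shows "poly_time (Cond t P Q)"
proof -
  from assms obtain p q where
    p: "\<And>m. wf_mem m \<Longrightarrow> halts_within (poly p (mem_size (set_prog P) m)) P m" and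
    q: "\<And>m. wf_mem m \<Longrightarrow> halts_within (poly q (mem_size (set_prog Q) m)) Q m"
    unfolding poly_time_def by blast
  show ?thesis
  proof (rule poly_timeI)
    fix m :: "(nat \<times> nat) mem" assume wf: "wf_mem m"
    let ?s = "mem_size (set_prog (Cond t P Q)) m"
    have "poly p (mem_size (set_prog P) m) \<le> poly p ?s" "poly q (mem_size (set_prog Q) m) \<le> poly q ?s"
      by (intro poly_mono_nat mem_size_mono; auto)+
    then have "poly p (mem_size (set_prog P) m) \<le> poly p ?s + poly q ?s"
      "poly q (mem_size (set_prog Q) m) \<le> poly p ?s + poly q ?s" by simp_all
    then have "halts_within (poly p ?s + poly q ?s) (if Defs.holds t m then P else Q) m"
      using p[OF wf] q[OF wf] by (auto intro: halts_within_mono)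
    from run_Cond(1)[OF this] show "halts_within (poly (1 + p + q) ?s) (Cond t P Q) m" by simp
  qed
qed

section \<open>Copying classical strings\<close>

definition upd :: "'v set \<Rightarrow> ('v \<Rightarrow> bits) \<Rightarrow> 'v mem \<Rightarrow> 'v mem" where
  "upd X s m = m\<lparr>cl := override_on (cl m) s X\<rparr>"

lemma upd_sel [simp]:
  "cl (upd X s m) = override_on (cl m) s X" "ql (upd X s m) = ql m" "amp (upd X s m) = amp m"
  by (simp_all add: upd_def)

lemma wf_upd [simp]: "wf_mem (upd X s m) \<longleftrightarrow> wf_mem m"
  by (simp add: wf_mem_def)

primrec pushes :: "bool \<Rightarrow> 'v list \<Rightarrow> 'v prog" where
  "pushes b [] = Skip"
| "pushes b (w # ws) = Seq (Do (Push b w)) (pushes b ws)"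

definition fan :: "'v \<Rightarrow> 'v list \<Rightarrow> 'v prog" where
  "fan v ws = While (NonEmpty v)
     (Seq (Cond (TopIsOne v) (pushes True ws) (pushes False ws)) (Do (Pop v)))"

text \<open>\<open>fan\<close> reverses the string, so it has to be used twice.\<close>

definition transfer :: "'v \<Rightarrow> 'v \<Rightarrow> 'v list \<Rightarrow> 'v prog" where
  "transfer v t ws = Seq (fan v [t]) (fan t ws)"

lemma map_pushes: "map_prog f (pushes b ws) = pushes b (map f ws)"
  by (induction ws) auto

lemma map_fan: "map_prog f (fan v ws) = fan (f v) (map f ws)"
  by (simp add: fan_def map_pushes)

lemma map_transfer: "map_prog f (transfer v t ws) = transfer (f v) (f t) (map f ws)"
  by (simp add: transfer_def map_fan)

lemma run_pushes:
  assumes "distinct ws"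
  shows "halts_within (2 * length ws) (pushes b ws) m \<and>
    run (pushes b ws) m = return_pmf (upd (set ws) (\<lambda>r. b # cl m r) m)"
  using assms
proof (induction ws arbitrary: m)
  case Nil
  have "upd {} (\<lambda>r. b # cl m r) m = m" by (intro mem_eqI) auto
  then show ?case using run_Skip[of m] by simp
next
  case (Cons w ws)
  have D: "run (Do (Push b w)) m = return_pmf (push b w m)" by (simp add: run_Do(2))
  have IH: "halts_within (2 * length ws) (pushes b ws) m'"
    "run (pushes b ws) m' = return_pmf (upd (set ws) (\<lambda>r. b # cl m' r) m')" for m'
    using Cons by auto
  have "upd (set ws) (\<lambda>r. b # cl (push b w m) r) (push b w m) =
      upd (set (w # ws)) (\<lambda>r. b # cl m r) m"
    using Cons.prems by (intro mem_eqI) (auto simp: override_on_def push_def)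
  then show ?case
    using halts_within_Seq[OF run_Do(1)[of "Push b w" m] IH(1)] by (simp add: D IH(2) bind_return_pmf)
qed

text \<open>Each bit costs \<open>2 * length ws\<close> steps for the pushes, one for the
  conditional, one for the pop, one for the loop test and one for each of two sequences. The outer
  \<open>Suc\<close> is the last loop test. The first bit read ends up deepest, hence the
  reversal.\<close>

lemma run_fan:
  assumes "distinct ws" "v \<notin> set ws"
  shows "halts_within (Suc ((2 * length ws + 5) * length (cl m v))) (fan v ws) m \<and>
    run (fan v ws) m = return_pmf
      (upd (insert v (set ws)) (\<lambda>r. if r = v then [] else rev (cl m v) @ cl m r) m)"
proof (induction "cl m v" arbitrary: m)
  case Nil
  have "upd (insert v (set ws)) (\<lambda>r. if r = v then [] else rev (cl m v) @ cl m r) m = m"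
    using Nil by (intro mem_eqI) (auto simp: override_on_def)
  then show ?case using run_While_False[of "NonEmpty v" m] Nil by (simp add: fan_def)
next
  case (Cons b s)
  let ?C = "Cond (TopIsOne v) (pushes True ws) (pushes False ws)"
  let ?L = "length ws"
  let ?m1 = "upd (set ws) (\<lambda>r. b # cl m r) m"
  define m2 where "m2 = ?m1\<lparr>cl := (cl ?m1)(v := tl (cl ?m1 v))\<rparr>"
  have b: "cl m v = b # s" using Cons.hyps by simp
  note pushes = run_pushes[OF assms(1), of _ m]
  have "halts_within (2 * ?L) (if Defs.holds (TopIsOne v) m then pushes True ws else pushes False ws) m"
    using pushes by auto
  from run_Cond[OF this] have C: "halts_within (Suc (2 * ?L)) ?C m" "run ?C m = return_pmf ?m1"
    using pushes b by (auto split: if_splits)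
  have P: "run (Do (Pop v)) ?m1 = return_pmf m2" by (simp add: run_Do m2_def)
  have body: "halts_within (2 * ?L + 3) (Seq ?C (Do (Pop v))) m"
    "run (Seq ?C (Do (Pop v))) m = return_pmf m2"
    using halts_within_Seq[OF C(1), of 1 "Do (Pop v)"]
    by (simp_all add: run_Do(1)[simplified] C(2) P bind_return_pmf numeral_3_eq_3)
  have s: "s = cl m2 v" using b assms(2) by (simp add: m2_def)
  let ?N = "Suc ((2 * ?L + 5) * length (cl m2 v))"
  from Cons.hyps(1)[OF s] have IH: "halts_within ?N (fan v ws) m2"
    "run (fan v ws) m2 = return_pmf
      (upd (insert v (set ws)) (\<lambda>r. if r = v then [] else rev (cl m2 v) @ cl m2 r) m2)" by auto
  have seq: "halts_within (Suc (2 * ?L + 3 + ?N)) (Seq (Seq ?C (Do (Pop v))) (fan v ws)) m"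
    "run (Seq (Seq ?C (Do (Pop v))) (fan v ws)) m = run (fan v ws) m2"
    using halts_within_Seq[OF body(1), of ?N "fan v ws"] IH(1) by (simp_all add: body(2) bind_return_pmf)
  have v: "Defs.holds (NonEmpty v) m" by (simp add: b)
  note While = run_While_True[OF v seq(1)[unfolded fan_def], folded fan_def]
  have "halts_within (Suc (Suc (2 * ?L + 3 + ?N))) (fan v ws) m" by (rule While(1))
  moreover have "run (fan v ws) m = run (fan v ws) m2" using While(2) seq(2) by simp
  moreover have "upd (insert v (set ws)) (\<lambda>r. if r = v then [] else rev (cl m2 v) @ cl m2 r) m2 =
      upd (insert v (set ws)) (\<lambda>r. if r = v then [] else rev (cl m v) @ cl m r) m"
    using assms(2) by (intro mem_eqI) (auto simp: m2_def b override_on_def)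
  moreover have "Suc (Suc (2 * ?L + 3 + ?N)) = Suc ((2 * ?L + 5) * length (cl m v))"
    by (simp add: b s[symmetric])
  ultimately show ?case using IH(2) by (simp only: simp_thms)
qed

lemma poly_time_fan:
  assumes "distinct ws" "v \<notin> set ws" shows "poly_time (fan v ws)"
proof (rule poly_timeI)
  fix m :: "(nat \<times> nat) mem"
  have "v \<in> set_prog (fan v ws)" by (simp add: fan_def)
  then have "length (cl m v) + ql m v \<le> mem_size (set_prog (fan v ws)) m"
    unfolding mem_size_def by (intro member_le_sum) auto
  then have "(2 * length ws + 5) * length (cl m v) \<le>
      (2 * length ws + 5) * mem_size (set_prog (fan v ws)) m"
    by (intro mult_le_mono2) simp
  with run_fan[OF assms, of m]
  show "halts_within (poly [:1, 2 * length ws + 5:] (mem_size (set_prog (fan v ws)) m)) (fan v ws) m"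
    by (auto elim: halts_within_mono simp: algebra_simps)
qed

lemma poly_time_transfer:
  assumes "distinct ws" "t \<notin> set ws" "v \<noteq> t" shows "poly_time (transfer v t ws)"
  unfolding transfer_def using assms by (intro poly_time_Seq poly_time_fan) auto

text \<open>The source \<open>v\<close> may be among the targets: it is empty when the second pass
  starts and gets its content back. This case gives \<open>run_copy\<close>, the other one
  \<open>run_move\<close>.\<close>

lemma run_transfer:
  assumes "distinct ws" "t \<notin> set ws" "v \<noteq> t" "cl m t = []"
  shows "run (transfer v t ws) m = return_pmf (upd (insert v (set ws))
      (\<lambda>r. if r \<in> set ws then cl m v @ (if r = v then [] else cl m r) else []) m)"
proof -
  have halts: "halts (fan x ys) m" if "distinct ys" "x \<notin> set ys" for x m and ys :: "'a list"
    using run_fan[OF that] by (auto simp: halts_def)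
  have 1: "run (fan v [t]) m =
      return_pmf (upd {v, t} (\<lambda>r. if r = v then [] else rev (cl m v) @ cl m r) m)"
    using run_fan[of "[t]" v m] assms(3) by simp
  have "run (transfer v t ws) m = run (fan v [t]) m \<bind> run (fan t ws)"
    unfolding transfer_def using assms by (intro run_Seq halts) auto
  also have "\<dots> = run (fan t ws) (upd {v, t} (\<lambda>r. if r = v then [] else rev (cl m v) @ cl m r) m)"
    by (simp add: 1 bind_return_pmf)
  also have "\<dots> = return_pmf (upd (insert v (set ws))
      (\<lambda>r. if r \<in> set ws then cl m v @ (if r = v then [] else cl m r) else []) m)"
    using run_fan[OF assms(1,2)] assms(2-4)
    by (auto intro!: arg_cong[of _ _ return_pmf] mem_eqI simp: override_on_def fun_eq_iff)
  finally show ?thesis .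
qed

section \<open>Frame rules\<close>

text \<open>\<open>upd\<close> changes classical contents only, so coins, which depend on heights
  and amplitudes, stay the same; and the program neither reads nor writes \<open>X\<close>. This is
  a simulation with the identity as renaming.\<close>

lemma run_upd:
  assumes "set_prog P \<inter> X = {}"
  shows "run P (upd X s m) = map_pmf (upd X s) (run P m)"
    and "halts_within n P (upd X s m) \<longleftrightarrow> halts_within n P m"
proof -
  have act: "act i b (upd X s m) = upd X s (act i b m)" if "set_instr i \<subseteq> set_prog P" for i b m
  proof (rule mem_eqI)
    have out: "v \<notin> X" if "v \<in> set_instr i" for v using that assms \<open>set_instr i \<subseteq> set_prog P\<close> by auto
    show "cl (act i b (upd X s m)) = cl (upd X s (act i b m))"
    proof
      fix v
      show "cl (act i b (upd X s m)) v = cl (upd X s (act i b m)) v"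
        by (cases "v \<in> set_instr i") (auto simp: out act_outside override_on_def intro!: act_cong(1))
    qed
  qed simp_all
  have coin: "coin i (upd X s m) = coin i m" for i m by (cases i) auto
  have exec: "exec (map_instr id i) (upd X s m) = map_pmf (upd X s) (exec i m)"
    if "set_instr i \<subseteq> set_prog P" for i m
    by (simp add: instr.map_id exec_act coin act[OF that] pmf.map_comp o_def)
  have holds: "Defs.holds (map_test id t) (upd X s m) = Defs.holds t m"
    if "set_test t \<subseteq> set_prog P" for t m
    using that assms by (cases t) (auto simp: override_on_def)
  note sim = run_simulation[of "\<lambda>_. True" "set_prog P" id "upd X s" "\<lambda>_. True" P, OF exec holds]
  show "run P (upd X s m) = map_pmf (upd X s) (run P m)"
    using sim(2) by (simp add: prog.map_id)
  show "halts_within n P (upd X s m) \<longleftrightarrow> halts_within n P m"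
    using sim(1) by (simp add: prog.map_id)
qed

text \<open>Classical data are planted in \<open>m\<close> while its qubits stay in place. A
  classical algorithm specified by its run from \<open>load\<close> can thus be executed within an
  entangled memory.\<close>

definition embed :: "('v \<Rightarrow> 'w) \<Rightarrow> 'w mem \<Rightarrow> 'v mem \<Rightarrow> 'w mem" where
  "embed e m m' = upd (range e) (\<lambda>r. cl m' (inv e r)) m"

text \<open>Classical instructions and tests see bit stacks only. \<open>QNonEmpty\<close> would see
  the heights, which may differ between \<open>m\<close> and \<open>m'\<close>.\<close>

lemma run_embed:
  assumes "inj e" "uses_only classical_instr classical_test P"
  shows "run (map_prog e P) (embed e m m') = map_pmf (embed e m) (run P m')"
proof -
  have cl: "cl (embed e m m') (e v) = cl m' v" for v m'
    using assms(1) by (simp add: embed_def)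
  have upd: "(embed e m m')\<lparr>cl := (cl (embed e m m'))(e v := s)\<rparr> = embed e m (m'\<lparr>cl := (cl m')(v := s)\<rparr>)"
    for v s m'
    using assms(1) by (intro mem_eqI) (auto simp: embed_def override_on_def fun_eq_iff)
  have "exec (map_instr e i) (embed e m m') = map_pmf (embed e m) (exec i m')"
    if "classical_instr i" for i m'
    using that by (cases i) (auto simp: push_def cl upd pmf.map_comp o_def)
  moreover have "Defs.holds (map_test e t) (embed e m m') = Defs.holds t m'"
    if "classical_test t" for t m'
    using that by (cases t) (auto simp: cl)
  ultimately show ?thesis
    using assms(2) by (intro run_simulation(2)[where R = UNIV and I = classical_instr and T = classical_test]) auto
qed

lemma upd_eqI:
  assumes "\<And>r. cl m r = cl m' r" "ql m = ql m'" "amp m = amp m'" shows "m = (m' :: 'v mem)"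
  using assms by (intro mem_eqI) auto

lemma run_copy:
  assumes "cl m w = []" "cl m t = []" "v \<noteq> w" "t \<noteq> v" "t \<noteq> w"
  shows "run (transfer v t [v, w]) m = return_pmf (upd {w} (\<lambda>_. cl m v) m)"
  using assms by (subst run_transfer)
    (auto intro!: arg_cong[of _ _ return_pmf] upd_eqI simp: override_on_def)

lemma run_move:
  assumes "distinct ws" "\<And>w. w \<in> set ws \<Longrightarrow> cl m w = []" "cl m t = []"
    and "v \<notin> set ws" "t \<notin> set ws" "t \<noteq> v"
  shows "run (transfer v t ws) m = return_pmf (upd {v} (\<lambda>_. []) (upd (set ws) (\<lambda>_. cl m v) m))"
  using assms by (subst run_transfer)
    (auto intro!: arg_cong[of _ _ return_pmf] upd_eqI simp: override_on_def)

lemma run_Seq_return: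
  assumes "terminating P" "terminating Q" "wf_mem m" "run P m = return_pmf m'"
  shows "run (Seq P Q) m = run Q m'"
  by (simp add: run_Seq_terminating[OF assms(1-3)] assms(4) bind_return_pmf)

lemma countable_joint: "countable (UNIV :: (party \<times> nat \<times> nat) set)"
proof -
  have "(UNIV :: party set) = {Obfuscator, Evaluator, Alice, Bob, Charlie}"
    using party.exhaust by auto
  then have "countable (UNIV :: party set)" by (metis countable_finite finite.emptyI finite.insertI)
  then show ?thesis unfolding UNIV_Times_UNIV[symmetric] by (intro countable_SIGMA) auto
qed

lemma infinite_joint: "infinite (UNIV :: (party \<times> nat \<times> nat) set)"
  by (simp add: finite_prod)

lemma terminating_joint:
  fixes f :: "nat \<times> nat \<Rightarrow> party \<times> nat \<times> nat"
  assumes "poly_time P" "inj f" shows "terminating (map_prog f P)"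
  using terminating_map_prog[OF assms(1) _ countable_joint infinite_joint] assms(2)
  by (simp add: inj_on_subset)

lemma set_pushes [simp]: "set_prog (pushes b ws) = set ws"
  by (induction ws) auto

lemma set_transfer [simp]: "set_prog (transfer v t ws) = {v, t} \<union> set ws"
  by (auto simp: transfer_def fan_def)

lemma cl_run_outside:
  assumes "terminating P" "wf_mem m" "m' \<in> set_pmf (run P m)" "r \<notin> set_prog P"
  shows "cl m' r = cl m r"
  using agree_run[of P m m' "{r}"] assms by (auto simp: terminating_def agree_def)

lemma wf_run_terminating:
  assumes "terminating P" "wf_mem m" "m' \<in> set_pmf (run P m)" shows "wf_mem m'"
  using assms wf_run by (auto simp: terminating_def)

section \<open>The parts of the reduction\<close>

definition shift :: "nat \<Rightarrow> alg \<Rightarrow> alg" where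
  "shift N P = map_prog (\<lambda>(p, i). (N + p, i)) P"

lemma inj_shift: "inj (\<lambda>(p, i). (N + p :: nat, i :: nat))"
  by (auto simp: inj_on_def)

lemma inj_shifted: "inj f \<Longrightarrow> inj (\<lambda>(p, i). f (N + p :: nat, i :: nat))"
  by (rule injI) (auto dest: injD)

lemma poly_time_shift: "poly_time P \<Longrightarrow> poly_time (shift N P)"
  unfolding shift_def using inj_shift by (blast intro: poly_time_map_prog inj_on_subset)

definition high :: "(nat \<times> nat \<Rightarrow> 'w) \<Rightarrow> nat \<Rightarrow> 'w set" where
  "high f N = f ` ({N..} \<times> UNIV)"

abbreviation erase :: "'v set \<Rightarrow> 'v mem \<Rightarrow> 'v mem" where
  "erase X \<equiv> upd X (\<lambda>_. [])"

lemma mem_high: "inj f \<Longrightarrow> f (p, i) \<in> high f N \<longleftrightarrow> N \<le> p"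
  by (auto simp: high_def inj_eq)

text \<open>The shifted ports hold exactly the bits of \<open>load ins\<close>, so \<open>m\<close>
  is its own embedding of that memory and \<open>run_embed\<close> applies.\<close>

lemma run_shift:
  fixes f :: "nat \<times> nat \<Rightarrow> party \<times> nat \<times> nat"
  assumes "inj f" "uses_only classical_instr classical_test P"
    and "\<And>p i. cl m (f (N + p, i)) = (if i = 0 \<and> p < length ins then ins ! p else [])"
  shows "run (map_prog f (shift N P)) m =
    map_pmf (embed (\<lambda>(p, i). f (N + p, i)) m) (run P (load ins))"
proof -
  let ?e = "\<lambda>(p, i). f (N + p, i)"
  have e: "inj ?e" by (rule inj_shifted[OF assms(1)])
  have "embed ?e m (load ins) = m"
  proof (rule upd_eqI)
    fix r
    show "cl (embed ?e m (load ins)) r = cl m r"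
    proof (cases "r \<in> range ?e")
      case True
      then obtain p i where r: "r = ?e (p, i)" by auto
      then have "inv ?e r = (p, i)" using inv_f_f[OF e, of "(p, i)"] by simp
      with r True assms(3)[of p i] show ?thesis by (simp add: embed_def load_def)
    qed (simp add: embed_def)
  qed (simp_all add: embed_def)
  moreover have "map_prog f (shift N P) = map_prog ?e P"
    by (simp add: shift_def prog.map_comp o_def split_def)
  ultimately show ?thesis using run_embed[OF e assms(2), of m "load ins"] by simp
qed

lemma cl_embed_shift:
  assumes "inj f"
  shows "cl (embed (\<lambda>(p, i). f (N + p, i)) m m') (f (N + p, i)) = cl m' (p, i)"
    and "q < N \<Longrightarrow> cl (embed (\<lambda>(p, i). f (N + p, i)) m m') (f (q, i)) = cl m (f (q, i))"
    and "r \<notin> high f N \<Longrightarrow> cl (embed (\<lambda>(p, i). f (N + p, i)) m m') r = cl m r"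
proof -
  let ?e = "\<lambda>(p, i). f (N + p, i)"
  have e: "inj ?e" by (rule inj_shifted[OF assms])
  have "f (N + p, i) \<in> range ?e" by (rule image_eqI[of _ _ "(p, i)"]) auto
  moreover have "inv ?e (f (N + p, i)) = (p, i)" using inv_f_f[OF e, of "(p, i)"] by simp
  ultimately show "cl (embed ?e m m') (f (N + p, i)) = cl m' (p, i)" by (simp add: embed_def)
  have range: "range ?e \<subseteq> high f N" by (auto simp: high_def)
  show 1: "cl (embed ?e m m') r = cl m r" if "r \<notin> high f N" for r
  proof -
    have "r \<notin> range ?e" using that range by blast
    then show ?thesis unfolding embed_def upd_sel by (rule override_on_apply_notin)
  qed
  show "cl (embed ?e m m') (f (q, i)) = cl m (f (q, i))" if "q < N"
    using that by (intro 1) (simp add: mem_high[OF assms])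
qed

lemma embed_sel [simp]: "ql (embed e m m') = ql m" "amp (embed e m m') = amp m"
  by (simp_all add: embed_def)

lemma wf_embed [simp]: "wf_mem (embed e m m') \<longleftrightarrow> wf_mem m"
  by (simp add: embed_def)

text \<open>
  The programs of the pirate do not touch ports or registers from \<open>N\<close> on, and \<open>(0, N)\<close> is a temporary
  stack.  The key is left at \<open>(2, 0)\<close>, where the challenger reads it, and the auxiliary information
  at \<open>(2, N)\<close>.  It is passed on, together with the key, in the registers \<open>N\<close> and \<open>N + 1\<close> of the ports
  3 and 4, which are port 2 of the receivers.  A receiver outputs the negated verdict at \<open>(3, 0)\<close>.
\<close>

definition sampler :: "nat \<Rightarrow> alg \<Rightarrow> alg" where
  "sampler N P = Seq (transfer (0, 0) (0, N) [(0, 0), (N, 0)])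
     (Seq (shift N P)
     (Seq (transfer (N + 1, 0) (0, N) [(2, 0)]) (transfer (N + 2, 0) (0, N) [(2, N)])))"

definition distributor :: "nat \<Rightarrow> alg \<Rightarrow> alg" where
  "distributor N P = Seq (transfer (2, 0) (0, N) [(3, N), (4, N)])
     (Seq (transfer (2, N) (0, N) [(2, 0), (3, N + 1), (4, N + 1)]) P)"

text \<open>Acceptance means that the verdict stack is exactly \<open>[True]\<close>, so below its
  top bit there must be nothing left. An accepted answer yields the guess \<open>False\<close>, the
  value of \<open>b\<close> for the unpunctured circuit.\<close>

definition decide :: "'v \<Rightarrow> 'v \<Rightarrow> 'v prog" where
  "decide r q = Cond (TopIsOne r)
     (Seq (Do (Pop r)) (Cond (NonEmpty r) (Do (Push True q)) (Do (Push False q))))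
     (Do (Push True q))"

definition receiver :: "nat \<Rightarrow> alg \<Rightarrow> alg \<Rightarrow> alg" where
  "receiver N P V = Seq (transfer (0, 0) (0, N) [(0, 0), (N, 0)])
     (Seq (transfer (1, 0) (0, N) [(1, 0), (N + 3, 0)])
     (Seq (transfer (2, N) (0, N) [(N + 1, 0)])
     (Seq (transfer (2, N + 1) (0, N) [(N + 2, 0)])
     (Seq P
     (Seq (transfer (3, 0) (0, N) [(N + 4, 0)])
     (Seq (shift N V) (decide (N + 5, 0) (3, 0))))))))"

lemma poly_time_decide: "poly_time (decide r q)"
  unfolding decide_def by (intro poly_time_Cond poly_time_Seq poly_time_Do)

lemma map_decide: "map_prog f (decide r q) = decide (f r) (f q)"
  by (simp add: decide_def)

lemma poly_time_reduction:
  assumes "4 < N" "poly_time P" "poly_time V"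
  shows "poly_time (sampler N P)" "poly_time (distributor N P)" "poly_time (receiver N P V)"
  unfolding sampler_def distributor_def receiver_def using assms
  by (intro poly_time_Seq poly_time_transfer poly_time_shift poly_time_decide; simp)+

text \<open>\<open>s\<close> is what remains of the verdict stack. It depends on the verdict, but
  the register is scratch and will be erased, so its existence is enough.\<close>

lemma run_decide:
  assumes "cl m q = []" "r \<noteq> q"
  obtains s where
    "run (decide r q) m = return_pmf (upd {r} (\<lambda>_. s) (upd {q} (\<lambda>_. [cl m r \<noteq> [True]]) m))"
proof -
  let ?C = "Cond (NonEmpty r) (Do (Push True q)) (Do (Push False q))"
  let ?m1 = "m\<lparr>cl := (cl m)(r := tl (cl m r))\<rparr>"
  have C: "halts_within 2 ?C m'" "run ?C m' = return_pmf (push (cl m' r \<noteq> []) q m')" for m'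
    using run_Cond[of 1 "NonEmpty r" m' "Do (Push True q)" "Do (Push False q)"]
      run_Do[of "Push True q" m'] run_Do[of "Push False q" m'] by (auto simp: numeral_2_eq_2)
  have S: "halts_within 4 (Seq (Do (Pop r)) ?C) m" "run (Seq (Do (Pop r)) ?C) m = run ?C ?m1"
    using halts_within_Seq[OF run_Do(1)[of "Pop r" m] C(1)]
    by (simp_all add: run_Do(2) bind_return_pmf eval_nat_numeral)
  have "halts_within 4 (Do (Push True q)) m" using run_Do(1) by (rule halts_within_mono) simp
  with S(1) have "run (decide r q) m = (if cl m r \<noteq> [] \<and> hd (cl m r) then run ?C ?m1
      else return_pmf (push True q m))"
    unfolding decide_def
    using run_Cond(2)[of 4 "TopIsOne r" m "Seq (Do (Pop r)) ?C" "Do (Push True q)"] S(2)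
    by (simp add: run_Do(2))
  also have "\<dots> = return_pmf (upd {r} (\<lambda>_. if cl m r \<noteq> [] \<and> hd (cl m r) then tl (cl m r) else cl m r)
      (upd {q} (\<lambda>_. [cl m r \<noteq> [True]]) m))"
    using assms by (cases "cl m r")
      (auto simp: C(2) push_def override_on_def intro!: arg_cong[of _ _ return_pmf] upd_eqI)
  finally show ?thesis by (rule that)
qed

lemma run_sampler:
  fixes f :: "nat \<times> nat \<Rightarrow> party \<times> nat \<times> nat"
  assumes f: "inj f" and N: "4 < N" and P: "PPT P" and wf: "wf_mem m"
    and m: "\<And>p i. cl m (f (p, i)) = (if (p, i) = (0, 0) then u else [])"
  shows "map_pmf (erase (high f N)) (run (map_prog f (sampler N P)) m) =
    map_pmf (\<lambda>m'. upd {f (2, N)} (\<lambda>_. cl m' (2, 0)) (upd {f (2, 0)} (\<lambda>_. cl m' (1, 0)) m))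
      (run P (load [u]))"
proof -
  have P': "poly_time P" "uses_only classical_instr classical_test P" using P by (auto simp: PPT_def)
  note tm = terminating_joint[OF _ f]
  let ?e = "\<lambda>(p, i). f (N + p, i)"
  let ?m1 = "upd {f (N, 0)} (\<lambda>_. u) m"
  let ?Q = "transfer (N + 1, 0) (0, N) [(2, 0)]" and ?R = "transfer (N + 2, 0) (0, N) [(2, N)]"
  have ptime: "poly_time ?Q" "poly_time ?R" "poly_time (shift N P)"
    using N P'(1) by (auto intro: poly_time_transfer poly_time_shift)
  have 1: "run (map_prog f (sampler N P)) m = run (map_prog f (Seq (shift N P) (Seq ?Q ?R))) ?m1"
  proof -
    have "run (map_prog f (transfer (0, 0) (0, N) [(0, 0), (N, 0)])) m = return_pmf ?m1"
      unfolding map_transfer using N by (simp add: run_copy m inj_eq[OF f])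
    then show ?thesis unfolding sampler_def prog.map
      using N ptime wf by (intro run_Seq_return)
        (auto simp del: prog.map simp: prog.map[symmetric] intro!: tm poly_time_Seq poly_time_transfer)
  qed
  have 2: "run (map_prog f (shift N P)) ?m1 = map_pmf (embed ?e ?m1) (run P (load [u]))"
    using N by (intro run_shift[OF f P'(2)]) (auto simp: override_on_def m inj_eq[OF f])
  have 3: "map_pmf (erase (high f N)) (run (map_prog f (Seq ?Q ?R)) (embed ?e ?m1 m')) =
      return_pmf (upd {f (2, N)} (\<lambda>_. cl m' (2, 0)) (upd {f (2, 0)} (\<lambda>_. cl m' (1, 0)) m))" for m'
  proof -
    let ?m2 = "embed ?e ?m1 m'"
    have low: "cl ?m2 (f (q, i)) = (if (q, i) = (0, 0) then u else [])" if "q < N" for q i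
      using that m by (simp add: cl_embed_shift[OF f] override_on_def inj_eq[OF f])
    have e: "cl ?m2 (f (Suc N, i)) = cl m' (1, i)" "cl ?m2 (f (Suc (Suc N), i)) = cl m' (2, i)" for i
      using cl_embed_shift(1)[OF f, of N ?m1 m' 1 i] cl_embed_shift(1)[OF f, of N ?m1 m' 2 i] by simp_all
    let ?m3 = "upd {f (N + 1, 0)} (\<lambda>_. []) (upd {f (2, 0)} (\<lambda>_. cl m' (1, 0)) ?m2)"
    have "run (map_prog f ?Q) ?m2 = return_pmf ?m3"
      unfolding map_transfer using N by (subst run_move) (auto simp: low e inj_eq[OF f])
    then have "run (map_prog f (Seq ?Q ?R)) ?m2 = run (map_prog f ?R) ?m3"
      unfolding prog.map using ptime wf by (intro run_Seq_return tm) auto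
    also have "\<dots> = return_pmf (upd {f (N + 2, 0)} (\<lambda>_. []) (upd {f (2, N)} (\<lambda>_. cl m' (2, 0)) ?m3))"
      unfolding map_transfer using N
      by (subst run_move) (auto simp: low e inj_eq[OF f] override_on_def)
    finally have run: "run (map_prog f (Seq ?Q ?R)) ?m2 = \<dots>" .
    have "erase (high f N) (upd {f (N + 2, 0)} (\<lambda>_. []) (upd {f (2, N)} (\<lambda>_. cl m' (2, 0)) ?m3)) =
      upd {f (2, N)} (\<lambda>_. cl m' (2, 0)) (upd {f (2, 0)} (\<lambda>_. cl m' (1, 0)) m)"
    proof (rule upd_eqI)
      fix r
      have "cl m r = []" if "r \<in> high f N" using that m N by (auto simp: high_def)
      moreover have "cl ?m2 r = cl m r" if "r \<notin> high f N"
        using that cl_embed_shift(3)[OF f that, of ?m1] by (auto simp: override_on_def mem_high[OF f])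
      moreover have "f (2, i) \<notin> high f N" "f (N + 1, i) \<in> high f N" "f (N + 2, i) \<in> high f N" for i
        using N by (auto simp: mem_high[OF f])
      ultimately show "cl (erase (high f N) (upd {f (N + 2, 0)} (\<lambda>_. []) (upd {f (2, N)} (\<lambda>_. cl m' (2, 0)) ?m3))) r =
        cl (upd {f (2, N)} (\<lambda>_. cl m' (2, 0)) (upd {f (2, 0)} (\<lambda>_. cl m' (1, 0)) m)) r"
        using N by (auto simp: override_on_def inj_eq[OF f])
    qed simp_all
    then show ?thesis unfolding run by simp
  qed
  have "run (map_prog f (sampler N P)) m =
      run P (load [u]) \<bind> (\<lambda>m'. run (map_prog f (Seq ?Q ?R)) (embed ?e ?m1 m'))"
    unfolding 1 prog.map(3)[of f "shift N P"]
    using ptime wf by (subst run_Seq_terminating) (auto simp del: prog.map simp: 2 bind_map_pmf intro!: tm poly_time_Seq)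
  then show ?thesis by (simp only: map_bind_pmf 3) (simp add: map_pmf_def)
qed

text \<open>The registers from \<open>N\<close> on at ports 3 and 4 lie outside \<open>P\<close>. By
  the frame rule the strings stored there might as well be written after \<open>P\<close> has
  run.\<close>

lemma run_distributor:
  fixes f :: "nat \<times> nat \<Rightarrow> party \<times> nat \<times> nat"
  assumes f: "inj f" and N: "4 < N" and P: "poly_time P" "set_prog P \<subseteq> {..<N} \<times> {..<N}"
    and wf: "wf_mem m"
    and m: "\<And>i. cl m (f (0, N)) = []" "\<And>i. N \<le> i \<Longrightarrow> cl m (f (3, i)) = []" "\<And>i. N \<le> i \<Longrightarrow> cl m (f (4, i)) = []"
  shows "run (map_prog f (distributor N P)) m =
    map_pmf (upd {f (3, N), f (4, N), f (3, N + 1), f (4, N + 1)}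
        (\<lambda>r. if r \<in> {f (3, N), f (4, N)} then cl m (f (2, 0)) else cl m (f (2, N))))
      (run (map_prog f P) (erase {f (2, N)} (upd {f (2, 0)} (\<lambda>_. cl m (f (2, N))) m)))"
proof -
  note tm = terminating_joint[OF _ f]
  let ?R = "transfer (2, N) (0, N) [(2, 0), (3, N + 1), (4, N + 1)]"
  let ?m1 = "erase {f (2, 0)} (upd {f (3, N), f (4, N)} (\<lambda>_. cl m (f (2, 0))) m)"
  let ?m2 = "erase {f (2, N)} (upd {f (2, 0), f (3, N + 1), f (4, N + 1)} (\<lambda>_. cl m (f (2, N))) ?m1)"
  have R: "poly_time ?R" using N by (intro poly_time_transfer) auto
  have "run (map_prog f (transfer (2, 0) (0, N) [(3, N), (4, N)])) m = return_pmf ?m1"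
    unfolding map_transfer using N m by (subst run_move) (auto simp: inj_eq[OF f])
  then have "run (map_prog f (distributor N P)) m = run (map_prog f (Seq ?R P)) ?m1"
    unfolding distributor_def prog.map(3)[of f "transfer (2, 0) (0, N) [(3, N), (4, N)]"]
    using N wf R P by (intro run_Seq_return tm poly_time_Seq poly_time_transfer) auto
  also have "run (map_prog f ?R) ?m1 = return_pmf ?m2"
    unfolding map_transfer using N m
    by (subst run_move) (auto simp: inj_eq[OF f] override_on_def)
  then have "run (map_prog f (Seq ?R P)) ?m1 = run (map_prog f P) ?m2"
    unfolding prog.map using wf R P by (intro run_Seq_return tm) auto
  also have "?m2 = upd {f (3, N), f (4, N), f (3, N + 1), f (4, N + 1)}
        (\<lambda>r. if r \<in> {f (3, N), f (4, N)} then cl m (f (2, 0)) else cl m (f (2, N)))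
      (erase {f (2, N)} (upd {f (2, 0)} (\<lambda>_. cl m (f (2, N))) m))"
    using N by (intro upd_eqI) (auto simp: override_on_def inj_eq[OF f])
  finally show ?thesis
    using P(2) by (simp only:) (intro run_upd, auto simp: inj_eq[OF f])
qed

text \<open>The ports \<open>N\<close> to \<open>N + 4\<close> are the input ports of the verifier
  and \<open>N + 5\<close> is its output port. The security parameter and the challenge are copied
  there because \<open>P\<close> needs them too; key and auxiliary string are moved, so that
  \<open>P\<close> does not find them.\<close>

lemma run_receiver:
  fixes f :: "nat \<times> nat \<Rightarrow> party \<times> nat \<times> nat"
  assumes f: "inj f" and N: "4 < N" and P: "poly_time P" "set_prog P \<subseteq> {..<N} \<times> {..<N}"
    and V: "PPT V" and wf: "wf_mem m"
    and u: "cl m (f (0, 0)) = u" and x: "cl m (f (1, 0)) = x"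
    and sk: "cl m (f (2, N)) = sk" and aux: "cl m (f (2, N + 1)) = aux"
    and m0: "cl m (f (0, N)) = []" and high: "\<And>p i. N \<le> p \<Longrightarrow> cl m (f (p, i)) = []"
  shows "map_pmf (erase (high f N)) (run (map_prog f (receiver N P V)) m) =
    do { m' \<leftarrow> run (map_prog f P) (erase {f (2, N), f (2, N + 1)} m);
         v \<leftarrow> map_pmf (\<lambda>v. v = [True]) (out 5 V [u, sk, aux, x, cl m' (f (3, 0))]);
         return_pmf (erase (high f N) (upd {f (3, 0)} (\<lambda>_. [\<not> v]) m')) }"
proof -
  have V': "poly_time V" "uses_only classical_instr classical_test V" using V by (auto simp: PPT_def)
  note tm = terminating_joint[OF _ f]
  let ?e = "\<lambda>(p, i). f (N + p, i)"
  let ?T1 = "transfer (0, 0) (0, N) [(0, 0), (N, 0)]"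
  let ?T2 = "transfer (1, 0) (0, N) [(1, 0), (N + 3, 0)]"
  let ?T3 = "transfer (2, N) (0, N) [(N + 1, 0)]"
  let ?T4 = "transfer (2, N + 1) (0, N) [(N + 2, 0)]"
  let ?T5 = "transfer (3, 0) (0, N) [(N + 4, 0)]"
  let ?D = "decide (N + 5, 0) (3, 0) :: alg"
  let ?Q3 = "Seq (shift N V) ?D"
  let ?Q2 = "Seq ?T5 ?Q3"
  let ?Q1 = "Seq P ?Q2"
  have T: "poly_time ?T1" "poly_time ?T2" "poly_time ?T3" "poly_time ?T4" "poly_time ?T5"
    using N by (intro poly_time_transfer; simp)+
  have Q3: "poly_time ?Q3" using V' by (intro poly_time_Seq poly_time_shift poly_time_decide)
  have Q2: "poly_time ?Q2" by (rule poly_time_Seq[OF T(5) Q3])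
  have Q1: "poly_time ?Q1" by (rule poly_time_Seq[OF P(1) Q2])
  note Q1_4 = poly_time_Seq[OF T(4) Q1]
  note Q1_3 = poly_time_Seq[OF T(3) Q1_4]
  note Q1_2 = poly_time_Seq[OF T(2) Q1_3]
  define m1 where "m1 = upd {f (N, 0)} (\<lambda>_. u) m"
  define m2 where "m2 = upd {f (N + 3, 0)} (\<lambda>_. x) m1"
  define m3 where "m3 = erase {f (2, N)} (upd {f (N + 1, 0)} (\<lambda>_. sk) m2)"
  define m4 where "m4 = erase {f (2, N + 1)} (upd {f (N + 2, 0)} (\<lambda>_. aux) m3)"
  note defs = m1_def m2_def m3_def m4_def
  note ev = inj_eq[OF f] override_on_def
  have wfs: "wf_mem m1" "wf_mem m2" "wf_mem m3" "wf_mem m4" using wf by (simp_all add: defs)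
  have "run (map_prog f ?T1) m = return_pmf m1"
    unfolding map_transfer using N by (simp add: run_copy m0 high u ev m1_def)
  then have "run (map_prog f (receiver N P V)) m =
      run (map_prog f (Seq ?T2 (Seq ?T3 (Seq ?T4 ?Q1)))) m1"
    unfolding receiver_def prog.map(3)[of f ?T1] using T Q1_2 wf
    by (intro run_Seq_return tm)
  also have "run (map_prog f ?T2) m1 = return_pmf m2"
    unfolding map_transfer using N by (simp add: run_copy m0 high x[simplified] ev m1_def m2_def)
  then have "run (map_prog f (Seq ?T2 (Seq ?T3 (Seq ?T4 ?Q1)))) m1 =
      run (map_prog f (Seq ?T3 (Seq ?T4 ?Q1))) m2"
    unfolding prog.map(3)[of f ?T2] using T Q1_3 wfs by (intro run_Seq_return tm)
  also have "run (map_prog f ?T3) m2 = return_pmf m3"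
    unfolding map_transfer using N
    by (subst run_move) (auto simp: m0 high sk ev m1_def m2_def m3_def)
  then have "run (map_prog f (Seq ?T3 (Seq ?T4 ?Q1))) m2 = run (map_prog f (Seq ?T4 ?Q1)) m3"
    unfolding prog.map(3)[of f ?T3] using T Q1_4 wfs by (intro run_Seq_return tm)
  also have "run (map_prog f ?T4) m3 = return_pmf m4"
    unfolding map_transfer using N
    by (subst run_move) (auto simp: m0 high aux[simplified] ev defs)
  then have "run (map_prog f (Seq ?T4 ?Q1)) m3 = run (map_prog f ?Q1) m4"
    unfolding prog.map(3)[of f ?T4] using T Q1 wfs by (intro run_Seq_return tm)
  also have "\<dots> = run (map_prog f P) m4 \<bind> run (map_prog f ?Q2)"
    unfolding prog.map(3)[of f P] using P Q2 wfs by (intro run_Seq_terminating tm)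
  finally have run: "run (map_prog f (receiver N P V)) m = \<dots>" .
  let ?S = "high f N"
  let ?m0 = "erase {f (2, N), f (2, N + 1)} m"
  have "m4 = upd ?S (cl m4) ?m0"
    using N by (intro upd_eqI) (auto simp: defs ev mem_high[OF f])
  moreover have "set_prog (map_prog f P) \<inter> ?S = {}"
    using P(2) by (auto simp: mem_high[OF f])
  ultimately have frame: "run (map_prog f P) m4 = map_pmf (upd ?S (cl m4)) (run (map_prog f P) ?m0)"
    using run_upd(1) by metis
  have m4: "cl m4 (f (N + p, i)) = (if i = 0 \<and> p < 4 then [u, sk, aux, x] ! p else [])" for p i
  proof -
    have "p = 0 \<or> p = 1 \<or> p = 2 \<or> p = 3 \<or> 4 \<le> p" by linarith
    then show ?thesis using N by (elim disjE) (auto simp: defs ev high)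
  qed
  have "map_pmf (erase ?S) (run (map_prog f ?Q2) (upd ?S (cl m4) m')) =
      do { v \<leftarrow> map_pmf (\<lambda>v. v = [True]) (out 5 V [u, sk, aux, x, cl m' (f (3, 0))]);
        return_pmf (erase ?S (upd {f (3, 0)} (\<lambda>_. [\<not> v]) m')) }"
    if m': "m' \<in> set_pmf (run (map_prog f P) ?m0)" for m'
  proof -
    have wf': "wf_mem m'" using wf by (intro wf_run_terminating[OF tm[OF P(1)] _ m']) simp
    have m'0: "cl m' (f (0, N)) = []"
      using wf P(2) N by (subst cl_run_outside[OF tm[OF P(1)] _ m']) (auto simp: m0 ev)
    let ?y = "cl m' (f (3, 0))"
    let ?ins = "[u, sk, aux, x, ?y]"
    let ?m5 = "upd ?S (cl m4) m'"
    let ?m6 = "erase {f (3, 0)} (upd {f (N + 4, 0)} (\<lambda>_. ?y) ?m5)"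
    have "run (map_prog f ?T5) ?m5 = return_pmf ?m6"
      unfolding map_transfer using N m4[of 4 0]
      by (subst run_move) (auto simp: m'0 ev mem_high[OF f])
    then have "run (map_prog f ?Q2) ?m5 = run (map_prog f ?Q3) ?m6"
      unfolding prog.map(3)[of f ?T5] using T Q3 wf' by (intro run_Seq_return tm) auto
    also have "\<dots> = run (map_prog f (shift N V)) ?m6 \<bind> run (map_prog f ?D)"
      unfolding prog.map(3)[of f "shift N V"] using V' wf'
      by (intro run_Seq_terminating tm poly_time_shift poly_time_decide) auto
    also have "run (map_prog f (shift N V)) ?m6 = map_pmf (embed ?e ?m6) (run V (load ?ins))"
    proof (rule run_shift[OF f V'(2)])
      fix p i :: nat
      \<comment> \<open>Port 4 takes the answer of \<open>P\<close>; the other four inputs were in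
        place before.\<close>
      have "p < 5 \<longleftrightarrow> p < 4 \<or> p = 4" by auto
      moreover have "p < 4 \<Longrightarrow> ?ins ! p = [u, sk, aux, x] ! p"
        using nth_append[of "[u, sk, aux, x]" "[?y]" p] by simp
      ultimately show "cl ?m6 (f (N + p, i)) = (if i = 0 \<and> p < length ?ins then ?ins ! p else [])"
        using N m4[of p i] by (auto simp: ev mem_high[OF f])
    qed
    finally have run5: "run (map_prog f ?Q2) ?m5 =
        run V (load ?ins) \<bind> (\<lambda>n. run (map_prog f ?D) (embed ?e ?m6 n))"
      by (simp add: bind_map_pmf)
    have "map_pmf (erase ?S) (run (map_prog f ?D) (embed ?e ?m6 n)) =
        return_pmf (erase ?S (upd {f (3, 0)} (\<lambda>_. [cl n (5, 0) \<noteq> [True]]) m'))" for n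
    proof -
      have "cl (embed ?e ?m6 n) (f (3, 0)) = []" "f (N + 5, 0) \<noteq> f (3, 0)"
        using N by (simp_all add: cl_embed_shift[OF f] ev)
      then obtain s where "run (decide (f (N + 5, 0)) (f (3, 0))) (embed ?e ?m6 n) =
          return_pmf (upd {f (N + 5, 0)} (\<lambda>_. s) (upd {f (3, 0)}
            (\<lambda>_. [cl (embed ?e ?m6 n) (f (N + 5, 0)) \<noteq> [True]]) (embed ?e ?m6 n)))"
        by (rule run_decide)
      moreover have "erase ?S (upd {f (N + 5, 0)} (\<lambda>_. s) (upd {f (3, 0)} (\<lambda>_. t) (embed ?e ?m6 n))) =
          erase ?S (upd {f (3, 0)} (\<lambda>_. t) m')" for t
      proof (rule upd_eqI)
        fix r
        have "cl (embed ?e ?m6 n) r = cl m' r" if "r \<notin> ?S" "r \<noteq> f (3, 0)"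
          using that by (subst cl_embed_shift(3)[OF f]) (auto simp: override_on_def mem_high[OF f])
        moreover have "f (N + 5, 0) \<in> ?S" by (simp add: mem_high[OF f])
        ultimately show "cl (erase ?S (upd {f (N + 5, 0)} (\<lambda>_. s) (upd {f (3, 0)} (\<lambda>_. t) (embed ?e ?m6 n)))) r =
            cl (erase ?S (upd {f (3, 0)} (\<lambda>_. t) m')) r"
          by (auto simp: override_on_def)
      qed simp_all
      ultimately show ?thesis unfolding map_decide by (simp add: cl_embed_shift(1)[OF f])
    qed
    then show ?thesis
      unfolding run5 map_bind_pmf by (simp add: out_def pmf.map_comp map_pmf_def bind_assoc_pmf bind_return_pmf)
  qed
  then show ?thesis
    unfolding run frame by (auto simp: map_bind_pmf bind_map_pmf intro!: bind_pmf_cong)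
qed

section \<open>Wirings of algorithms into the joint memory\<close>

definition reg :: "(nat \<Rightarrow> port) \<Rightarrow> nat \<times> nat \<Rightarrow> party \<times> nat \<times> nat" where
  "reg w = (\<lambda>(p, i). (fst (w p), snd (w p), i))"

lemma reg_apply [simp]: "reg w (p, i) = (fst (w p), snd (w p), i)"
  by (simp add: reg_def)

lemma run_wired_eq: "run_wired w P m = run (map_prog (reg w) P) m"
  by (simp add: run_wired_def reg_def)

lemma inj_reg: "inj w \<Longrightarrow> inj (reg w)"
  by (auto simp: inj_on_def reg_def prod_eq_iff)

lemma inj_Pair_upd: "a \<noteq> b \<Longrightarrow> inj ((Pair a)(p := (b, q)))"
  by (auto simp: inj_on_def)

lemma set_wired: "set_prog (map_prog (reg w) P) \<subseteq> {(a, p, i). (a, p) \<in> range w}"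
  by (auto simp: reg_def)

lemma deliver_sel [simp]:
  "cl (deliver r s m) = (cl m)((fst r, snd r, 0) := s)" "ql (deliver r s m) = ql m"
  "amp (deliver r s m) = amp m"
  by (simp_all add: deliver_def)

lemma wf_deliver [simp]: "wf_mem (deliver r s m) \<longleftrightarrow> wf_mem m"
  by (simp add: wf_mem_def)

lemma wf_empty_mem [simp]: "wf_mem empty_mem"
  by (auto simp: wf_mem_def empty_mem_def)

lemma empty_mem_sel [simp]: "cl empty_mem r = []" "ql empty_mem r = 0"
  by (simp_all add: empty_mem_def)

lemma terminating_wired:
  "poly_time P \<Longrightarrow> inj w \<Longrightarrow> terminating (map_prog (reg w) P)"
  by (intro terminating_joint inj_reg)

lemma run_wired_upd:
  assumes "X \<inter> {(a, p, i). (a, p) \<in> range w} = {}"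
  shows "run_wired w P (upd X s m) = map_pmf (upd X s) (run_wired w P m)"
  unfolding run_wired_eq using set_wired[of w P] assms by (intro run_upd(1)) blast

lemma wf_run_wired:
  assumes "poly_time P" "inj w" "wf_mem m" "m' \<in> set_pmf (run_wired w P m)" shows "wf_mem m'"
  using wf_run_terminating[OF terminating_wired[OF assms(1,2)] assms(3)] assms(4)
  by (simp add: run_wired_eq)

lemma cl_run_wired:
  assumes "poly_time P" "inj w" "wf_mem m" "m' \<in> set_pmf (run_wired w P m)" "(a, p) \<notin> range w"
  shows "cl m' (a, p, i) = cl m (a, p, i)"
  using cl_run_outside[OF terminating_wired[OF assms(1,2)] assms(3), of m' "(a, p, i)"]
    set_wired[of w P] assms(4,5) by (auto simp: run_wired_eq)

lemma inj_wires:
  "inj (Pair a :: nat \<Rightarrow> party \<times> nat)" "inj wire_Alice"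
  "inj ((Pair Bob)(2 := (Alice, k)))" "inj ((Pair Charlie)(2 := (Alice, k)))"
  by (simp_all add: inj_Pair_upd inj_on_def)

lemma range_fun_upd_Pair: "(a, p) \<in> range ((Pair b)(q := y)) \<longleftrightarrow> (a = b \<and> p \<noteq> q) \<or> (a, p) = y"
  by (auto simp: image_iff)

lemma range_Pair: "(a, p) \<in> range (Pair b) \<longleftrightarrow> a = b"
  by auto

lemmas range_wires = range_fun_upd_Pair range_Pair

lemma wf_obfuscate:
  assumes "poly_time (obf U)" "wf_mem m" "m' \<in> set_pmf (obfuscate U \<eta> c m)" shows "wf_mem m'"
  using assms wf_run_wired[OF assms(1) inj_wires(1)] unfolding obfuscate_def by (metis wf_deliver)

lemma cl_obfuscate:
  assumes "poly_time (obf U)" "wf_mem m" "m' \<in> set_pmf (obfuscate U \<eta> c m)" "a \<noteq> Obfuscator"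
  shows "cl m' (a, p, i) = cl m (a, p, i)"
  using cl_run_wired[OF assms(1) inj_wires(1) _ assms(3)[unfolded obfuscate_def], of a p i] assms
  by (auto simp: range_wires)

lemma obfuscate_upd:
  assumes "\<And>p i. (Obfuscator, p, i) \<notin> X"
  shows "obfuscate U \<eta> c (upd X s m) = map_pmf (upd X s) (obfuscate U \<eta> c m)"
proof -
  have "deliver (Obfuscator, 0) (unary \<eta>) (deliver (Obfuscator, 1) c (upd X s m)) =
      upd X s (deliver (Obfuscator, 0) (unary \<eta>) (deliver (Obfuscator, 1) c m))"
    using assms by (intro upd_eqI) (auto simp: override_on_def)
  then show ?thesis unfolding obfuscate_def
    using assms by (simp only:) (intro run_wired_upd, auto)
qed

lemma rev_unary: "rev (unary \<eta>) = unary \<eta>"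
  by (simp add: unary_def)

section \<open>Attacking the punctured circuit\<close>

text \<open>\<open>D\<close> must be a single algorithm on registers numbered by pairs, while the
  simulation runs the programs of three parties. A bijection carries the joint program over; it is
  prescribed on the interface of \<open>D\<close> and arbitrary elsewhere.\<close>

lemma puncturing_adversary:
  assumes X: "X = Bob \<or> X = Charlie"
    and poly: "poly_time (obf U)" "poly_time A" "poly_time B"
  obtains D where "QPT D"
    "\<And>\<eta> x aux c. out 4 D [unary \<eta>, x, aux, c] = do {
       m \<leftarrow> obfuscate U \<eta> c empty_mem;
       m \<leftarrow> run_wired wire_Alice A (deliver (Alice, 0) (unary \<eta>) (deliver (Alice, 2) aux m));
       m \<leftarrow> run_wired ((Pair X)(2 := (Alice, k))) B
         (deliver (X, 0) (unary \<eta>) (deliver (X, 1) x m));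
       return_pmf (received (X, 3) m) }"
proof -
  have X': "X \<noteq> Alice" "X \<noteq> Obfuscator" "X \<noteq> Evaluator" using X by auto
  let ?wO = "Pair Obfuscator :: nat \<Rightarrow> port" and ?wB = "(Pair X)(2 := (Alice, k))"
  let ?O = "map_prog (reg ?wO) (obf U)" and ?A = "map_prog (reg wire_Alice) A"
  let ?B = "map_prog (reg ?wB) B"
  have inj: "inj ?wO" "inj wire_Alice" "inj ?wB" using X' by (simp_all add: inj_wires inj_Pair_upd)
  note terminating = poly[THEN terminating_wired]
  have T: "terminating ?O" "terminating ?A" "terminating ?B" using terminating inj by auto
  \<comment> \<open>The security parameter arrives once, but three programs need it. No program of
    the simulation uses a port of the Evaluator, so it can serve as the source.\<close>
  let ?src = "(Evaluator, 0 :: nat, 0 :: nat)"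
  let ?ws = "[(Obfuscator, 0, 0), (Alice, 0, 0), (X, 0, 0)]"
  let ?F = "fan ?src ?ws"
  let ?J = "Seq ?F (Seq ?O (Seq ?A ?B))"
  let ?R = "{?src, (X, 1, 0), (Alice, 2, 0), (Obfuscator, 1, 0), (X, 3, 0)}"
  \<comment> \<open>Ports 0 to 3 carry the arguments of \<open>D\<close> and port 4 its output, as
    in \<open>punct_expt\<close>. The default \<open>(0, 0)\<close> is the image of
    \<open>?src\<close>.\<close>
  let ?g0 = "(\<lambda>_. (0, 0))((X, 1, 0) := (1, 0), (Alice, 2, 0) := (2, 0), (Obfuscator, 1, 0) := (3, 0),
     (X, 3, 0) := (4, 0)) :: party \<times> nat \<times> nat \<Rightarrow> nat \<times> nat"
  have "inj_on ?g0 ?R" using X' by (auto simp: inj_on_def)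
  then obtain g where g: "bij g" "\<And>r. r \<in> ?R \<Longrightarrow> g r = ?g0 r"
    using bij_extension[of ?R ?g0] countable_joint infinite_joint infinite_nat_pairs by auto
  have gR: "g ?src = (0, 0)" "g (X, 1, 0) = (1, 0)" "g (Alice, 2, 0) = (2, 0)"
    "g (Obfuscator, 1, 0) = (3, 0)" "g (X, 3, 0) = (4, 0)"
    using X' by (simp_all add: g(2))
  have F: "distinct ?ws" "?src \<notin> set ?ws" using X' by auto
  have TF: "terminating ?F" unfolding terminating_def halts_def using run_fan[OF F] by blast
  show ?thesis
  proof (rule that)
    have map: "map_prog g (map_prog (reg w) P) = map_prog (g \<circ> reg w) P" for w P
      by (simp add: prog.map_comp)
    have "inj_on (g \<circ> reg w) M" if "inj w" for w M
      using inj_compose[OF bij_is_inj[OF g(1)] inj_reg[OF that]] by (rule inj_on_subset) simp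
    then have "poly_time (map_prog g ?O)" "poly_time (map_prog g ?A)" "poly_time (map_prog g ?B)"
      unfolding map using poly inj by (auto intro: poly_time_map_prog)
    moreover have "poly_time (map_prog g ?F)"
      unfolding map_fan using F bij_is_inj[OF g(1)]
      by (intro poly_time_fan) (auto simp: inj_eq[OF bij_is_inj[OF g(1)]])
    ultimately show "QPT (map_prog g ?J)"
      unfolding QPT_def prog.map by (intro poly_time_Seq)
  next
    fix \<eta> x aux c
    let ?u = "unary \<eta>" and ?ins = "[unary \<eta>, x, aux, c]"
    let ?m0 = "upd {?src, (X, 1, 0), (Alice, 2, 0), (Obfuscator, 1, 0)}
      (\<lambda>r. if r = ?src then ?u else if r = (X, 1, 0) then x else if r = (Alice, 2, 0) then aux else c)
      empty_mem"
    have load: "load ?ins = rename g ?m0"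
    proof (rule mem_eqI)
      have "cl (load ?ins) (g r) = cl ?m0 r" for r
      proof (cases "r \<in> {?src, (X, 1, 0), (Alice, 2, 0), (Obfuscator, 1, 0)}")
        case True
        then show ?thesis using X' gR by (auto simp: load_def)
      next
        case False
        then have "g r \<noteq> (0, 0)" "g r \<noteq> (1, 0)" "g r \<noteq> (2, 0)" "g r \<noteq> (3, 0)"
          using inj_eq[OF bij_is_inj[OF g(1)]] gR by (metis insertCI)+
        moreover have "p < 4 \<Longrightarrow> p = 0 \<or> p = 1 \<or> p = 2 \<or> p = 3" for p :: nat by auto
        ultimately have "cl (load ?ins) (g r) = []" by (auto simp: load_def split: prod.splits)
        with False show ?thesis by simp
      qed
      from this[of "inv g q" for q] show "cl (load ?ins) = cl (rename g ?m0)"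
        by (auto simp: fun_eq_iff bij_is_surj[OF g(1)] surj_f_inv_f)
      have "c \<circ> map_prod g id = (\<lambda>_. False) \<longleftrightarrow> c = (\<lambda>_. False)" for c :: "(nat \<times> nat) config"
        using inj_eq[OF bij_is_inj[OF bij_reindex_config[OF g(1)]], of c "\<lambda>_. False"]
        by (simp add: comp_def)
      then show "amp (load ?ins) = amp (rename g ?m0)" by (simp add: load_def empty_mem_def)
    qed (auto simp: load_def fun_eq_iff)
    have inv: "inv g (4, 0) = (X, 3, 0)" using inv_f_f[OF bij_is_inj[OF g(1)], of "(X, 3, 0)"] gR by simp
    have "received (X, 3) = (\<lambda>m. cl m (X, 3, 0))" by (simp add: received_def fun_eq_iff)
    then have "out 4 (map_prog g ?J) ?ins = map_pmf (received (X, 3)) (run ?J ?m0)"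
      unfolding out_def load run_rename(2)[OF g(1)]
      by (simp add: pmf.map_comp o_def inv)
    also have "run ?J ?m0 = run ?F ?m0 \<bind> run (Seq ?O (Seq ?A ?B))"
      using T TF by (intro run_Seq_terminating terminating_Seq) auto
    also have "\<dots> = run (Seq ?O (Seq ?A ?B)) (upd {(Alice, 0, 0), (Alice, 2, 0), (X, 0, 0), (X, 1, 0)}
        (\<lambda>r. if r = (Alice, 2, 0) then aux else if r = (X, 1, 0) then x else ?u)
        (deliver (Obfuscator, 0) ?u (deliver (Obfuscator, 1) c empty_mem)))"
    proof -
      \<comment> \<open>A single \<open>fan\<close> is enough, since a unary string equals its
        reversal.\<close>
      let ?m1 = "upd (insert ?src (set ?ws)) (\<lambda>r. if r = ?src then [] else rev (cl ?m0 ?src) @ cl ?m0 r) ?m0"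
      have "run ?F ?m0 = return_pmf ?m1" using run_fan[OF F, of ?m0] by blast
      moreover have "?m1 = upd {(Alice, 0, 0), (Alice, 2, 0), (X, 0, 0), (X, 1, 0)}
        (\<lambda>r. if r = (Alice, 2, 0) then aux else if r = (X, 1, 0) then x else ?u)
        (deliver (Obfuscator, 0) ?u (deliver (Obfuscator, 1) c empty_mem))"
        using X' by (intro upd_eqI) (auto simp: override_on_def rev_unary)
      ultimately show ?thesis by (simp only: bind_return_pmf)
    qed
    also have "\<dots> = run ?O (upd {(Alice, 0, 0), (Alice, 2, 0), (X, 0, 0), (X, 1, 0)}
        (\<lambda>r. if r = (Alice, 2, 0) then aux else if r = (X, 1, 0) then x else ?u)
        (deliver (Obfuscator, 0) ?u (deliver (Obfuscator, 1) c empty_mem))) \<bind> run (Seq ?A ?B)"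
      using T by (intro run_Seq_terminating terminating_Seq) auto
    \<comment> \<open>The inputs of Alice and \<open>X\<close> are already present. They lie outside
      the registers of the earlier programs, so they can be treated as delivered just before their
      use, as in the experiment.\<close>
    also have "run ?O (upd {(Alice, 0, 0), (Alice, 2, 0), (X, 0, 0), (X, 1, 0)}
        (\<lambda>r. if r = (Alice, 2, 0) then aux else if r = (X, 1, 0) then x else ?u)
        (deliver (Obfuscator, 0) ?u (deliver (Obfuscator, 1) c empty_mem))) =
      map_pmf (upd {(Alice, 0, 0), (Alice, 2, 0), (X, 0, 0), (X, 1, 0)}
        (\<lambda>r. if r = (Alice, 2, 0) then aux else if r = (X, 1, 0) then x else ?u))
        (obfuscate U \<eta> c empty_mem)"
      unfolding obfuscate_def run_wired_eq[symmetric]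
      by (rule run_wired_upd) (use X' in \<open>auto simp: range_wires\<close>)
    also have "\<dots> \<bind> run (Seq ?A ?B) = obfuscate U \<eta> c empty_mem \<bind> (\<lambda>m. run (Seq ?A ?B)
        (upd {(Alice, 0, 0), (Alice, 2, 0), (X, 0, 0), (X, 1, 0)}
          (\<lambda>r. if r = (Alice, 2, 0) then aux else if r = (X, 1, 0) then x else ?u) m))"
      by (simp only: bind_map_pmf)
    also have "\<dots> = do {
       m \<leftarrow> obfuscate U \<eta> c empty_mem;
       m \<leftarrow> run_wired wire_Alice A (deliver (Alice, 0) ?u (deliver (Alice, 2) aux m));
       run_wired ?wB B (deliver (X, 0) ?u (deliver (X, 1) x m)) }"
    proof (intro bind_pmf_cong refl)
      fix m assume "m \<in> set_pmf (obfuscate U \<eta> c empty_mem)"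
      then have wf: "wf_mem m" by (rule wf_obfuscate[OF poly(1) wf_empty_mem])
      let ?dA = "deliver (Alice, 0) ?u (deliver (Alice, 2) aux m)"
      let ?s = "\<lambda>r. if r = (X, 1, 0) then x else ?u"
      have "upd {(Alice, 0, 0), (Alice, 2, 0), (X, 0, 0), (X, 1, 0)}
          (\<lambda>r. if r = (Alice, 2, 0) then aux else if r = (X, 1, 0) then x else ?u) m =
          upd {(X, 0, 0), (X, 1, 0)} ?s ?dA"
        using X' by (intro upd_eqI) (auto simp: override_on_def)
      moreover have "run (Seq ?A ?B) (upd {(X, 0, 0), (X, 1, 0)} ?s ?dA) =
          run_wired wire_Alice A (upd {(X, 0, 0), (X, 1, 0)} ?s ?dA) \<bind> run_wired ?wB B"
        unfolding run_wired_eq using T wf by (intro run_Seq_terminating) auto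
      moreover have "run_wired wire_Alice A (upd {(X, 0, 0), (X, 1, 0)} ?s ?dA) =
          map_pmf (upd {(X, 0, 0), (X, 1, 0)} ?s) (run_wired wire_Alice A ?dA)"
        by (rule run_wired_upd) (use X' in \<open>auto simp: range_wires\<close>)
      moreover have "upd {(X, 0, 0), (X, 1, 0)} ?s m = deliver (X, 0) ?u (deliver (X, 1) x m)" for m
        by (intro upd_eqI) (auto simp: override_on_def)
      ultimately show "run (Seq ?A ?B) (upd {(Alice, 0, 0), (Alice, 2, 0), (X, 0, 0), (X, 1, 0)}
          (\<lambda>r. if r = (Alice, 2, 0) then aux else if r = (X, 1, 0) then x else ?u) m) =
          run_wired wire_Alice A ?dA \<bind>
          (\<lambda>m. run_wired ?wB B (deliver (X, 0) ?u (deliver (X, 1) x m)))"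
        by (simp only: bind_map_pmf)
    qed
    finally show "out 4 (map_prog g ?J) ?ins = do {
       m \<leftarrow> obfuscate U \<eta> c empty_mem;
       m \<leftarrow> run_wired wire_Alice A (deliver (Alice, 0) ?u (deliver (Alice, 2) aux m));
       m \<leftarrow> run_wired ?wB B (deliver (X, 0) ?u (deliver (X, 1) x m));
       return_pmf (received (X, 3) m) }"
      by (simp only: map_pmf_def bind_assoc_pmf)
  qed
qed

section \<open>Attacking the obfuscation\<close>

lemma run_wired_receiver:
  assumes X: "X = Bob \<or> X = Charlie" and k: "2 < k" and N: "4 < N"
    and P: "poly_time P" "set_prog P \<subseteq> {..<N} \<times> {..<N}" and V: "PPT (verify S)" and wf: "wf_mem m"
    and m: "\<And>p i. cl m (X, p, i) = []" "cl m (Alice, k, N) = sk" "cl m (Alice, k, N + 1) = aux"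
  shows "map_pmf (erase ({X} \<times> {N..} \<times> UNIV))
      (run_wired ((Pair X)(2 := (Alice, k))) (receiver N P (verify S))
        (deliver (X, 0) (unary \<eta>) (deliver (X, 1) x m))) =
    do { m' \<leftarrow> run_wired ((Pair X)(2 := (Alice, k))) P (deliver (X, 0) (unary \<eta>) (deliver (X, 1) x
           (erase {(Alice, k, N), (Alice, k, N + 1)} m)));
         v \<leftarrow> accepts S \<eta> sk aux x (received (X, 3) m');
         return_pmf (erase ({X} \<times> {N..} \<times> UNIV) (upd {(X, 3, 0)} (\<lambda>_. [\<not> v]) m')) }"
proof -
  let ?f = "reg ((Pair X)(2 := (Alice, k)))"
  let ?m = "deliver (X, 0) (unary \<eta>) (deliver (X, 1) x m)"
  have X': "X \<noteq> Alice" using X by auto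
  have f: "inj ?f" using X' by (intro inj_reg inj_Pair_upd)
  have high: "high ?f N = {X} \<times> {N..} \<times> UNIV"
    using N by (force simp: high_def image_iff)
  have comm: "deliver (X, 0) (unary \<eta>) (deliver (X, 1) x (erase {(Alice, k, N), (Alice, k, N + 1)} m)) =
      erase {(Alice, k, N), (Alice, k, N + 1)} ?m"
    using X' by (intro upd_eqI) (auto simp: override_on_def)
  have "map_pmf (erase (high ?f N)) (run (map_prog ?f (receiver N P (verify S))) ?m) =
    do { m' \<leftarrow> run (map_prog ?f P) (erase {?f (2, N), ?f (2, N + 1)} ?m);
         v \<leftarrow> map_pmf (\<lambda>v. v = [True]) (out 5 (verify S) [unary \<eta>, sk, aux, x, cl m' (?f (3, 0))]);
         return_pmf (erase (high ?f N) (upd {?f (3, 0)} (\<lambda>_. [\<not> v]) m')) }"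
    using X' N m wf by (intro run_receiver[OF f N P V]) auto
  then show ?thesis unfolding high comm accepts_def received_def run_wired_eq by simp
qed

text \<open>The receivers are unfolded one at a time: Charlie's strings are a frame for Bob's
  program, and then Bob's verdict is a frame for Charlie's. Finally both verifications are moved
  behind both programs.\<close>

lemma run_Bob_Charlie_receiver:
  assumes N: "4 < N"
    and B: "poly_time B" "set_prog B \<subseteq> {..<N} \<times> {..<N}"
    and C: "poly_time C" "set_prog C \<subseteq> {..<N} \<times> {..<N}"
    and V: "PPT (verify S)" and wf: "wf_mem m"
    and m: "\<And>p i. cl m (Bob, p, i) = []" "\<And>p i. cl m (Charlie, p, i) = []"
      "\<And>k i. N \<le> i \<Longrightarrow> cl m (Alice, k, i) = []"
  shows "run_Bob_Charlie (receiver N B (verify S)) (receiver N C (verify S)) \<eta> xB xC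
      (upd {(Alice, 3, N), (Alice, 4, N), (Alice, 3, N + 1), (Alice, 4, N + 1)}
        (\<lambda>r. if r \<in> {(Alice, 3, N), (Alice, 4, N)} then sk else aux) m) =
    do { (yB, yC) \<leftarrow> run_Bob_Charlie B C \<eta> xB xC m;
         vB \<leftarrow> accepts S \<eta> sk aux xB yB;
         vC \<leftarrow> accepts S \<eta> sk aux xC yC;
         return_pmf ([\<not> vB], [\<not> vC]) }"
proof -
  let ?wB = "(Pair Bob)(2 := (Alice, 3))" and ?wC = "(Pair Charlie)(2 := (Alice, 4))"
  let ?RB = "run_wired ?wB (receiver N B (verify S))" and ?RC = "run_wired ?wC (receiver N C (verify S))"
  let ?Z = "{(Alice, 3, N), (Alice, 4, N), (Alice, 3, N + 1), (Alice, 4, N + 1)}"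
  let ?ZC = "{(Alice, 4, N), (Alice, 4, N + 1)}"
  let ?q = "\<lambda>r. if r \<in> {(Alice, 3, N), (Alice, 4, N)} then sk else aux"
  let ?dB = "\<lambda>m. deliver (Bob, 0) (unary \<eta>) (deliver (Bob, 1) xB m)"
  let ?dC = "\<lambda>m. deliver (Charlie, 0) (unary \<eta>) (deliver (Charlie, 1) xC m)"
  let ?YB = "{Bob} \<times> {N..} \<times> (UNIV :: nat set)" and ?YC = "{Charlie} \<times> {N..} \<times> (UNIV :: nat set)"
  let ?res = "\<lambda>m. return_pmf (received (Bob, 3) m, received (Charlie, 3) m)"
  let ?K = "\<lambda>m. map_pmf (erase ?YC) (?RC (?dC m)) \<bind> ?res"
  have K: "?RC (?dC m) \<bind> ?res = ?K (erase ?YB m)" for m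
  proof -
    have "?dC (erase ?YB m) = erase ?YB (?dC m)"
      by (intro upd_eqI) (auto simp: override_on_def)
    moreover have "?RC (erase ?YB (?dC m)) = map_pmf (erase ?YB) (?RC (?dC m))"
      by (rule run_wired_upd) (auto simp: range_wires)
    moreover have "?res (erase ?YC (erase ?YB m)) = ?res m" for m
      using N by (simp add: received_def)
    ultimately show ?thesis by (simp add: bind_map_pmf)
  qed
  have rec: "received (Bob, 3) (upd ?ZC s m) = received (Bob, 3) m" for s m
    by (simp add: received_def)
  have "run_Bob_Charlie (receiver N B (verify S)) (receiver N C (verify S)) \<eta> xB xC (upd ?Z ?q m) =
      ?RB (?dB (upd ?Z ?q m)) \<bind> (\<lambda>m. ?RC (?dC m) \<bind> ?res)"
    by (simp add: run_Bob_Charlie_def)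
  also have "\<dots> = map_pmf (erase ?YB) (?RB (?dB (upd ?Z ?q m))) \<bind> ?K"
    unfolding K by (simp add: bind_map_pmf)
  also have "map_pmf (erase ?YB) (?RB (?dB (upd ?Z ?q m))) =
    do { m' \<leftarrow> run_wired ?wB B (?dB (erase {(Alice, 3, N), (Alice, 3, N + 1)} (upd ?Z ?q m)));
         v \<leftarrow> accepts S \<eta> sk aux xB (received (Bob, 3) m');
         return_pmf (erase ?YB (upd {(Bob, 3, 0)} (\<lambda>_. [\<not> v]) m')) }"
    using N B V wf m by (intro run_wired_receiver) (auto simp: override_on_def)
  \<comment> \<open>Bob's receiver has consumed his copies. Those of Charlie remain, as writes that
    commute with \<open>B\<close>.\<close>
  also have "?dB (erase {(Alice, 3, N), (Alice, 3, N + 1)} (upd ?Z ?q m)) = upd ?ZC ?q (?dB m)"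
    using m by (intro upd_eqI) (auto simp: override_on_def)
  also have "run_wired ?wB B (upd ?ZC ?q (?dB m)) = map_pmf (upd ?ZC ?q) (run_wired ?wB B (?dB m))"
    by (rule run_wired_upd) (auto simp: range_wires)
  finally have "run_Bob_Charlie (receiver N B (verify S)) (receiver N C (verify S)) \<eta> xB xC (upd ?Z ?q m) =
    do { m' \<leftarrow> run_wired ?wB B (?dB m);
         v \<leftarrow> accepts S \<eta> sk aux xB (received (Bob, 3) m');
         ?K (erase ?YB (upd {(Bob, 3, 0)} (\<lambda>_. [\<not> v]) (upd ?ZC ?q m'))) }"
    by (simp only: bind_map_pmf bind_assoc_pmf bind_return_pmf rec)
  also have "\<dots> = do { m' \<leftarrow> run_wired ?wB B (?dB m);
         vB \<leftarrow> accepts S \<eta> sk aux xB (received (Bob, 3) m');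
         m'' \<leftarrow> run_wired ?wC C (?dC m');
         vC \<leftarrow> accepts S \<eta> sk aux xC (received (Charlie, 3) m'');
         return_pmf ([\<not> vB], [\<not> vC]) }"
  proof (intro bind_pmf_cong[OF refl])
    fix m' v assume m': "m' \<in> set_pmf (run_wired ?wB B (?dB m))"
    have wf': "wf_mem m'" using wf_run_wired[OF B(1) inj_wires(3) _ m'] wf by simp
    have out: "cl m' (a, p, i) = cl (?dB m) (a, p, i)" if "(a, p) \<notin> range ?wB" for a p i
      using cl_run_wired[OF B(1) inj_wires(3) _ m' that] wf by simp
    have Charlie: "cl m' (Charlie, p, i) = []" for p i using m by (subst out) (auto simp: range_wires)
    have Alice: "cl m' (Alice, 4, i) = []" if "N \<le> i" for i
      using m that by (subst out) (auto simp: range_wires)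
    let ?m = "erase ?YB (upd {(Bob, 3, 0)} (\<lambda>_. [\<not> v]) (upd ?ZC ?q m'))"
    let ?XB = "insert (Bob, 3, 0) ?YB" and ?s = "\<lambda>r. if r = (Bob, 3, 0) then [\<not> v] else []"
    have "map_pmf (erase ?YC) (?RC (?dC ?m)) =
      do { m'' \<leftarrow> run_wired ?wC C (?dC (erase ?ZC ?m));
           vC \<leftarrow> accepts S \<eta> sk aux xC (received (Charlie, 3) m'');
           return_pmf (erase ?YC (upd {(Charlie, 3, 0)} (\<lambda>_. [\<not> vC]) m'')) }"
      using N C V wf' Charlie by (intro run_wired_receiver) (auto simp: override_on_def)
    also have "?dC (erase ?ZC ?m) = upd ?XB ?s (?dC m')"
      using Alice N by (intro upd_eqI) (auto simp: override_on_def)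
    also have "run_wired ?wC C (upd ?XB ?s (?dC m')) = map_pmf (upd ?XB ?s) (run_wired ?wC C (?dC m'))"
      by (rule run_wired_upd) (auto simp: range_wires)
    finally have "map_pmf (erase ?YC) (?RC (?dC ?m)) =
      do { m'' \<leftarrow> map_pmf (upd ?XB ?s) (run_wired ?wC C (?dC m'));
           vC \<leftarrow> accepts S \<eta> sk aux xC (received (Charlie, 3) m'');
           return_pmf (erase ?YC (upd {(Charlie, 3, 0)} (\<lambda>_. [\<not> vC]) m'')) }" .
    moreover have recs: "received (Bob, 3) (erase ?YC (upd {(Charlie, 3, 0)} t (upd ?XB ?s m))) = [\<not> v]"
      "received (Charlie, 3) (erase ?YC (upd {(Charlie, 3, 0)} t (upd ?XB ?s m))) = t (Charlie, 3, 0)"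
      "received (Charlie, 3) (upd ?XB ?s m) = received (Charlie, 3) m" for t m
      using N by (simp_all add: received_def)
    ultimately show "?K ?m = do { m'' \<leftarrow> run_wired ?wC C (?dC m');
         vC \<leftarrow> accepts S \<eta> sk aux xC (received (Charlie, 3) m'');
         return_pmf ([\<not> v], [\<not> vC]) }"
      by (simp only: bind_map_pmf bind_assoc_pmf bind_return_pmf recs)
  qed
  \<comment> \<open>Bob's verdict needs only his answer and fresh coins, so it can wait until
    Charlie has run.\<close>
  also have "\<dots> = do { m' \<leftarrow> run_wired ?wB B (?dB m);
         m'' \<leftarrow> run_wired ?wC C (?dC m');
         vB \<leftarrow> accepts S \<eta> sk aux xB (received (Bob, 3) m');
         vC \<leftarrow> accepts S \<eta> sk aux xC (received (Charlie, 3) m'');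
         return_pmf ([\<not> vB], [\<not> vC]) }"
    by (subst (2) bind_commute_pmf) rule
  also have "\<dots> = do { m' \<leftarrow> run_wired ?wB B (?dB m);
         m'' \<leftarrow> run_wired ?wC C (?dC m');
         vB \<leftarrow> accepts S \<eta> sk aux xB (received (Bob, 3) m'');
         vC \<leftarrow> accepts S \<eta> sk aux xC (received (Charlie, 3) m'');
         return_pmf ([\<not> vB], [\<not> vC]) }"
  \<comment> \<open>The answer is now read from the final memory, where Charlie has left it
    alone.\<close>
  proof (intro bind_pmf_cong refl)
    fix m' m'' assume m': "m' \<in> set_pmf (run_wired ?wB B (?dB m))"
      and m'': "m'' \<in> set_pmf (run_wired ?wC C (?dC m'))"
    have "wf_mem m'" using wf_run_wired[OF B(1) inj_wires(3) _ m'] wf by simp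
    then have "cl m'' (Bob, 3, 0) = cl m' (Bob, 3, 0)"
      using cl_run_wired[OF C(1) inj_wires(4) _ m'', of Bob 3 0] by (auto simp: range_wires)
    then show "accepts S \<eta> sk aux xB (received (Bob, 3) m') = accepts S \<eta> sk aux xB (received (Bob, 3) m'')"
      by (simp add: received_def)
  qed
  finally show ?thesis by (simp add: run_Bob_Charlie_def bind_assoc_pmf bind_return_pmf)
qed

text \<open>The strings left by the first stage are out of reach of the obfuscator, so its run
  starts in effect from the empty memory, as in the pirate's experiment. After that the distributor
  and the receivers are replaced in turn.\<close>

lemma run_distributor_receivers:
  assumes N: "4 < N" and U: "poly_time (obf U)"
    and A: "poly_time A" "set_prog A \<subseteq> {..<N} \<times> {..<N}"
    and B: "poly_time B" "set_prog B \<subseteq> {..<N} \<times> {..<N}"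
    and C: "poly_time C" "set_prog C \<subseteq> {..<N} \<times> {..<N}"
    and V: "PPT (verify S)"
  shows "do { m \<leftarrow> obfuscate U \<eta> c (upd {(Alice, 2, N)} (\<lambda>_. aux) (upd {(Alice, 2, 0)} (\<lambda>_. sk)
           (deliver (Alice, 0) (unary \<eta>) empty_mem)));
         m \<leftarrow> run_wired wire_Alice (distributor N A) m;
         run_Bob_Charlie (receiver N B (verify S)) (receiver N C (verify S)) \<eta> xB xC m } =
    do { m \<leftarrow> obfuscate U \<eta> c empty_mem;
         m \<leftarrow> run_wired wire_Alice A (deliver (Alice, 0) (unary \<eta>) (deliver (Alice, 2) aux m));
         (yB, yC) \<leftarrow> run_Bob_Charlie B C \<eta> xB xC m;
         vB \<leftarrow> accepts S \<eta> sk aux xB yB;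
         vC \<leftarrow> accepts S \<eta> sk aux xC yC;
         return_pmf ([\<not> vB], [\<not> vC]) }"
proof -
  let ?s = "\<lambda>r. if r = (Alice, 2, N) then aux else if r = (Alice, 2, 0) then sk else unary \<eta>"
  let ?X = "{(Alice, 2, N), (Alice, 2, 0), (Alice, 0, 0)}"
  let ?Z = "{(Alice, 3, N), (Alice, 4, N), (Alice, 3, N + 1), (Alice, 4, N + 1)}"
  let ?q = "\<lambda>r. if r \<in> {(Alice, 3, N), (Alice, 4, N)} then sk else aux"
  let ?f = "reg wire_Alice"
  have start: "upd {(Alice, 2, N)} (\<lambda>_. aux) (upd {(Alice, 2, 0)} (\<lambda>_. sk)
      (deliver (Alice, 0) (unary \<eta>) empty_mem)) = upd ?X ?s empty_mem"
    by (intro upd_eqI) (auto simp: override_on_def)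
  have "do { m \<leftarrow> obfuscate U \<eta> c (upd ?X ?s empty_mem);
         m \<leftarrow> run_wired wire_Alice (distributor N A) m;
         run_Bob_Charlie (receiver N B (verify S)) (receiver N C (verify S)) \<eta> xB xC m } =
    do { m \<leftarrow> obfuscate U \<eta> c empty_mem;
         m \<leftarrow> run_wired wire_Alice (distributor N A) (upd ?X ?s m);
         run_Bob_Charlie (receiver N B (verify S)) (receiver N C (verify S)) \<eta> xB xC m }"
    by (subst obfuscate_upd) (auto simp: bind_map_pmf)
  also have "\<dots> = do { m \<leftarrow> obfuscate U \<eta> c empty_mem;
         m \<leftarrow> run_wired wire_Alice A (deliver (Alice, 0) (unary \<eta>) (deliver (Alice, 2) aux m));
         run_Bob_Charlie (receiver N B (verify S)) (receiver N C (verify S)) \<eta> xB xC (upd ?Z ?q m) }"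
  proof (intro bind_pmf_cong[OF refl])
    fix m assume m: "m \<in> set_pmf (obfuscate U \<eta> c empty_mem)"
    have wf: "wf_mem m" using wf_obfuscate[OF U _ m] by simp
    have cl: "cl m (Alice, p, i) = []" for p i using cl_obfuscate[OF U _ m, of Alice p i] by simp
    have f: "inj ?f" by (intro inj_reg inj_wires)
    have "run (map_prog ?f (distributor N A)) (upd ?X ?s m) =
      map_pmf (upd {?f (3, N), ?f (4, N), ?f (3, N + 1), ?f (4, N + 1)}
        (\<lambda>r. if r \<in> {?f (3, N), ?f (4, N)} then cl (upd ?X ?s m) (?f (2, 0)) else cl (upd ?X ?s m) (?f (2, N))))
      (run (map_prog ?f A) (erase {?f (2, N)} (upd {?f (2, 0)} (\<lambda>_. cl (upd ?X ?s m) (?f (2, N))) (upd ?X ?s m))))"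
      using N wf by (intro run_distributor[OF f N A]) (auto simp: cl override_on_def)
    \<comment> \<open>The auxiliary string has taken the place of the key, so \<open>A\<close>
      starts from the same memory as in \<open>pcs_expt\<close>.\<close>
    moreover have "erase {?f (2, N)} (upd {?f (2, 0)} (\<lambda>_. cl (upd ?X ?s m) (?f (2, N))) (upd ?X ?s m)) =
        deliver (Alice, 0) (unary \<eta>) (deliver (Alice, 2) aux m)"
      using N by (intro upd_eqI) (auto simp: override_on_def cl)
    moreover have "(\<lambda>r. if r \<in> {?f (3, N), ?f (4, N)} then cl (upd ?X ?s m) (?f (2, 0))
        else cl (upd ?X ?s m) (?f (2, N))) = ?q"
      using N by (intro ext) (auto simp: override_on_def)
    moreover have "{?f (3, N), ?f (4, N), ?f (3, N + 1), ?f (4, N + 1)} = ?Z" by simp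
    ultimately show "run_wired wire_Alice (distributor N A) (upd ?X ?s m) \<bind>
        run_Bob_Charlie (receiver N B (verify S)) (receiver N C (verify S)) \<eta> xB xC =
      run_wired wire_Alice A (deliver (Alice, 0) (unary \<eta>) (deliver (Alice, 2) aux m)) \<bind>
        (\<lambda>m. run_Bob_Charlie (receiver N B (verify S)) (receiver N C (verify S)) \<eta> xB xC (upd ?Z ?q m))"
      by (simp only: run_wired_eq bind_map_pmf)
  qed
  also have "\<dots> = do { m \<leftarrow> obfuscate U \<eta> c empty_mem;
         m \<leftarrow> run_wired wire_Alice A (deliver (Alice, 0) (unary \<eta>) (deliver (Alice, 2) aux m));
         (yB, yC) \<leftarrow> run_Bob_Charlie B C \<eta> xB xC m;
         vB \<leftarrow> accepts S \<eta> sk aux xB yB;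
         vC \<leftarrow> accepts S \<eta> sk aux xC yC;
         return_pmf ([\<not> vB], [\<not> vC]) }"
  proof (intro bind_pmf_cong[OF refl] run_Bob_Charlie_receiver[OF N B C V])
    fix m m' assume m: "m \<in> set_pmf (obfuscate U \<eta> c empty_mem)"
      and m': "m' \<in> set_pmf (run_wired wire_Alice A
        (deliver (Alice, 0) (unary \<eta>) (deliver (Alice, 2) aux m)))"
    have wf: "wf_mem m" using wf_obfuscate[OF U _ m] by simp
    have cl: "cl m (a, p, i) = []" if "a \<noteq> Obfuscator" for a p i
      using cl_obfuscate[OF U _ m that, of p i] by simp
    show "wf_mem m'" using wf_run_wired[OF A(1) inj_wires(2) _ m'] wf by simp
    show "cl m' (Bob, p, i) = []" "cl m' (Charlie, p, i) = []" for p i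
      using wf cl_run_wired[OF A(1) inj_wires(2) _ m', of Bob p i]
        cl_run_wired[OF A(1) inj_wires(2) _ m', of Charlie p i] by (auto simp: range_wires cl)
    show "cl m' (Alice, k, i) = []" if "N \<le> i" for k i
    proof -
      have "(Alice, k, i) \<notin> set_prog (map_prog ?f A)" using A(2) that by (auto simp: reg_def)
      then have "cl m' (Alice, k, i) = cl (deliver (Alice, 0) (unary \<eta>) (deliver (Alice, 2) aux m)) (Alice, k, i)"
        using wf m' by (intro cl_run_outside[OF terminating_wired[OF A(1) inj_wires(2)]])
          (auto simp: run_wired_eq)
      then show ?thesis using that N by (simp add: cl)
    qed
  qed
  finally show ?thesis unfolding start .
qed

section \<open>Uniform strings and negligible functions\<close>

lemma finite_strings: "finite (strings n)"
  using finite_lists_length_eq[of "UNIV :: bool set" n] by (simp add: strings_def)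

lemma strings_nonempty: "strings n \<noteq> {}"
proof -
  have "replicate n True \<in> strings n" by (simp add: strings_def)
  then show ?thesis by blast
qed

lemma uniform_pairs_eq:
  "uniform_pairs n \<eta> =
    do { x \<leftarrow> pmf_of_set (strings (n \<eta>)); y \<leftarrow> pmf_of_set (strings (n \<eta>)); return_pmf (x, y) }"
proof -
  have "uniform_pairs n \<eta> = pair_pmf (pmf_of_set (strings (n \<eta>))) (pmf_of_set (strings (n \<eta>)))"
    by (rule pmf_eqI) (auto simp: uniform_pairs_def pmf_pair pmf_of_set finite_strings
        strings_nonempty indicator_def card_cartesian_product)
  then show ?thesis by (simp add: pair_pmf_def)
qed

lemma pmf_map_True: "pmf (map_pmf f p) True = measure (measure_pmf p) {x. f x}"
  by (simp add: pmf_map vimage_def)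

text \<open>Exponent \<open>Suc d\<close> for both summands leaves a spare factor
  \<open>\<eta>\<close>, which absorbs the 2 as soon as \<open>\<eta>\<close> is at least 2.\<close>

lemma negl_add:
  assumes "negl f" "negl g" shows "negl (\<lambda>\<eta>. f \<eta> + g \<eta>)"
  unfolding negl_def
proof
  fix d
  have "eventually (\<lambda>\<eta>. \<bar>f \<eta>\<bar> < 1 / real \<eta> ^ Suc d) sequentially"
    "eventually (\<lambda>\<eta>. \<bar>g \<eta>\<bar> < 1 / real \<eta> ^ Suc d) sequentially"
    using assms unfolding negl_def by blast+
  then show "eventually (\<lambda>\<eta>. \<bar>f \<eta> + g \<eta>\<bar> < 1 / real \<eta> ^ d) sequentially"
    using eventually_ge_at_top[of 2]
  proof eventually_elim
    case (elim \<eta>)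
    have "\<bar>f \<eta> + g \<eta>\<bar> \<le> \<bar>f \<eta>\<bar> + \<bar>g \<eta>\<bar>" by (rule abs_triangle_ineq)
    also have "\<dots> < 1 / real \<eta> ^ Suc d + 1 / real \<eta> ^ Suc d" using elim(1,2) by linarith
    also have "\<dots> \<le> 1 / real \<eta> ^ d" using elim(3) by (simp add: field_simps)
    finally show ?case .
  qed
qed

section \<open>Hybrid games\<close>

text \<open>Both verdicts are kept, so that the winning events of the copy-protection experiment, of
  the attack and of the two puncturing experiments are all expressed by this distribution. The
  punctured circuit is sampled for either \<open>b\<close>, as in \<open>upo_expt\<close>.\<close>

definition hybrid ::
  "scheme \<Rightarrow> (nat \<Rightarrow> bits \<Rightarrow> circuit) \<Rightarrow> upo \<Rightarrow> alg \<Rightarrow> alg \<Rightarrow> alg \<Rightarrow> bool \<Rightarrow> nat \<Rightarrow> (bool \<times> bool) pmf"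
where
  "hybrid S F U A B C b \<eta> = do {
     (sk, aux) \<leftarrow> gen_out S \<eta>;
     (xB, xC) \<leftarrow> uniform_pairs (inlen S) \<eta>;
     G \<leftarrow> punct_out (punct S) \<eta> sk xB xC;
     m \<leftarrow> obfuscate U \<eta> (if b then G else encode (F \<eta> sk)) empty_mem;
     m \<leftarrow> run_wired wire_Alice A (deliver (Alice, 0) (unary \<eta>) (deliver (Alice, 2) aux m));
     (yB, yC) \<leftarrow> run_Bob_Charlie B C \<eta> xB xC m;
     vB \<leftarrow> accepts S \<eta> sk aux xB yB;
     vC \<leftarrow> accepts S \<eta> sk aux xC yC;
     return_pmf (vB, vC)
   }"

text \<open>Nothing that happens before Bob and Charlie act depends on their points, so these may be
  drawn in advance. The punctured circuit is discarded and contributes total mass one.\<close>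

lemma pcs_expt_hybrid:
  "pcs_expt S F U A B C \<eta> = map_pmf (\<lambda>(vB, vC). vB \<and> vC) (hybrid S F U A B C False \<eta>)"
proof -
  let ?X = "pmf_of_set (strings (inlen S \<eta>))"
  have "do { m \<leftarrow> M; x \<leftarrow> ?X; y \<leftarrow> ?X; f m x y } = do { x \<leftarrow> ?X; y \<leftarrow> ?X; m \<leftarrow> M; f m x y }"
    for M :: "joint_mem pmf" and f :: "joint_mem \<Rightarrow> bits \<Rightarrow> bits \<Rightarrow> bool pmf"
    by (subst bind_commute_pmf, subst (2) bind_commute_pmf) rule
  note commute = this[of "do { m \<leftarrow> obfuscate U \<eta> (encode (F \<eta> sk)) empty_mem;
      run_wired wire_Alice A (deliver (Alice, 0) (unary \<eta>) (deliver (Alice, 2) aux m)) }"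
    "\<lambda>m xB xC. do { (yB, yC) \<leftarrow> run_Bob_Charlie B C \<eta> xB xC m;
     vB \<leftarrow> accepts S \<eta> sk aux xB yB;
     vC \<leftarrow> accepts S \<eta> sk aux xC yC;
     return_pmf (vB \<and> vC) }" for sk aux, unfolded bind_assoc_pmf]
  show ?thesis
    unfolding pcs_expt_def commute hybrid_def uniform_pairs_eq
    by (simp add: map_bind_pmf bind_assoc_pmf bind_return_pmf split_def)
qed

locale reduction =
  fixes S :: scheme and F :: "nat \<Rightarrow> bits \<Rightarrow> circuit" and U :: upo and A B C :: alg and N :: nat
  assumes N: "4 < N"
    and U: "poly_time (obf U)"
    and A: "poly_time A" "set_prog A \<subseteq> {..<N} \<times> {..<N}"
    and B: "poly_time B" "set_prog B \<subseteq> {..<N} \<times> {..<N}"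
    and C: "poly_time C" "set_prog C \<subseteq> {..<N} \<times> {..<N}"
    and G: "PPT (gen S)" and V: "PPT (verify S)"
    and length_sk: "\<And>\<eta> sk aux. (sk, aux) \<in> set_pmf (gen_out S \<eta>) \<Longrightarrow> length sk = \<eta>"
begin

text \<open>The garbage of \<open>sampler\<close> sits at Alice's ports from \<open>N\<close> on.
  The distributor stays below them, and Bob and Charlie get only her ports 3 and 4.\<close>

lemma erase_parts:
  assumes Y: "Y = {Alice} \<times> {N..} \<times> UNIV"
  shows "obfuscate U \<eta> c (erase Y m) = map_pmf (erase Y) (obfuscate U \<eta> c m)"
    and "run_wired wire_Alice (distributor N A) (erase Y m) =
      map_pmf (erase Y) (run_wired wire_Alice (distributor N A) m)"
    and "run_Bob_Charlie B' C' \<eta> xB xC (erase Y m) = run_Bob_Charlie B' C' \<eta> xB xC m"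
proof -
  show "obfuscate U \<eta> c (erase Y m) = map_pmf (erase Y) (obfuscate U \<eta> c m)"
    unfolding Y by (rule obfuscate_upd) auto
  show "run_wired wire_Alice (distributor N A) (erase Y m) =
      map_pmf (erase Y) (run_wired wire_Alice (distributor N A) m)"
    unfolding run_wired_eq Y
    by (rule run_upd(1)) (use A(2) N in \<open>auto simp: distributor_def reg_def split: if_splits\<close>)
  have deliver: "deliver (X, p) s (deliver (X, q) t (erase Y m)) =
      erase Y (deliver (X, p) s (deliver (X, q) t m))" if "X \<noteq> Alice" for X p q s t m
    using that unfolding Y by (intro upd_eqI) (auto simp: override_on_def)
  have "run_wired ((Pair Bob)(2 := (Alice, 3))) B' (erase Y m) =
      map_pmf (erase Y) (run_wired ((Pair Bob)(2 := (Alice, 3))) B' m)"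
    "run_wired ((Pair Charlie)(2 := (Alice, 4))) C' (erase Y m) =
      map_pmf (erase Y) (run_wired ((Pair Charlie)(2 := (Alice, 4))) C' m)" for m
    by (rule run_wired_upd; use N in \<open>auto simp: Y range_wires\<close>)+
  moreover have "received (Bob, 3) (erase Y m) = received (Bob, 3) m"
    "received (Charlie, 3) (erase Y m) = received (Charlie, 3) m" for m
    by (simp_all add: received_def Y)
  ultimately show "run_Bob_Charlie B' C' \<eta> xB xC (erase Y m) = run_Bob_Charlie B' C' \<eta> xB xC m"
    unfolding run_Bob_Charlie_def by (simp only: deliver bind_map_pmf party.distinct not_False_eq_True)
qed

text \<open>The first stage is known only up to erasure, so the rest of the experiment is packed
  into a continuation \<open>K\<close> that ignores the erased registers. A guess is right iff the
  verdict is the negation of \<open>b\<close>.\<close>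

lemma upo_expt_hybrid:
  "upo_expt U (eval_class S F) (uniform_pairs (inlen S)) (sampler N (gen S)) (distributor N A)
     (receiver N B (verify S)) (receiver N C (verify S)) \<eta> =
   do { b \<leftarrow> pmf_of_set UNIV;
        map_pmf (\<lambda>(vB, vC). vB = (\<not> b) \<and> vC = (\<not> b)) (hybrid S F U A B C b \<eta>) }"
proof -
  let ?u = "deliver (Alice, 0) (unary \<eta>) empty_mem"
  let ?Y = "{Alice} \<times> {N..} \<times> (UNIV :: nat set)"
  define M where "M = (\<lambda>sk aux. upd {(Alice, 2, N)} (\<lambda>_. aux) (upd {(Alice, 2, 0)} (\<lambda>_. sk) ?u))"
  have sample: "map_pmf (erase ?Y) (run_wired (Pair Alice) (sampler N (gen S)) ?u) =
      map_pmf (\<lambda>(sk, aux). M sk aux) (gen_out S \<eta>)"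
  proof -
    let ?f = "reg (Pair Alice)"
    have "high ?f N = ?Y" by (force simp: high_def image_iff)
    moreover have "map_pmf (erase (high ?f N)) (run (map_prog ?f (sampler N (gen S))) ?u) =
      map_pmf (\<lambda>m'. upd {?f (2, N)} (\<lambda>_. cl m' (2, 0)) (upd {?f (2, 0)} (\<lambda>_. cl m' (1, 0)) ?u))
        (run (gen S) (load [unary \<eta>]))"
      by (rule run_sampler[OF inj_reg[OF inj_wires(1)] N G]) auto
    ultimately show ?thesis
      by (simp add: run_wired_eq gen_out_def pmf.map_comp o_def M_def)
  qed
  define K where "K = (\<lambda>b m. let k = received (Alice, 2) m in
     if k \<notin> strings \<eta> then return_pmf False
     else do {
       (xB, xC) \<leftarrow> uniform_pairs (inlen S) \<eta>;
       G \<leftarrow> punct_out (punct S) \<eta> k xB xC;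
       m \<leftarrow> obfuscate U \<eta> (if b then G else encode (F \<eta> k)) m;
       m \<leftarrow> run_wired wire_Alice (distributor N A) m;
       (bB, bC) \<leftarrow> run_Bob_Charlie (receiver N B (verify S)) (receiver N C (verify S)) \<eta> xB xC m;
       return_pmf (bB = [b] \<and> bC = [b])
     })"
  have K_erase: "K b (erase ?Y m) = K b m" for b m
  proof -
    have "received (Alice, 2) (erase ?Y m) = received (Alice, 2) m" using N by (simp add: received_def)
    then show ?thesis unfolding K_def by (simp only: erase_parts[OF refl] bind_map_pmf)
  qed
  have K_M: "K b (M sk aux) = do {
       (xB, xC) \<leftarrow> uniform_pairs (inlen S) \<eta>;
       G \<leftarrow> punct_out (punct S) \<eta> sk xB xC;
       m \<leftarrow> obfuscate U \<eta> (if b then G else encode (F \<eta> sk)) empty_mem;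
       m \<leftarrow> run_wired wire_Alice A (deliver (Alice, 0) (unary \<eta>) (deliver (Alice, 2) aux m));
       (yB, yC) \<leftarrow> run_Bob_Charlie B C \<eta> xB xC m;
       vB \<leftarrow> accepts S \<eta> sk aux xB yB;
       vC \<leftarrow> accepts S \<eta> sk aux xC yC;
       return_pmf (vB = (\<not> b) \<and> vC = (\<not> b)) }"
    if "(sk, aux) \<in> set_pmf (gen_out S \<eta>)" for b sk aux
  proof -
    \<comment> \<open>A sampled key has length \<open>\<eta>\<close>, so the attack never falls into
      the branch for invalid keys.\<close>
    have "sk \<in> strings \<eta>" using length_sk[OF that] by (simp add: strings_def)
    moreover have "received (Alice, 2) (M sk aux) = sk" using N by (simp add: M_def received_def)
    moreover have "do { m \<leftarrow> obfuscate U \<eta> c (M sk aux);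
         m \<leftarrow> run_wired wire_Alice (distributor N A) m;
         (bB, bC) \<leftarrow> run_Bob_Charlie (receiver N B (verify S)) (receiver N C (verify S)) \<eta> xB xC m;
         return_pmf (bB = [b] \<and> bC = [b]) } =
       do { m \<leftarrow> obfuscate U \<eta> c empty_mem;
         m \<leftarrow> run_wired wire_Alice A (deliver (Alice, 0) (unary \<eta>) (deliver (Alice, 2) aux m));
         (yB, yC) \<leftarrow> run_Bob_Charlie B C \<eta> xB xC m;
         vB \<leftarrow> accepts S \<eta> sk aux xB yB;
         vC \<leftarrow> accepts S \<eta> sk aux xC yC;
         return_pmf (vB = (\<not> b) \<and> vC = (\<not> b)) }" for c xB xC
    proof -
      have neg: "([\<not> v] = [b]) = (v = (\<not> b))" for v by auto
      show ?thesis
        using arg_cong[OF run_distributor_receivers[OF N U A B C V, of \<eta> c aux sk xB xC],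
          of "\<lambda>p. p \<bind> (\<lambda>(bB, bC). return_pmf (bB = [b] \<and> bC = [b]))"]
        unfolding M_def by (simp only: bind_assoc_pmf bind_return_pmf split_def fst_conv snd_conv neg)
    qed
    ultimately show ?thesis unfolding K_def by (simp only: Let_def not_True_eq_False if_False simp_thms)
  qed
  have "upo_expt U (eval_class S F) (uniform_pairs (inlen S)) (sampler N (gen S)) (distributor N A)
     (receiver N B (verify S)) (receiver N C (verify S)) \<eta> =
     do { b \<leftarrow> pmf_of_set UNIV; run_wired (Pair Alice) (sampler N (gen S)) ?u \<bind> K b }"
  proof -
    have "keys (eval_class S F) = strings" "circ (eval_class S F) = F" "class_punct (eval_class S F) = punct S"
      by (simp_all add: eval_class_def)
    then show ?thesis unfolding upo_expt_def K_def by (simp only:)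
  qed
  also have "\<dots> = do { b \<leftarrow> pmf_of_set UNIV;
      map_pmf (erase ?Y) (run_wired (Pair Alice) (sampler N (gen S)) ?u) \<bind> K b }"
    by (simp only: bind_map_pmf K_erase)
  also have "\<dots> = do { b \<leftarrow> pmf_of_set UNIV; (sk, aux) \<leftarrow> gen_out S \<eta>; K b (M sk aux) }"
    unfolding sample by (simp add: bind_map_pmf split_def)
  also have "\<dots> = do { b \<leftarrow> pmf_of_set UNIV;
      map_pmf (\<lambda>(vB, vC). vB = (\<not> b) \<and> vC = (\<not> b)) (hybrid S F U A B C b \<eta>) }"
  proof (intro bind_pmf_cong[OF refl])
    fix b
    have "gen_out S \<eta> \<bind> (\<lambda>(sk, aux). K b (M sk aux)) = gen_out S \<eta> \<bind> (\<lambda>(sk, aux). do {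
       (xB, xC) \<leftarrow> uniform_pairs (inlen S) \<eta>;
       G \<leftarrow> punct_out (punct S) \<eta> sk xB xC;
       m \<leftarrow> obfuscate U \<eta> (if b then G else encode (F \<eta> sk)) empty_mem;
       m \<leftarrow> run_wired wire_Alice A (deliver (Alice, 0) (unary \<eta>) (deliver (Alice, 2) aux m));
       (yB, yC) \<leftarrow> run_Bob_Charlie B C \<eta> xB xC m;
       vB \<leftarrow> accepts S \<eta> sk aux xB yB;
       vC \<leftarrow> accepts S \<eta> sk aux xC yC;
       return_pmf (vB = (\<not> b) \<and> vC = (\<not> b)) })"
    proof (rule bind_pmf_cong[OF refl], clarify)
      fix sk aux assume "(sk, aux) \<in> set_pmf (gen_out S \<eta>)"
      from K_M[OF this, of b] show "K b (M sk aux) = do {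
       (xB, xC) \<leftarrow> uniform_pairs (inlen S) \<eta>;
       G \<leftarrow> punct_out (punct S) \<eta> sk xB xC;
       m \<leftarrow> obfuscate U \<eta> (if b then G else encode (F \<eta> sk)) empty_mem;
       m \<leftarrow> run_wired wire_Alice A (deliver (Alice, 0) (unary \<eta>) (deliver (Alice, 2) aux m));
       (yB, yC) \<leftarrow> run_Bob_Charlie B C \<eta> xB xC m;
       vB \<leftarrow> accepts S \<eta> sk aux xB yB;
       vC \<leftarrow> accepts S \<eta> sk aux xC yC;
       return_pmf (vB = (\<not> b) \<and> vC = (\<not> b)) }" .
    qed
    also have "\<dots> = map_pmf (\<lambda>(vB, vC). vB = (\<not> b) \<and> vC = (\<not> b)) (hybrid S F U A B C b \<eta>)"
      unfolding hybrid_def by (simp only: map_bind_pmf split_def map_return_pmf fst_conv snd_conv)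
    finally show "gen_out S \<eta> \<bind> (\<lambda>(sk, aux). K b (M sk aux)) =
        map_pmf (\<lambda>(vB, vC). vB = (\<not> b) \<and> vC = (\<not> b)) (hybrid S F U A B C b \<eta>)" .
  qed
  finally show ?thesis .
qed

text \<open>By no signalling, the answer of Charlie is the same whether or not Bob acts before him.\<close>

lemma run_Bob_Charlie_marginals:
  assumes "wf_mem m"
  shows "map_pmf fst (run_Bob_Charlie B C \<eta> xB xC m) = do {
      m \<leftarrow> run_wired ((Pair Bob)(2 := (Alice, 3))) B (deliver (Bob, 0) (unary \<eta>) (deliver (Bob, 1) xB m));
      return_pmf (received (Bob, 3) m) }"
    and "map_pmf snd (run_Bob_Charlie B C \<eta> xB xC m) = do {
      m \<leftarrow> run_wired ((Pair Charlie)(2 := (Alice, 4))) C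
        (deliver (Charlie, 0) (unary \<eta>) (deliver (Charlie, 1) xC m));
      return_pmf (received (Charlie, 3) m) }"
proof -
  let ?wB = "(Pair Bob)(2 := (Alice, 3))" and ?wC = "(Pair Charlie)(2 := (Alice, 4))"
  let ?RB = "run_wired ?wB B" and ?RC = "run_wired ?wC C"
  let ?dB = "\<lambda>m. deliver (Bob, 0) (unary \<eta>) (deliver (Bob, 1) xB m)"
  let ?dC = "\<lambda>m. deliver (Charlie, 0) (unary \<eta>) (deliver (Charlie, 1) xC m)"
  have "map_pmf fst (run_Bob_Charlie B C \<eta> xB xC m) =
      do { m' \<leftarrow> ?RB (?dB m); m'' \<leftarrow> ?RC (?dC m'); return_pmf (received (Bob, 3) m'') }"
    by (simp add: run_Bob_Charlie_def map_bind_pmf)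
  \<comment> \<open>Bob acts first, so his answer is settled before Charlie's run, which then drops
    out.\<close>
  also have "\<dots> = do { m' \<leftarrow> ?RB (?dB m); m'' \<leftarrow> ?RC (?dC m'); return_pmf (received (Bob, 3) m') }"
  proof (intro bind_pmf_cong[OF refl])
    fix m' m'' assume m': "m' \<in> set_pmf (?RB (?dB m))" and m'': "m'' \<in> set_pmf (?RC (?dC m'))"
    have "wf_mem m'" using wf_run_wired[OF B(1) inj_wires(3) _ m'] assms by simp
    then have "cl m'' (Bob, 3, 0) = cl m' (Bob, 3, 0)"
      using cl_run_wired[OF C(1) inj_wires(4) _ m'', of Bob 3 0] by (auto simp: range_wires)
    then show "return_pmf (received (Bob, 3) m'') = return_pmf (received (Bob, 3) m')"
      by (simp add: received_def)
  qed
  finally show "map_pmf fst (run_Bob_Charlie B C \<eta> xB xC m) =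
      do { m \<leftarrow> ?RB (?dB m); return_pmf (received (Bob, 3) m) }" by simp
  let ?XB = "{(Bob, 0, 0), (Bob, 1, 0)}" and ?XC = "{(Charlie, 0, 0), (Charlie, 1, 0)}"
  let ?sB = "\<lambda>r. if r = (Bob, 0, 0) then unary \<eta> else xB"
  let ?sC = "\<lambda>r. if r = (Charlie, 0, 0) then unary \<eta> else xC"
  have dB: "?dB m = upd ?XB ?sB m" and dC: "?dC m = upd ?XC ?sC m" for m
    by (intro upd_eqI; auto simp: override_on_def)+
  have comm: "upd ?XC ?sC (upd ?XB ?sB m) = upd ?XB ?sB (upd ?XC ?sC m)"
    by (intro upd_eqI) (auto simp: override_on_def)
  have RB: "?RB (upd ?XC ?sC m) = map_pmf (upd ?XC ?sC) (?RB m)" for m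
    by (rule run_wired_upd) (auto simp: range_wires)
  have RC: "?RC (upd ?XB ?sB m) = map_pmf (upd ?XB ?sB) (?RC m)" for m
    by (rule run_wired_upd) (auto simp: range_wires)
  let ?res = "\<lambda>m. return_pmf (received (Charlie, 3) m)"
  have "map_pmf snd (run_Bob_Charlie B C \<eta> xB xC m) = ?RB (?dB m) \<bind> (\<lambda>m. ?RC (?dC m)) \<bind> ?res"
    by (simp add: run_Bob_Charlie_def map_bind_pmf bind_assoc_pmf)
  \<comment> \<open>Charlie's input is delivered before Bob acts, so that the two runs become
    adjacent and can be exchanged.\<close>
  also have "?RB (?dB m) \<bind> (\<lambda>m. ?RC (?dC m)) = ?RB (?dC (?dB m)) \<bind> ?RC"
    unfolding dB dC RB by (simp only: bind_map_pmf)
  also have "\<dots> = ?RC (?dC (?dB m)) \<bind> ?RB"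
  proof -
    have "set_prog (map_prog (reg ?wB) B) \<inter> set_prog (map_prog (reg ?wC) C) = {}"
      by (auto simp: reg_def split: if_splits)
    then show ?thesis
      unfolding run_wired_eq using assms terminating_wired[OF B(1) inj_wires(3)]
        terminating_wired[OF C(1) inj_wires(4)] by (intro run_commute) (auto simp: terminating_def)
  qed
  also have "\<dots> \<bind> ?res = ?RC (?dC (?dB m)) \<bind> ?res"
    unfolding bind_assoc_pmf
  proof (rule bind_pmf_cong[OF refl])
    fix m' assume m': "m' \<in> set_pmf (?RC (?dC (?dB m)))"
    have wf: "wf_mem m'" using wf_run_wired[OF C(1) inj_wires(4) _ m'] assms by simp
    \<comment> \<open>Bob now runs last and cannot change Charlie's answer, so his run drops
      out.\<close>
    have "?RB m' \<bind> ?res = ?RB m' \<bind> (\<lambda>_. ?res m')"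
    proof (rule bind_pmf_cong[OF refl])
      fix m'' assume m'': "m'' \<in> set_pmf (?RB m')"
      have "cl m'' (Charlie, 3, 0) = cl m' (Charlie, 3, 0)"
        using cl_run_wired[OF B(1) inj_wires(3) wf m'', of Charlie 3 0] by (auto simp: range_wires)
      then show "?res m'' = ?res m'" by (simp add: received_def)
    qed
    then show "?RB m' \<bind> ?res = ?res m'" by simp
  qed
  also have "\<dots> = ?RC (?dC m) \<bind> ?res"
    unfolding dB dC comm RC by (simp add: bind_map_pmf received_def)
  finally show "map_pmf snd (run_Bob_Charlie B C \<eta> xB xC m) =
      do { m \<leftarrow> ?RC (?dC m); return_pmf (received (Charlie, 3) m) }" .
qed

text \<open>Bob is challenged at the first punctured point and Charlie at the second. Each marginal
  is thus a puncturing experiment of its own, one for each value of \<open>first\<close>.\<close>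

lemma hybrid_marginals:
  obtains D1 D2 where "QPT D1" "QPT D2"
    "\<And>\<eta>. map_pmf fst (hybrid S F U A B C True \<eta>) = punct_expt S True D1 \<eta>"
    "\<And>\<eta>. map_pmf snd (hybrid S F U A B C True \<eta>) = punct_expt S False D2 \<eta>"
proof -
  obtain D1 where D1: "QPT D1" and out1: "\<And>\<eta> x aux c. out 4 D1 [unary \<eta>, x, aux, c] = do {
       m \<leftarrow> obfuscate U \<eta> c empty_mem;
       m \<leftarrow> run_wired wire_Alice A (deliver (Alice, 0) (unary \<eta>) (deliver (Alice, 2) aux m));
       m \<leftarrow> run_wired ((Pair Bob)(2 := (Alice, 3))) B
         (deliver (Bob, 0) (unary \<eta>) (deliver (Bob, 1) x m));
       return_pmf (received (Bob, 3) m) }"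
    using puncturing_adversary[OF _ U A(1) B(1), of Bob 3] by blast
  obtain D2 where D2: "QPT D2" and out2: "\<And>\<eta> x aux c. out 4 D2 [unary \<eta>, x, aux, c] = do {
       m \<leftarrow> obfuscate U \<eta> c empty_mem;
       m \<leftarrow> run_wired wire_Alice A (deliver (Alice, 0) (unary \<eta>) (deliver (Alice, 2) aux m));
       m \<leftarrow> run_wired ((Pair Charlie)(2 := (Alice, 4))) C
         (deliver (Charlie, 0) (unary \<eta>) (deliver (Charlie, 1) x m));
       return_pmf (received (Charlie, 3) m) }"
    using puncturing_adversary[OF _ U A(1) C(1), of Charlie 4] by blast
  let ?T = "\<lambda>\<eta> aux c. do { m \<leftarrow> obfuscate U \<eta> c empty_mem;
     run_wired wire_Alice A (deliver (Alice, 0) (unary \<eta>) (deliver (Alice, 2) aux m)) }"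
  have wf: "wf_mem m" if "m \<in> set_pmf (?T \<eta> aux c)" for m \<eta> aux c
  proof -
    from that obtain m0 where m0: "m0 \<in> set_pmf (obfuscate U \<eta> c empty_mem)"
      and m: "m \<in> set_pmf (run_wired wire_Alice A (deliver (Alice, 0) (unary \<eta>) (deliver (Alice, 2) aux m0)))"
      by auto
    have "wf_mem m0" by (rule wf_obfuscate[OF U wf_empty_mem m0])
    then show ?thesis using wf_run_wired[OF A(1) inj_wires(2) _ m] by simp
  qed
  \<comment> \<open>\<open>xC\<close> is arbitrary because Bob's marginal does not depend on it. So
    \<open>D1\<close>, which is not given the other point, still reproduces the hybrid.\<close>
  have out1: "out 4 D1 [unary \<eta>, x, aux, c] =
      ?T \<eta> aux c \<bind> (\<lambda>m. map_pmf fst (run_Bob_Charlie B C \<eta> x xC m))" for \<eta> x aux c xC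
  proof -
    have "out 4 D1 [unary \<eta>, x, aux, c] = ?T \<eta> aux c \<bind> (\<lambda>m. do {
       m \<leftarrow> run_wired ((Pair Bob)(2 := (Alice, 3))) B
         (deliver (Bob, 0) (unary \<eta>) (deliver (Bob, 1) x m));
       return_pmf (received (Bob, 3) m) })"
      unfolding out1 by (simp only: bind_assoc_pmf)
    also have "\<dots> = ?T \<eta> aux c \<bind> (\<lambda>m. map_pmf fst (run_Bob_Charlie B C \<eta> x xC m))"
      by (intro bind_pmf_cong[OF refl]) (rule run_Bob_Charlie_marginals(1)[OF wf, symmetric])
    finally show ?thesis .
  qed
  have out2: "out 4 D2 [unary \<eta>, x, aux, c] =
      ?T \<eta> aux c \<bind> (\<lambda>m. map_pmf snd (run_Bob_Charlie B C \<eta> xB x m))" for \<eta> x aux c xB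
  proof -
    have "out 4 D2 [unary \<eta>, x, aux, c] = ?T \<eta> aux c \<bind> (\<lambda>m. do {
       m \<leftarrow> run_wired ((Pair Charlie)(2 := (Alice, 4))) C
         (deliver (Charlie, 0) (unary \<eta>) (deliver (Charlie, 1) x m));
       return_pmf (received (Charlie, 3) m) })"
      unfolding out2 by (simp only: bind_assoc_pmf)
    also have "\<dots> = ?T \<eta> aux c \<bind> (\<lambda>m. map_pmf snd (run_Bob_Charlie B C \<eta> xB x m))"
      by (intro bind_pmf_cong[OF refl]) (rule run_Bob_Charlie_marginals(2)[OF wf, symmetric])
    finally show ?thesis .
  qed
  have "map_pmf fst (hybrid S F U A B C True \<eta>) = punct_expt S True D1 \<eta>" for \<eta>
  proof -
    have "do { y \<leftarrow> out 4 D1 [unary \<eta>, xB, aux, c]; accepts S \<eta> sk aux xB y } =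
      do { m \<leftarrow> ?T \<eta> aux c; (yB, yC) \<leftarrow> run_Bob_Charlie B C \<eta> xB xC m;
        vB \<leftarrow> accepts S \<eta> sk aux xB yB; vC \<leftarrow> accepts S \<eta> sk aux xC yC; return_pmf vB }"
      for xB xC c sk aux
      unfolding out1[where xC = xC]
      by (simp add: bind_assoc_pmf bind_map_pmf split_def bind_return_pmf')
    then show ?thesis
      unfolding hybrid_def punct_expt_def uniform_pairs_eq
      by (simp add: map_bind_pmf bind_assoc_pmf bind_return_pmf split_def)
  qed
  moreover have "map_pmf snd (hybrid S F U A B C True \<eta>) = punct_expt S False D2 \<eta>" for \<eta>
  proof -
    have "do { y \<leftarrow> out 4 D2 [unary \<eta>, xC, aux, c]; accepts S \<eta> sk aux xC y } =
      do { m \<leftarrow> ?T \<eta> aux c; (yB, yC) \<leftarrow> run_Bob_Charlie B C \<eta> xB xC m;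
        vB \<leftarrow> accepts S \<eta> sk aux xB yB; vC \<leftarrow> accepts S \<eta> sk aux xC yC; return_pmf vC }"
      for xB xC c sk aux
      unfolding out2[where xB = xB]
      by (simp add: bind_assoc_pmf bind_map_pmf split_def bind_return_pmf')
    then show ?thesis
      unfolding hybrid_def punct_expt_def uniform_pairs_eq
      by (simp add: map_bind_pmf bind_assoc_pmf bind_return_pmf split_def)
  qed
  ultimately show ?thesis using that D1 D2 by blast
qed

end

section \<open>Probability estimates and conclusion\<close>

lemma pmf_bind_coin:
  "pmf (pmf_of_set UNIV \<bind> f) x = (pmf (f False) x + pmf (f True) x) / 2" for f :: "bool \<Rightarrow> 'a pmf"
  by (simp add: pmf_bind_pmf_of_set UNIV_bool)

text \<open>Union bound; the two verdicts may be correlated through entanglement, so only their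
  marginals enter.\<close>

lemma neither_ge:
  "pmf (map_pmf (\<lambda>(v, w). \<not> v \<and> \<not> w) p) True \<ge> 1 - pmf (map_pmf fst p) True - pmf (map_pmf snd p) True"
proof -
  let ?P = "measure (measure_pmf p)"
  have "1 = ?P UNIV" by simp
  also have "\<dots> \<le> ?P ({x. \<not> fst x \<and> \<not> snd x} \<union> ({x. fst x} \<union> {x. snd x}))"
    by (rule measure_pmf.finite_measure_mono) auto
  also have "\<dots> \<le> ?P {x. \<not> fst x \<and> \<not> snd x} + ?P ({x. fst x} \<union> {x. snd x})"
    by (rule measure_Un_le) auto
  also have "?P ({x. fst x} \<union> {x. snd x}) \<le> ?P {x. fst x} + ?P {x. snd x}"
    by (rule measure_Un_le) auto
  finally show ?thesis by (simp add: pmf_map_True split_def)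
qed

lemma finite_registers_bound:
  assumes "finite (R :: (nat \<times> nat) set)" obtains n where "R \<subseteq> {..<n} \<times> {..<n}"
proof -
  have "finite (fst ` R \<union> snd ` R)" using assms by simp
  then obtain n where n: "\<forall>i \<in> fst ` R \<union> snd ` R. i < n"
    unfolding finite_nat_set_iff_bounded ..
  have "R \<subseteq> {..<n} \<times> {..<n}"
  proof
    fix r assume "r \<in> R"
    then have "fst r < n" "snd r < n" using n by auto
    then show "r \<in> {..<n} \<times> {..<n}" by (cases r) auto
  qed
  with that show ?thesis .
qed

theorem theorem1:
  fixes S :: scheme and F :: "nat \<Rightarrow> bits \<Rightarrow> circuit" and U :: upo
  assumes "puncturable_scheme S"
    and "computes_eval S F"
    and "puncturable_class (eval_class S F)"
    and "secure_upo_scheme U (eval_class S F) (uniform_pairs (inlen S))"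
  shows "\<forall>A B C. QPT A \<and> QPT B \<and> QPT C \<longrightarrow>
    (\<exists>\<nu>. negl \<nu> \<and> (\<forall>\<eta>. pmf (pcs_expt S F U A B C \<eta>) True \<le> \<nu> \<eta>))"
proof (intro allI impI)
  fix A B C assume "QPT A \<and> QPT B \<and> QPT C"
  then have ABC: "poly_time A" "poly_time B" "poly_time C" by (simp_all add: QPT_def)
  have scheme: "PPT (gen S)" "PPT (verify S)" "secure_scheme S"
    and len: "\<And>\<eta> sk aux. (sk, aux) \<in> set_pmf (gen_out S \<eta>) \<Longrightarrow> length sk = \<eta>"
    using assms(1) unfolding puncturable_scheme_def by blast+
  have U: "poly_time (obf U)" "secure_upo U (eval_class S F) (uniform_pairs (inlen S))"
    using assms(4) by (simp_all add: secure_upo_scheme_def QPT_def)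
  obtain n where n: "set_prog A \<union> set_prog B \<union> set_prog C \<subseteq> {..<n} \<times> {..<n}"
    by (rule finite_registers_bound[of "set_prog A \<union> set_prog B \<union> set_prog C"]) simp_all
  \<comment> \<open>\<open>n\<close> bounds all ports and registers of the pirate. The additional 5
    puts the interface ports 0 to 4 below \<open>N\<close> as well.\<close>
  define N where "N = n + 5"
  have N: "set_prog A \<subseteq> {..<N} \<times> {..<N}" "set_prog B \<subseteq> {..<N} \<times> {..<N}" "set_prog C \<subseteq> {..<N} \<times> {..<N}"
    "4 < N" using n by (auto simp: N_def)
  interpret red: reduction S F U A B C N
    by unfold_locales (use N U(1) ABC scheme len in auto)
  let ?A1 = "sampler N (gen S)" and ?A2 = "distributor N A"
  let ?B = "receiver N B (verify S)" and ?C = "receiver N C (verify S)"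
  have "QPT ?A1" "QPT ?A2" "QPT ?B" "QPT ?C"
    using ABC scheme(1,2) N(4) poly_time_reduction unfolding QPT_def PPT_def by blast+
  then obtain \<nu> where \<nu>: "negl \<nu>" "\<And>\<eta>. pmf (upo_expt U (eval_class S F) (uniform_pairs (inlen S))
      ?A1 ?A2 ?B ?C \<eta>) True \<le> 1 / 2 + \<nu> \<eta>"
    using U(2) unfolding secure_upo_def by blast
  obtain D1 D2 where D: "QPT D1" "QPT D2"
    and fst: "\<And>\<eta>. map_pmf fst (hybrid S F U A B C True \<eta>) = punct_expt S True D1 \<eta>"
    and snd: "\<And>\<eta>. map_pmf snd (hybrid S F U A B C True \<eta>) = punct_expt S False D2 \<eta>"
    using red.hybrid_marginals by blast
  let ?\<mu>1 = "\<lambda>\<eta>. pmf (punct_expt S True D1 \<eta>) True"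
  let ?\<mu>2 = "\<lambda>\<eta>. pmf (punct_expt S False D2 \<eta>) True"
  have negl: "negl ?\<mu>1" "negl ?\<mu>2" using D scheme(3) by (simp_all add: secure_scheme_def)
  show "\<exists>\<nu>. negl \<nu> \<and> (\<forall>\<eta>. pmf (pcs_expt S F U A B C \<eta>) True \<le> \<nu> \<eta>)"
  proof (intro exI conjI allI)
    show "negl (\<lambda>\<eta>. (\<nu> \<eta> + \<nu> \<eta>) + (?\<mu>1 \<eta> + ?\<mu>2 \<eta>))"
      using negl \<nu>(1) by (intro negl_add)
    fix \<eta>
    \<comment> \<open>The average over \<open>b\<close> is at most
      \<open>1 / 2 + \<nu> \<eta>\<close>. Multiplying by 2 doubles \<open>\<nu>\<close>, and the
      union bound adds the two puncturing advantages.\<close>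
    have "(pmf (pcs_expt S F U A B C \<eta>) True +
        pmf (map_pmf (\<lambda>(v, w). \<not> v \<and> \<not> w) (hybrid S F U A B C True \<eta>)) True) / 2 \<le> 1 / 2 + \<nu> \<eta>"
      using \<nu>(2)[of \<eta>] unfolding red.upo_expt_hybrid pmf_bind_coin pcs_expt_hybrid by simp
    then show "pmf (pcs_expt S F U A B C \<eta>) True \<le> (\<nu> \<eta> + \<nu> \<eta>) + (?\<mu>1 \<eta> + ?\<mu>2 \<eta>)"
      using neither_ge[of "hybrid S F U A B C True \<eta>"] unfolding fst snd by argo
  qed
qed

end
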